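(* Let $G\in\mathcal{G}_2$ be a Lie group with Lie algebra $\mathfrak{g}$, equipped with a left invariant $(\alpha,\beta)$-metric $F$ defined by a left invariant Riemannian metric $g$ and a left invariant vector field $X$. Let $\mathfrak{g}'$ be the one-dimensional Lie algebra of the commutator group of $G$, and let $\Gamma\subset\mathfrak{g}$ be the hyperplane orthogonal, with respect to $g$, to a unit element of $\mathfrak{g}'$. Then: (a) if $F$ is a Randers metric, $F(x,y)=\sqrt{g(y,y)}+g(X(x),y)$, then $F$ is of Douglas type if and only if $X\in\Gamma$; (b) $F$ is of Berwald type if and only if $X\in\Gamma\cap\mathfrak{z}(\mathfrak{g})$, where $\mathfrak{z}(\mathfrak{g})$ denotes the center of $\mathfrak{g}$.
   Context: $\mathcal{G}_2$ is the family of Lie groups $G$ whose commutator group $G'$ is one-dimensional. A Finsler metric on a manifold $M$ is a function $F:TM\to[0,\infty)$, smooth on $TM\setminus\{0\}$, with $F(x,\lambda y)=\lambda F(x,y)$ for $\lambda>0$, and with $(g_{ij})=\left(\frac12\frac{\partial^2F^2}{\partial y^i\partial y^j}\right)$ positive definite on $TM\setminus\{0\}$. On a Lie group with identity $e$, $F$ is left invariant if $F(x,y)=F(e,dl_{x^{-1}}y)$. An $(\alpha,\beta)$-metric defined by a Riemannian metric $g$ and a vector field $X$ is a Finsler metric of the form $F=\alpha\,\phi(\beta/\alpha)$, where $\alpha(x,y)=\sqrt{g(y,y)}$, $\beta$ is the 1-form $\beta(x,y)=g(X(x),y)$, and $\phi$ is a $C^\infty$ function. (Such an $F$ is a Finsler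 metric if $\phi:(-b_0,b_0)\to\mathbb{R}^+$ satisfies $\phi(s)-s\phi'(s)+(b^2-s^2)\phi''(s)>0$ for $|s|\le b<b_0$ and $\sqrt{g(X,X)}<b_0$ at every point.) Randers metrics correspond to $\phi(s)=1+s$ and are Finsler metrics if and only if $\sqrt{g(X,X)}<1$. The spray coefficients of $F$ are $G^i=\frac14 g^{il}\left([F^2]_{x^my^l}y^m-[F^2]_{x^l}\right)$, with $(g^{il})$ the inverse of $(g_{ij})$. $F$ is of Douglas type if in any standard local coordinate system of $TM$ one has $G^i=\frac12\Gamma^i_{jk}(x)y^jy^k+P(x,y)y^i$, where $P(x,y)$ is a local positively homogeneous function of degree one on $TM$. $F$ is of Berwald type if, in any standard local coordinate system on $TM\setminus\{0\}$, the Christoffel symbols of its Chern connection do not depend on $y$.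
   Formalization: G is assumed connected (otherwise G' can be one-dimensional with abelian Lie algebra and the claim fails), and in (b) F is assumed not to be Riemannian when X is nonzero (a Riemannian F, e.g. φ = 1, is Berwald for every X). *)

theory Defs
  imports "HOL-Analysis.Analysis" "HOL-Algebra.Generated_Groups"
begin

section \<open>Smooth maps between open subsets of Euclidean spaces\<close>

text \<open>Only used for open sets \<open>S\<close>.\<close>

primrec Ck_on :: "nat \<Rightarrow> 'a::real_normed_vector set \<Rightarrow> ('a \<Rightarrow> 'b::real_normed_vector) \<Rightarrow> bool" where
  "Ck_on 0 S f \<longleftrightarrow> continuous_on S f"
| "Ck_on (Suc k) S f \<longleftrightarrow>
     (\<forall>x\<in>S. f differentiable (at x)) \<and> (\<forall>v. Ck_on k S (\<lambda>x. frechet_derivative f (at x) v))"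

definition smooth_on :: "'a::real_normed_vector set \<Rightarrow> ('a \<Rightarrow> 'b::real_normed_vector) \<Rightarrow> bool" where
  "smooth_on S f \<longleftrightarrow> (\<forall>k. Ck_on k S f)"

section \<open>Smooth manifolds modelled on \<open>real ^ 'n\<close>\<close>

text \<open>A chart is a pair of a domain and a coordinate map; the coordinate map is only
  meaningful on the domain. The manifold is the whole type \<open>'g\<close>, its smooth structure is
  given by an atlas \<open>A\<close> that need not be maximal.\<close>

type_synonym ('g, 'n) chart = "'g set \<times> ('g \<Rightarrow> real ^ 'n)"

definition chart_inv :: "('g, 'n::finite) chart \<Rightarrow> real ^ 'n \<Rightarrow> 'g" where
  "chart_inv c = inv_into (fst c) (snd c)"

definition chart_image :: "('g, 'n::finite) chart \<Rightarrow> (real ^ 'n) set" where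
  "chart_image c = snd c ` fst c"

definition is_chart :: "('g::topological_space, 'n::finite) chart \<Rightarrow> bool" where
  "is_chart c \<longleftrightarrow> open (fst c) \<and> open (chart_image c) \<and>
     homeomorphism (fst c) (chart_image c) (snd c) (chart_inv c)"

definition compatible :: "('g::topological_space, 'n::finite) chart \<Rightarrow> ('g, 'n) chart \<Rightarrow> bool" where
  "compatible c d \<longleftrightarrow>
     smooth_on (snd c ` (fst c \<inter> fst d)) (snd d \<circ> chart_inv c) \<and>
     smooth_on (snd d ` (fst c \<inter> fst d)) (snd c \<circ> chart_inv d)"

definition smooth_atlas :: "('g::topological_space, 'n::finite) chart set \<Rightarrow> bool" where
  "smooth_atlas A \<longleftrightarrow> (\<forall>c\<in>A. is_chart c) \<and> (\<Union>c\<in>A. fst c) = UNIV \<and>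
     (\<forall>c\<in>A. \<forall>d\<in>A. compatible c d)"

text \<open>All local coordinate systems of the smooth structure, i.e. the maximal atlas.\<close>

definition charts :: "('g::topological_space, 'n::finite) chart set \<Rightarrow> ('g, 'n) chart set" where
  "charts A = {c. is_chart c \<and> (\<forall>d\<in>A. compatible c d)}"

section \<open>Tangent vectors\<close>

text \<open>
  The tangent space at \<open>x\<close> is the model space \<open>real ^ 'n\<close>: a vector there stands for the
  tangent vector at \<open>x\<close> having these components in the chart \<open>chart_at A x\<close>, which is
  selected once and for all. Thus a function on the tangent bundle has type
  \<open>'g \<Rightarrow> real ^ 'n \<Rightarrow> real\<close> and a vector field has type \<open>'g \<Rightarrow> real ^ 'n\<close>. The components in any
  other chart are obtained with the derivative of the coordinate change.\<close>

definition chart_at :: "('g, 'n::finite) chart set \<Rightarrow> 'g \<Rightarrow> ('g, 'n) chart" where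
  "chart_at A x = (SOME c. c \<in> A \<and> x \<in> fst c)"

text \<open>Components in the chart \<open>c\<close> of the tangent vector \<open>v\<close> at \<open>x\<close>.\<close>

definition components ::
  "('g, 'n::finite) chart set \<Rightarrow> ('g, 'n) chart \<Rightarrow> 'g \<Rightarrow> real ^ 'n \<Rightarrow> real ^ 'n" where
  "components A c x v =
     frechet_derivative (snd c \<circ> chart_inv (chart_at A x)) (at (snd (chart_at A x) x)) v"

text \<open>The tangent vector, at the point with coordinates \<open>p\<close> in the chart \<open>c\<close>, that has the
  components \<open>y\<close> in \<open>c\<close>.\<close>

definition tangent_vector ::
  "('g, 'n::finite) chart set \<Rightarrow> ('g, 'n) chart \<Rightarrow> real ^ 'n \<Rightarrow> real ^ 'n \<Rightarrow> real ^ 'n" where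
  "tangent_vector A c p y =
     frechet_derivative (snd (chart_at A (chart_inv c p)) \<circ> chart_inv c) (at p) y"

text \<open>The differential at \<open>x\<close> of a map of the manifold to itself.\<close>

definition differential ::
  "('g, 'n::finite) chart set \<Rightarrow> ('g \<Rightarrow> 'g) \<Rightarrow> 'g \<Rightarrow> real ^ 'n \<Rightarrow> real ^ 'n" where
  "differential A f x v =
     frechet_derivative (snd (chart_at A (f x)) \<circ> f \<circ> chart_inv (chart_at A x))
       (at (snd (chart_at A x) x)) v"

definition smooth_curve :: "('g::topological_space, 'n::finite) chart set \<Rightarrow> (real \<Rightarrow> 'g) \<Rightarrow> bool" where
  "smooth_curve A \<gamma> \<longleftrightarrow> continuous_on UNIV \<gamma> \<and> (\<forall>c\<in>charts A. smooth_on (\<gamma> -` fst c) (snd c \<circ> \<gamma>))"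

definition velocity :: "('g, 'n::finite) chart set \<Rightarrow> (real \<Rightarrow> 'g) \<Rightarrow> real \<Rightarrow> real ^ 'n" where
  "velocity A \<gamma> t = vector_derivative (snd (chart_at A (\<gamma> t)) \<circ> \<gamma>) (at t)"

text \<open>The bracket of vector fields, \<open>[V, W]\<^sup>i = V\<^sup>j \<partial>\<^sub>j W\<^sup>i - W\<^sup>j \<partial>\<^sub>j V\<^sup>i\<close>, at \<open>x\<close>, computed
  in the chart \<open>chart_at A x\<close>.\<close>

definition field_in_chart ::
  "('g, 'n::finite) chart set \<Rightarrow> ('g, 'n) chart \<Rightarrow> ('g \<Rightarrow> real ^ 'n) \<Rightarrow> real ^ 'n \<Rightarrow> real ^ 'n" where
  "field_in_chart A c V p = components A c (chart_inv c p) (V (chart_inv c p))"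

definition field_bracket ::
  "('g, 'n::finite) chart set \<Rightarrow> ('g \<Rightarrow> real ^ 'n) \<Rightarrow> ('g \<Rightarrow> real ^ 'n) \<Rightarrow> 'g \<Rightarrow> real ^ 'n" where
  "field_bracket A V W x =
     (let c = chart_at A x; p = snd c x; V' = field_in_chart A c V; W' = field_in_chart A c W
      in frechet_derivative W' (at p) (V' p) - frechet_derivative V' (at p) (W' p))"

section \<open>Lie groups\<close>

definition lie_group ::
  "('g::{t2_space,second_countable_topology}) monoid \<Rightarrow> ('g, 'n::finite) chart set \<Rightarrow> bool" where
  "lie_group G A \<longleftrightarrow>
     group G \<and> carrier G = UNIV \<and> smooth_atlas A \<and>
     continuous_on UNIV (\<lambda>(a, b). a \<otimes>\<^bsub>G\<^esub> b) \<and>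
     (\<forall>c\<in>charts A. \<forall>d\<in>charts A. \<forall>e\<in>charts A.
        smooth_on {(p, q). p \<in> chart_image c \<and> q \<in> chart_image d \<and>
                           chart_inv c p \<otimes>\<^bsub>G\<^esub> chart_inv d q \<in> fst e}
          (\<lambda>(p, q). snd e (chart_inv c p \<otimes>\<^bsub>G\<^esub> chart_inv d q))) \<and>
     continuous_on UNIV (\<lambda>a. inv\<^bsub>G\<^esub> a) \<and>
     (\<forall>c\<in>charts A. \<forall>e\<in>charts A.
        smooth_on {p \<in> chart_image c. inv\<^bsub>G\<^esub> (chart_inv c p) \<in> fst e}
          (\<lambda>p. snd e (inv\<^bsub>G\<^esub> (chart_inv c p))))"

definition left_translation_differential ::
  "'g monoid \<Rightarrow> ('g, 'n::finite) chart set \<Rightarrow> 'g \<Rightarrow> 'g \<Rightarrow> real ^ 'n \<Rightarrow> real ^ 'n" where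
  "left_translation_differential G A a x v = differential A (\<lambda>z. a \<otimes>\<^bsub>G\<^esub> z) x v"

text \<open>The Lie algebra of \<open>G\<close> is the tangent space at the identity, with the bracket of the
  left invariant vector fields extending the given vectors.\<close>

definition left_invariant_extension ::
  "'g monoid \<Rightarrow> ('g, 'n::finite) chart set \<Rightarrow> real ^ 'n \<Rightarrow> 'g \<Rightarrow> real ^ 'n" where
  "left_invariant_extension G A v x = left_translation_differential G A x \<one>\<^bsub>G\<^esub> v"

definition lie_bracket ::
  "'g monoid \<Rightarrow> ('g, 'n::finite) chart set \<Rightarrow> real ^ 'n \<Rightarrow> real ^ 'n \<Rightarrow> real ^ 'n" where
  "lie_bracket G A v w =
     field_bracket A (left_invariant_extension G A v) (left_invariant_extension G A w) \<one>\<^bsub>G\<^esub>"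

definition lie_center :: "'g monoid \<Rightarrow> ('g, 'n::finite) chart set \<Rightarrow> (real ^ 'n) set" where
  "lie_center G A = {v. \<forall>w. lie_bracket G A v w = 0}"

text \<open>The Lie algebra of a subgroup \<open>H\<close>, not necessarily closed: the velocities at the identity
  of the smooth curves of \<open>G\<close> that run in \<open>H\<close>. For the commutator group of a connected Lie group,
  which is an integral subgroup, this is its Lie algebra as an immersed Lie subgroup.\<close>

definition lie_algebra_of_subgroup ::
  "('g::topological_space) monoid \<Rightarrow> ('g, 'n::finite) chart set \<Rightarrow> 'g set \<Rightarrow> (real ^ 'n) set" where
  "lie_algebra_of_subgroup G A H =
     {velocity A \<gamma> 0 | \<gamma>. smooth_curve A \<gamma> \<and> \<gamma> 0 = \<one>\<^bsub>G\<^esub> \<and> range \<gamma> \<subseteq> H}"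

definition commutator_lie_algebra ::
  "('g::topological_space) monoid \<Rightarrow> ('g, 'n::finite) chart set \<Rightarrow> (real ^ 'n) set" where
  "commutator_lie_algebra G A = lie_algebra_of_subgroup G A (derived G (carrier G))"

text \<open>The family of Lie groups with one-dimensional commutator group. Lie groups are connected
  here: otherwise the commutator group is not determined by the Lie algebra (for the orthogonal
  group of the plane it is the circle, although the Lie algebra is abelian).\<close>

definition family_G2 ::
  "('g::{t2_space,second_countable_topology}) monoid \<Rightarrow> ('g, 'n::finite) chart set \<Rightarrow> bool" where
  "family_G2 G A \<longleftrightarrow> lie_group G A \<and> connected (UNIV :: 'g set) \<and>
     dim (commutator_lie_algebra G A) = 1"

section \<open>Riemannian and Finsler metrics\<close>

definition riemannian_metric ::
  "('g::topological_space, 'n::finite) chart set \<Rightarrow> ('g \<Rightarrow> real ^ 'n \<Rightarrow> real ^ 'n \<Rightarrow> real) \<Rightarrow> bool" where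
  "riemannian_metric A g \<longleftrightarrow>
     (\<forall>x. bilinear (g x) \<and> (\<forall>u v. g x u v = g x v u) \<and> (\<forall>v. v \<noteq> 0 \<longrightarrow> g x v v > 0)) \<and>
     (\<forall>c\<in>charts A. \<forall>i j. smooth_on (chart_image c)
        (\<lambda>p. g (chart_inv c p) (tangent_vector A c p (axis i 1)) (tangent_vector A c p (axis j 1))))"

text \<open>The function \<open>F(p, y)\<close> on a coordinate domain of the tangent bundle, in the standard
  coordinates induced by the chart \<open>c\<close>.\<close>

definition in_chart ::
  "('g, 'n::finite) chart set \<Rightarrow> ('g \<Rightarrow> real ^ 'n \<Rightarrow> real) \<Rightarrow> ('g, 'n) chart \<Rightarrow>
    real ^ 'n \<Rightarrow> real ^ 'n \<Rightarrow> real" where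
  "in_chart A F c p y = F (chart_inv c p) (tangent_vector A c p y)"

definition partial_deriv :: "(real ^ 'n::finite \<Rightarrow> real) \<Rightarrow> 'n \<Rightarrow> real ^ 'n \<Rightarrow> real" where
  "partial_deriv f i x = deriv (\<lambda>t. f (x + t *\<^sub>R axis i 1)) 0"

text \<open>In the following local formulas, \<open>L\<close> is a Finsler metric in standard local coordinates.\<close>

definition fundamental_tensor ::
  "(real ^ 'n::finite \<Rightarrow> real ^ 'n \<Rightarrow> real) \<Rightarrow> real ^ 'n \<Rightarrow> real ^ 'n \<Rightarrow> real ^ 'n ^ 'n" where
  "fundamental_tensor L p y =
     (\<chi> i j. 1/2 * partial_deriv (\<lambda>y'. partial_deriv (\<lambda>y''. (L p y'')\<^sup>2) j y') i y)"

definition finsler_metric ::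
  "('g::topological_space, 'n::finite) chart set \<Rightarrow> ('g \<Rightarrow> real ^ 'n \<Rightarrow> real) \<Rightarrow> bool" where
  "finsler_metric A F \<longleftrightarrow>
     (\<forall>x y. F x y \<ge> 0) \<and>
     (\<forall>x y. \<forall>l>0. F x (l *\<^sub>R y) = l * F x y) \<and>
     (\<forall>c\<in>charts A.
        smooth_on (chart_image c \<times> (UNIV - {0})) (\<lambda>(p, y). in_chart A F c p y) \<and>
        (\<forall>p\<in>chart_image c. \<forall>y. y \<noteq> 0 \<longrightarrow>
           (\<forall>v. v \<noteq> 0 \<longrightarrow> v \<bullet> (fundamental_tensor (in_chart A F c) p y *v v) > 0)))"

definition is_riemannian ::
  "('g::topological_space, 'n::finite) chart set \<Rightarrow> ('g \<Rightarrow> real ^ 'n \<Rightarrow> real) \<Rightarrow> bool" where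
  "is_riemannian A F \<longleftrightarrow> (\<exists>h. riemannian_metric A h \<and> (\<forall>x y. F x y = sqrt (h x y y)))"

definition spray_coeff ::
  "(real ^ 'n::finite \<Rightarrow> real ^ 'n \<Rightarrow> real) \<Rightarrow> 'n \<Rightarrow> real ^ 'n \<Rightarrow> real ^ 'n \<Rightarrow> real" where
  "spray_coeff L i p y =
     1/4 * (\<Sum>l\<in>UNIV. matrix_inv (fundamental_tensor L p y) $ i $ l *
       ((\<Sum>m\<in>UNIV. partial_deriv (\<lambda>p'. partial_deriv (\<lambda>y'. (L p' y')\<^sup>2) l y) m p * y $ m)
        - partial_deriv (\<lambda>p'. (L p' y)\<^sup>2) l p))"

text \<open>The nonlinear connection \<open>N\<^sup>m\<^sub>k = \<partial>G\<^sup>m/\<partial>y\<^sup>k\<close> and the horizontal derivative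
  \<open>\<delta>/\<delta>x\<^sup>k = \<partial>/\<partial>x\<^sup>k - N\<^sup>m\<^sub>k \<partial>/\<partial>y\<^sup>m\<close> of a function on the tangent bundle.\<close>

definition nonlinear_connection ::
  "(real ^ 'n::finite \<Rightarrow> real ^ 'n \<Rightarrow> real) \<Rightarrow> 'n \<Rightarrow> 'n \<Rightarrow> real ^ 'n \<Rightarrow> real ^ 'n \<Rightarrow> real" where
  "nonlinear_connection L m k p y = partial_deriv (spray_coeff L m p) k y"

definition horizontal_deriv ::
  "(real ^ 'n::finite \<Rightarrow> real ^ 'n \<Rightarrow> real) \<Rightarrow> (real ^ 'n \<Rightarrow> real ^ 'n \<Rightarrow> real) \<Rightarrow> 'n \<Rightarrow>
    real ^ 'n \<Rightarrow> real ^ 'n \<Rightarrow> real" where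
  "horizontal_deriv L f k p y =
     partial_deriv (\<lambda>p'. f p' y) k p
     - (\<Sum>m\<in>UNIV. nonlinear_connection L m k p y * partial_deriv (f p) m y)"

text \<open>The Christoffel symbols \<open>\<Gamma>\<^sup>i\<^sub>j\<^sub>k\<close> of the Chern connection, that is, of the torsion-free and
  almost metric-compatible connection:
  \<open>\<Gamma>\<^sup>i\<^sub>j\<^sub>k = 1/2 g\<^sup>i\<^sup>l (\<delta>g\<^sub>j\<^sub>l/\<delta>x\<^sup>k + \<delta>g\<^sub>l\<^sub>k/\<delta>x\<^sup>j - \<delta>g\<^sub>j\<^sub>k/\<delta>x\<^sup>l)\<close>.\<close>

definition chern_christoffel ::
  "(real ^ 'n::finite \<Rightarrow> real ^ 'n \<Rightarrow> real) \<Rightarrow> 'n \<Rightarrow> 'n \<Rightarrow> 'n \<Rightarrow> real ^ 'n \<Rightarrow> real ^ 'n \<Rightarrow> real" where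
  "chern_christoffel L i j k p y =
     1/2 * (\<Sum>l\<in>UNIV. matrix_inv (fundamental_tensor L p y) $ i $ l *
       (horizontal_deriv L (\<lambda>p' y'. fundamental_tensor L p' y' $ j $ l) k p y
        + horizontal_deriv L (\<lambda>p' y'. fundamental_tensor L p' y' $ l $ k) j p y
        - horizontal_deriv L (\<lambda>p' y'. fundamental_tensor L p' y' $ j $ k) l p y))"

definition berwald_type ::
  "('g::topological_space, 'n::finite) chart set \<Rightarrow> ('g \<Rightarrow> real ^ 'n \<Rightarrow> real) \<Rightarrow> bool" where
  "berwald_type A F \<longleftrightarrow>
     (\<forall>c\<in>charts A. \<forall>p\<in>chart_image c. \<forall>y y'. y \<noteq> 0 \<longrightarrow> y' \<noteq> 0 \<longrightarrow>
        (\<forall>i j k. chern_christoffel (in_chart A F c) i j k p y =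
                 chern_christoffel (in_chart A F c) i j k p y'))"

definition douglas_type ::
  "('g::topological_space, 'n::finite) chart set \<Rightarrow> ('g \<Rightarrow> real ^ 'n \<Rightarrow> real) \<Rightarrow> bool" where
  "douglas_type A F \<longleftrightarrow>
     (\<forall>c\<in>charts A.
        \<exists>(\<Gamma> :: 'n \<Rightarrow> 'n \<Rightarrow> 'n \<Rightarrow> real ^ 'n \<Rightarrow> real) (P :: real ^ 'n \<Rightarrow> real ^ 'n \<Rightarrow> real).
          (\<forall>p\<in>chart_image c. \<forall>y. y \<noteq> 0 \<longrightarrow> (\<forall>l>0. P p (l *\<^sub>R y) = l * P p y)) \<and>
          (\<forall>p\<in>chart_image c. \<forall>y. y \<noteq> 0 \<longrightarrow> (\<forall>i.
             spray_coeff (in_chart A F c) i p y =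
               1/2 * (\<Sum>j\<in>UNIV. \<Sum>k\<in>UNIV. \<Gamma> i j k p * y $ j * y $ k) + P p y * y $ i)))"

text \<open>At \<open>y = 0\<close> the formula below reads \<open>F x 0 = 0 * \<phi> (0 / 0)\<close>, which is \<open>0\<close> in HOL, as it
  should be. The bound \<open>b\<^sub>0\<close> of the domain of \<open>\<phi>\<close> may be infinite.\<close>

definition alpha_beta_metric ::
  "('g::topological_space, 'n::finite) chart set \<Rightarrow> ('g \<Rightarrow> real ^ 'n \<Rightarrow> real ^ 'n \<Rightarrow> real) \<Rightarrow>
    ('g \<Rightarrow> real ^ 'n) \<Rightarrow> ('g \<Rightarrow> real ^ 'n \<Rightarrow> real) \<Rightarrow> bool" where
  "alpha_beta_metric A g X F \<longleftrightarrow> finsler_metric A F \<and>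
     (\<exists>(\<phi> :: real \<Rightarrow> real) (b0 :: ereal).
        smooth_on {s. ereal \<bar>s\<bar> < b0} \<phi> \<and>
        (\<forall>x. ereal (sqrt (g x (X x) (X x))) < b0) \<and>
        (\<forall>x y. F x y = sqrt (g x y y) * \<phi> (g x (X x) y / sqrt (g x y y))))"

section \<open>Left invariance\<close>

definition left_invariant_riemannian ::
  "'g monoid \<Rightarrow> ('g, 'n::finite) chart set \<Rightarrow> ('g \<Rightarrow> real ^ 'n \<Rightarrow> real ^ 'n \<Rightarrow> real) \<Rightarrow> bool" where
  "left_invariant_riemannian G A g \<longleftrightarrow>
     (\<forall>a x u v. g (a \<otimes>\<^bsub>G\<^esub> x) (left_translation_differential G A a x u)
                              (left_translation_differential G A a x v) = g x u v)"

definition left_invariant_field ::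
  "'g monoid \<Rightarrow> ('g, 'n::finite) chart set \<Rightarrow> ('g \<Rightarrow> real ^ 'n) \<Rightarrow> bool" where
  "left_invariant_field G A X \<longleftrightarrow>
     (\<forall>a x. X (a \<otimes>\<^bsub>G\<^esub> x) = left_translation_differential G A a x (X x))"

definition left_invariant_finsler ::
  "'g monoid \<Rightarrow> ('g, 'n::finite) chart set \<Rightarrow> ('g \<Rightarrow> real ^ 'n \<Rightarrow> real) \<Rightarrow> bool" where
  "left_invariant_finsler G A F \<longleftrightarrow>
     (\<forall>x y. F x y = F \<one>\<^bsub>G\<^esub> (left_translation_differential G A (inv\<^bsub>G\<^esub> x) x y))"

definition orthogonal_hyperplane ::
  "'g monoid \<Rightarrow> ('g \<Rightarrow> real ^ 'n::finite \<Rightarrow> real ^ 'n \<Rightarrow> real) \<Rightarrow> real ^ 'n \<Rightarrow> (real ^ 'n) set" where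
  "orthogonal_hyperplane G g u = {v. g \<one>\<^bsub>G\<^esub> v u = 0}"

end

theory Submission
  imports Defs
begin

text \<open>
  In every chart a left invariant \<open>F\<close> is the Minkowski norm \<open>N = F(e, \<cdot>)\<close> composed with the
  Maurer-Cartan coframe, whose structure equation brings in the Lie bracket. With \<open>M = N\<^sup>2\<close>, the
  spray is determined by the vectors \<open>S(\<eta>)\<close> with \<open>D\<^sup>2M\<^sub>\<eta>(S(\<eta>), \<zeta>) = DM\<^sub>\<eta>[\<eta>, \<zeta>]\<close>. The Douglas condition
  becomes \<open>S(\<eta>) = Q(\<eta>, \<eta>) + P(\<eta>) \<eta>\<close> with \<open>Q\<close> bilinear. For a Randers norm the replacement of
  \<open>\<eta>\<close> by \<open>- \<eta>\<close> isolates the term \<open>g(X, [\<eta>, \<zeta>])\<close>, so that the condition means \<open>X \<bottom> [\<gg>, \<gg>]\<close>.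

  If \<open>F\<close> is of Berwald type, then \<open>S(\<eta>) = Q(\<eta>, \<eta>)\<close>, and differentiating \<open>DM\<^sub>\<eta>(Q(\<eta>, \<eta>)) = 0\<close> shows that
  each \<open>\<eta> \<mapsto> Q(\<zeta>, \<eta>) + Q(\<eta>, \<zeta>) + [\<eta>, \<zeta>]\<close> is an infinitesimal linear isometry of \<open>N\<close>. As \<open>N\<close> is not
  Euclidean, these isometries fix \<open>X\<close> and are skew for \<open>g\<close>, which forces \<open>X \<bottom> [\<gg>, \<gg>]\<close> and \<open>X\<close> central.
  Conversely, for such an \<open>X\<close> the Levi-Civita connection of \<open>g\<close> is the Chern connection of \<open>F\<close>.

  The commutator group enters through the curves \<open>a c(t) a\<inverse> c(t)\<inverse>\<close>, with velocity \<open>Ad(a) v - v\<close>: hence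
  its Lie algebra spans a space that contains \<open>[\<gg>, \<gg>]\<close>. If \<open>[\<gg>, \<gg>] = 0\<close>, then \<open>Ad\<close> is locally
  constant, so trivial, and then the centralizer of each element is open, so \<open>G\<close> is abelian.
\<close>

section \<open>Calculus of smooth maps\<close>

text \<open>That \<open>ad X\<close> is skew for \<open>g\<close> would not by itself make
  \<open>X\<close> central. The family enters here: \<open>[X, w]\<close> is a multiple
  \<open>f(w) u\<close> of a single vector, and a skew map of rank at most one is zero. The
  exclusion of Riemannian \<open>F\<close> for \<open>X \<noteq> 0\<close> in (b) rules out cases
  such as a constant \<phi>, where \<open>F\<close> is a multiple of the norm of \<open>g\<close>
  and hence of Berwald type for every \<open>X\<close>; the linear isometries of such a norm need
  not respect \<open>X\<close>. An obstacle shapes the first half: the tangent space at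
  \<open>x\<close> is identified with the model space through the selected chart
  \<open>chart_at A x\<close>, which may jump as \<open>x\<close> moves. Derivatives are therefore
  taken in one fixed chart, and the selected charts are eliminated beforehand by the chain rule for
  translations.\<close>

abbreviation \<D> where "\<D> f x \<equiv> frechet_derivative f (at x)"

lemma frechet_derivative_has:
  "f differentiable (at x) \<Longrightarrow> (f has_derivative \<D> f x) (at x)"
  by (simp add: frechet_derivative_works)

lemma frechet_derivative_eqI:
  "(f has_derivative f') (at x) \<Longrightarrow> \<D> f x = f'"
  using frechet_derivative_at by metis

lemma frechet_derivative_cong_open:
  assumes "open S" "x \<in> S" "\<And>y. y \<in> S \<Longrightarrow> f y = g y"
  shows "\<D> f x = \<D> g x"
proof -
  have "(f has_derivative D) (at x) \<longleftrightarrow> (g has_derivative D) (at x)" for D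
    by (rule iffI; erule has_derivative_transform_within_open[OF _ assms(1,2)])
      (simp_all add: assms(3))
  then show ?thesis unfolding frechet_derivative_def by presburger
qed

lemma differentiable_cong_open:
  assumes "open S" "x \<in> S" "\<And>y. y \<in> S \<Longrightarrow> f y = g y"
  shows "f differentiable (at x) \<longleftrightarrow> g differentiable (at x)"
proof -
  have "(f has_derivative D) (at x) \<longleftrightarrow> (g has_derivative D) (at x)" for D
    by (rule iffI; erule has_derivative_transform_within_open[OF _ assms(1,2)])
      (simp_all add: assms(3))
  then show ?thesis unfolding differentiable_def by presburger
qed

lemma Ck_on_cong:
  assumes "open S" "\<And>x. x \<in> S \<Longrightarrow> f x = g x"
  shows "Ck_on k S f \<longleftrightarrow> Ck_on k S g"
  using assms(2)
proof (induction k arbitrary: f g)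
  case 0
  then show ?case by (simp cong: continuous_on_cong)
next
  case (Suc k)
  have "Ck_on k S (\<lambda>x. \<D> f x v) \<longleftrightarrow>
        Ck_on k S (\<lambda>x. \<D> g x v)" for v
    by (rule Suc.IH, rule fun_cong[OF frechet_derivative_cong_open[OF assms(1)]])
      (simp_all add: Suc.prems)
  moreover have "f differentiable (at x) \<longleftrightarrow> g differentiable (at x)" if "x \<in> S" for x
    by (rule differentiable_cong_open[OF assms(1) that]) (simp add: Suc)
  ultimately show ?case by simp
qed

lemma Ck_on_subset: "Ck_on k S f \<Longrightarrow> T \<subseteq> S \<Longrightarrow> Ck_on k T f"
  by (induction k arbitrary: f) (auto intro: continuous_on_subset)

lemma Ck_on_SucD: "Ck_on (Suc k) S f \<Longrightarrow> Ck_on k S f"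
proof (induction k arbitrary: f)
  case 0
  then show ?case
    by (simp add: differentiable_at_imp_differentiable_on differentiable_imp_continuous_on)
next
  case (Suc k)
  from Suc.prems have "\<forall>x\<in>S. f differentiable (at x)"
    and "\<And>v. Ck_on (Suc k) S (\<lambda>x. \<D> f x v)" by simp_all
  with Suc.IH show ?case by simp
qed

lemma Ck_on_const: "Ck_on k S (\<lambda>x. c)"
  by (induction k arbitrary: c) auto

lemma Ck_on_add:
  assumes "open S" "Ck_on k S f" "Ck_on k S g"
  shows "Ck_on k S (\<lambda>x. f x + g x)"
  using assms(2,3)
proof (induction k arbitrary: f g)
  case 0
  then show ?case by (simp add: continuous_on_add)
next
  case (Suc k)
  have "\<D> (\<lambda>x. f x + g x) x v
      = \<D> f x v + \<D> g x v" if "x \<in> S" for x v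
    using Suc.prems that
    by (subst frechet_derivative_eqI[OF has_derivative_add[OF frechet_derivative_has frechet_derivative_has]]) auto
  then have "Ck_on k S (\<lambda>x. \<D> (\<lambda>x. f x + g x) x v)" for v
    using Suc by (subst Ck_on_cong[OF assms(1)]) auto
  with Suc.prems show ?case by auto
qed

lemma Ck_on_bounded_linear:
  assumes "open S" "bounded_linear L" "Ck_on k S f"
  shows "Ck_on k S (\<lambda>x. L (f x))"
  using assms(3)
proof (induction k arbitrary: f)
  case 0
  then show ?case using assms(2) by (simp add: bounded_linear.continuous_on)
next
  case (Suc k)
  have d: "((\<lambda>x. L (f x)) has_derivative (\<lambda>v. L (\<D> f x v))) (at x)"
    if "x \<in> S" for x
    using Suc.prems that by (intro bounded_linear.has_derivative[OF assms(2)] frechet_derivative_has) auto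
  have "Ck_on k S (\<lambda>x. \<D> (\<lambda>x. L (f x)) x v)" for v
    using Suc frechet_derivative_eqI[OF d] by (subst Ck_on_cong[OF assms(1)]) auto
  moreover have "(\<lambda>x. L (f x)) differentiable (at x)" if "x \<in> S" for x
    using d[OF that] unfolding differentiable_def by blast
  ultimately show ?case by simp
qed

lemma Ck_on_scaleR:
  fixes a :: "'a::real_normed_vector \<Rightarrow> real"
  assumes "open S" "Ck_on k S a" "Ck_on k S f"
  shows "Ck_on k S (\<lambda>x. a x *\<^sub>R f x)"
  using assms(2,3)
proof (induction k arbitrary: a f)
  case 0
  then show ?case by (simp add: continuous_on_scaleR)
next
  case (Suc k)
  have d: "((\<lambda>x. a x *\<^sub>R f x) has_derivative
      (\<lambda>v. a x *\<^sub>R \<D> f x v + \<D> a x v *\<^sub>R f x)) (at x)"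
    if "x \<in> S" for x
    using Suc.prems that by (intro has_derivative_scaleR frechet_derivative_has) auto
  have "Ck_on k S (\<lambda>x. a x *\<^sub>R \<D> f x v + \<D> a x v *\<^sub>R f x)" for v
    using Suc Ck_on_SucD[OF Suc.prems(1)] Ck_on_SucD[OF Suc.prems(2)]
    by (intro Ck_on_add assms(1)) auto
  then have "Ck_on k S (\<lambda>x. \<D> (\<lambda>x. a x *\<^sub>R f x) x v)" for v
    using frechet_derivative_eqI[OF d] by (subst Ck_on_cong[OF assms(1)]) auto
  moreover have "(\<lambda>x. a x *\<^sub>R f x) differentiable (at x)" if "x \<in> S" for x
    using d[OF that] unfolding differentiable_def by blast
  ultimately show ?case by simp
qed

lemma Ck_on_sum:
  assumes "open S" "\<And>i. i \<in> I \<Longrightarrow> Ck_on k S (f i)"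
  shows "Ck_on k S (\<lambda>x. \<Sum>i\<in>I. f i x)"
  using assms(2)
  by (induction I rule: infinite_finite_induct) (auto intro: Ck_on_const Ck_on_add[OF assms(1)])

lemma Ck_on_Pair:
  assumes "open S" "Ck_on k S f" "Ck_on k S g"
  shows "Ck_on k S (\<lambda>x. (f x, g x))"
proof -
  have "Ck_on k S (\<lambda>x. (f x, 0) + (0, g x))"
    by (intro Ck_on_add assms Ck_on_bounded_linear[where L="\<lambda>x. (x, 0)"]
        Ck_on_bounded_linear[where L="\<lambda>x. (0, x)"])
      (auto intro: bounded_linear_Pair bounded_linear_ident bounded_linear_zero)
  then show ?thesis by simp
qed

lemma frechet_derivative_chain:
  fixes f :: "'a::real_normed_vector \<Rightarrow> 'b::real_normed_vector"
  assumes "f differentiable (at x)" "g differentiable (at (f x))"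
  shows "((\<lambda>x. g (f x)) has_derivative
    (\<lambda>v. \<D> g (f x) (\<D> f x v))) (at x)"
  using diff_chain_at[OF frechet_derivative_has[OF assms(1)] frechet_derivative_has[OF assms(2)]]
  by (simp add: o_def)

lemma linear_euclidean_expansion:
  fixes L :: "'a::euclidean_space \<Rightarrow> 'b::real_vector"
  assumes "linear L"
  shows "L v = (\<Sum>b\<in>Basis. (v \<bullet> b) *\<^sub>R L b)"
proof -
  have "L v = L (\<Sum>b\<in>Basis. (v \<bullet> b) *\<^sub>R b)" by (simp add: euclidean_representation)
  then show ?thesis using assms by (simp add: linear_sum linear_scale)
qed

text \<open>\<open>Ck_on\<close> differentiates along fixed vectors only, while the chain rule
  evaluates the derivative of \<open>g\<close> along the moving vector \<open>\<D> f x v\<close>.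
  Expanding this vector in a basis gives a sum of products to which the induction hypothesis
  applies; hence the Euclidean middle space.\<close>

lemma Ck_on_compose:
  fixes f :: "'a::real_normed_vector \<Rightarrow> 'b::euclidean_space"
  assumes "open S" "open T" "Ck_on k S f" "Ck_on k T g" "f ` S \<subseteq> T"
  shows "Ck_on k S (\<lambda>x. g (f x))"
  using assms(3,4)
proof (induction k arbitrary: g)
  case 0
  then show ?case using assms(5) by (auto intro: continuous_on_compose2)
next
  case (Suc k)
  have df: "f differentiable (at x)" "g differentiable (at (f x))" if "x \<in> S" for x
    using Suc.prems that assms(5) by auto
  note d = frechet_derivative_chain[OF df]
  have e: "\<D> (\<lambda>x. g (f x)) x v =
     (\<Sum>b\<in>Basis. (\<D> f x v \<bullet> b) *\<^sub>R \<D> g (f x) b)"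
    if "x \<in> S" for x v
    using frechet_derivative_eqI[OF d[OF that that]] linear_frechet_derivative[OF df(2)[OF that]]
    by (simp add: linear_euclidean_expansion[symmetric])
  have "Ck_on k S (\<lambda>x. \<Sum>b\<in>Basis. (\<D> f x v \<bullet> b) *\<^sub>R \<D> g (f x) b)" for v
  proof (intro Ck_on_sum Ck_on_scaleR assms(1))
    fix b :: 'b
    show "Ck_on k S (\<lambda>x. \<D> f x v \<bullet> b)"
      using Suc.prems(1) by (intro Ck_on_bounded_linear[OF assms(1) bounded_linear_inner_left]) auto
    show "Ck_on k S (\<lambda>x. \<D> g (f x) b)"
      using Suc.prems Ck_on_SucD by (intro Suc.IH) auto
  qed
  then have "Ck_on k S (\<lambda>x. \<D> (\<lambda>x. g (f x)) x v)" for v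
    using e by (subst Ck_on_cong[OF assms(1)]) auto
  moreover have "(\<lambda>x. g (f x)) differentiable (at x)" if "x \<in> S" for x
    using d[OF that that] unfolding differentiable_def by blast
  ultimately show ?case by simp
qed

lemma Ck_on_local:
  assumes "\<And>x. x \<in> S \<Longrightarrow> \<exists>T. open T \<and> x \<in> T \<and> Ck_on k T f"
  shows "Ck_on k S f"
  using assms
proof (induction k arbitrary: f)
  case 0
  have "isCont f x" if "x \<in> S" for x
    using 0[OF that] continuous_on_eq_continuous_at by auto
  then show ?case by (simp add: continuous_at_imp_continuous_on)
next
  case (Suc k)
  have "f differentiable (at x)" if "x \<in> S" for x using Suc.prems[OF that] by auto
  moreover have "Ck_on k S (\<lambda>x. \<D> f x v)" for v
    by (rule Suc.IH) (use Suc.prems in force)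
  ultimately show ?case by simp
qed

lemma Ck_on_ident: "Ck_on k S (\<lambda>x. x)"
  by (cases k) (auto intro: Ck_on_const)

lemma smooth_on_cong: "open S \<Longrightarrow> (\<And>x. x \<in> S \<Longrightarrow> f x = g x) \<Longrightarrow> smooth_on S f \<longleftrightarrow> smooth_on S g"
  unfolding smooth_on_def by (meson Ck_on_cong)

lemma smooth_on_subset: "smooth_on S f \<Longrightarrow> T \<subseteq> S \<Longrightarrow> smooth_on T f"
  unfolding smooth_on_def by (meson Ck_on_subset)

lemma smooth_on_const: "smooth_on S (\<lambda>x. c)"
  unfolding smooth_on_def by (simp add: Ck_on_const)

lemma smooth_on_ident: "smooth_on S (\<lambda>x. x)"
  unfolding smooth_on_def by (simp add: Ck_on_ident)

lemma smooth_on_add: "open S \<Longrightarrow> smooth_on S f \<Longrightarrow> smooth_on S g \<Longrightarrow> smooth_on S (\<lambda>x. f x + g x)"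
  unfolding smooth_on_def by (simp add: Ck_on_add)

lemma smooth_on_bounded_linear:
  "open S \<Longrightarrow> bounded_linear L \<Longrightarrow> smooth_on S f \<Longrightarrow> smooth_on S (\<lambda>x. L (f x))"
  unfolding smooth_on_def by (simp add: Ck_on_bounded_linear)

lemma smooth_on_scaleR:
  fixes a :: "'a::real_normed_vector \<Rightarrow> real"
  shows "open S \<Longrightarrow> smooth_on S a \<Longrightarrow> smooth_on S f \<Longrightarrow> smooth_on S (\<lambda>x. a x *\<^sub>R f x)"
  unfolding smooth_on_def by (simp add: Ck_on_scaleR)

lemma smooth_on_Pair:
  "open S \<Longrightarrow> smooth_on S f \<Longrightarrow> smooth_on S g \<Longrightarrow> smooth_on S (\<lambda>x. (f x, g x))"
  unfolding smooth_on_def by (simp add: Ck_on_Pair)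

lemma smooth_on_compose:
  fixes f :: "'a::real_normed_vector \<Rightarrow> 'b::euclidean_space"
  assumes "open S" "open T" "smooth_on S f" "smooth_on T g" "f ` S \<subseteq> T"
  shows "smooth_on S (\<lambda>x. g (f x))"
  using assms Ck_on_compose unfolding smooth_on_def by blast

lemma smooth_on_local:
  assumes "\<And>x. x \<in> S \<Longrightarrow> \<exists>T. open T \<and> x \<in> T \<and> smooth_on T f"
  shows "smooth_on S f"
  unfolding smooth_on_def
proof (intro allI Ck_on_local)
  fix k x
  assume "x \<in> S"
  from assms[OF this] show "\<exists>T. open T \<and> x \<in> T \<and> Ck_on k T f"
    unfolding smooth_on_def by blast
qed

lemma smooth_on_differentiable: "smooth_on S f \<Longrightarrow> x \<in> S \<Longrightarrow> f differentiable (at x)"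
  unfolding smooth_on_def by (metis Ck_on.simps(2))

lemma smooth_on_derivative: "smooth_on S f \<Longrightarrow> smooth_on S (\<lambda>x. \<D> f x v)"
  unfolding smooth_on_def by (metis Ck_on.simps(2))

lemma smooth_on_continuous: "smooth_on S f \<Longrightarrow> continuous_on S f"
  unfolding smooth_on_def by (metis Ck_on.simps(1))

section \<open>Symmetry of second derivatives\<close>

lemma mvt_line:
  fixes h :: "real \<Rightarrow> real"
  assumes "0 < s" "\<And>r. 0 \<le> r \<Longrightarrow> r \<le> s \<Longrightarrow> (h has_real_derivative h' r) (at r)"
  obtains r where "0 < r" "r < s" "h s - h 0 = s * h' r"
proof -
  have "\<exists>z. 0 < z \<and> z < s \<and> h s - h 0 = (s - 0) * h' z"
    using assms by (intro MVT2) auto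
  then show thesis using that by auto
qed

text \<open>The second difference is symmetric in \<open>v\<close> and \<open>w\<close>, so
  exchanging them compares the two mixed derivatives. The mean value theorem is applied first along
  \<open>v\<close>, then along \<open>w\<close>.\<close>

lemma second_difference_mvt:
  fixes f :: "'a::real_normed_vector \<Rightarrow> real"
  assumes "0 < s"
    and S: "\<And>a b. 0 \<le> a \<Longrightarrow> a \<le> s \<Longrightarrow> 0 \<le> b \<Longrightarrow> b \<le> s \<Longrightarrow> x + a *\<^sub>R v + b *\<^sub>R w \<in> S"
    and d: "\<And>z. z \<in> S \<Longrightarrow> f differentiable (at z)"
    and dd: "\<And>z. z \<in> S \<Longrightarrow> (\<lambda>z. \<D> f z v) differentiable (at z)"
  obtains a b where "0 < a" "a < s" "0 < b" "b < s"
    "f (x + s *\<^sub>R v + s *\<^sub>R w) - f (x + s *\<^sub>R v) - f (x + s *\<^sub>R w) + f x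
      = s * s * \<D> (\<lambda>z. \<D> f z v) (x + a *\<^sub>R v + b *\<^sub>R w) w"
proof -
  let ?D = "\<lambda>z. \<D> f z v"
  let ?h = "\<lambda>a. f (x + a *\<^sub>R v + s *\<^sub>R w) - f (x + a *\<^sub>R v)"
  have line: "((\<lambda>a. k (z + a *\<^sub>R v)) has_real_derivative \<D> k (z + r *\<^sub>R v) v) (at r)"
    if "k differentiable (at (z + r *\<^sub>R v))" for k :: "'a \<Rightarrow> real" and z v r
  proof -
    have "((\<lambda>a. k (z + a *\<^sub>R v)) has_derivative (\<lambda>t. \<D> k (z + r *\<^sub>R v) (t *\<^sub>R v))) (at r)"
    proof -
      have "((\<lambda>a. z + a *\<^sub>R v) has_derivative (\<lambda>t. t *\<^sub>R v)) (at r)"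
        by (auto intro!: derivative_eq_intros)
      from diff_chain_at[OF this frechet_derivative_has[OF that]] show ?thesis
        by (simp add: o_def)
    qed
    moreover have "(\<lambda>t. \<D> k (z + r *\<^sub>R v) (t *\<^sub>R v)) = (*) (\<D> k (z + r *\<^sub>R v) v)"
      using linear_frechet_derivative[OF that] by (auto simp: linear_scale fun_eq_iff)
    ultimately show ?thesis by (simp add: has_field_derivative_def)
  qed
  have "(?h has_real_derivative (?D (x + s *\<^sub>R w + r *\<^sub>R v) - ?D (x + r *\<^sub>R v))) (at r)" if "0 \<le> r" "r \<le> s" for r
  proof (rule DERIV_diff)
    have "x + s *\<^sub>R w + r *\<^sub>R v \<in> S" using S[of r s] that assms(1) by (simp add: algebra_simps)
    from line[OF d[OF this]]
    show "((\<lambda>a. f (x + a *\<^sub>R v + s *\<^sub>R w)) has_real_derivative ?D (x + s *\<^sub>R w + r *\<^sub>R v)) (at r)"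
      by (simp add: algebra_simps)
    have "x + r *\<^sub>R v \<in> S" using S[of r 0] that assms(1) by (simp add: algebra_simps)
    from line[OF d[OF this]]
    show "((\<lambda>a. f (x + a *\<^sub>R v)) has_real_derivative ?D (x + r *\<^sub>R v)) (at r)" .
  qed
  then obtain a where a: "0 < a" "a < s" "?h s - ?h 0 = s * (?D (x + s *\<^sub>R w + a *\<^sub>R v) - ?D (x + a *\<^sub>R v))"
    using mvt_line[OF assms(1), of ?h "\<lambda>r. ?D (x + s *\<^sub>R w + r *\<^sub>R v) - ?D (x + r *\<^sub>R v)"] by blast
  let ?k = "\<lambda>b. ?D (x + a *\<^sub>R v + b *\<^sub>R w)"
  have "(?k has_real_derivative \<D> ?D (x + a *\<^sub>R v + r *\<^sub>R w) w) (at r)"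
    if "0 \<le> r" "r \<le> s" for r
    by (rule line[OF dd]) (use S[of a r] that a in auto)
  then obtain b where b: "0 < b" "b < s"
    "?k s - ?k 0 = s * \<D> ?D (x + a *\<^sub>R v + b *\<^sub>R w) w"
    using mvt_line[OF assms(1), of ?k "\<lambda>r. \<D> ?D (x + a *\<^sub>R v + r *\<^sub>R w) w"] by blast
  show thesis
  proof (rule that[of a b])
    have "?h s - ?h 0 = s * (?k s - ?k 0)" using a(3) by (simp add: add.assoc add.commute[of "s *\<^sub>R w"])
    then show "f (x + s *\<^sub>R v + s *\<^sub>R w) - f (x + s *\<^sub>R v) - f (x + s *\<^sub>R w) + f x
      = s * s * \<D> ?D (x + a *\<^sub>R v + b *\<^sub>R w) w"
      using b(3) by (simp add: algebra_simps)
  qed (use a b in auto)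
qed

text \<open>At two points arbitrarily near \<open>x\<close> the mixed derivatives agree, both being
  the same second difference divided by \<open>s * s\<close>; continuity forces equality at
  \<open>x\<close>.\<close>

lemma second_derivative_symmetric_real:
  fixes f :: "'a::real_normed_vector \<Rightarrow> real"
  assumes "open S" "smooth_on S f" "x \<in> S"
  shows "\<D> (\<lambda>z. \<D> f z v) x w
       = \<D> (\<lambda>z. \<D> f z w) x v"
proof -
  let ?P = "\<lambda>z. \<D> (\<lambda>z. \<D> f z v) z w"
  let ?Q = "\<lambda>z. \<D> (\<lambda>z. \<D> f z w) z v"
  note sm = smooth_on_derivative[OF assms(2)]
  have cP: "continuous_on S ?P" and cQ: "continuous_on S ?Q"
    using smooth_on_continuous smooth_on_derivative sm by blast+
  show ?thesis
  proof (rule ccontr)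
    assume ne: "?P x \<noteq> ?Q x"
    define \<epsilon> where "\<epsilon> = \<bar>?P x - ?Q x\<bar> / 2"
    have "\<epsilon> > 0" using ne by (simp add: \<epsilon>_def)
    from cP assms have "isCont ?P x" by (simp add: continuous_on_eq_continuous_at)
    then obtain d1 where d1: "d1 > 0" "\<And>z. dist z x < d1 \<Longrightarrow> \<bar>?P z - ?P x\<bar> < \<epsilon>"
      using \<open>\<epsilon> > 0\<close> unfolding continuous_at_eps_delta dist_real_def by meson
    from cQ assms have "isCont ?Q x" by (simp add: continuous_on_eq_continuous_at)
    then obtain d2 where d2: "d2 > 0" "\<And>z. dist z x < d2 \<Longrightarrow> \<bar>?Q z - ?Q x\<bar> < \<epsilon>"
      using \<open>\<epsilon> > 0\<close> unfolding continuous_at_eps_delta dist_real_def by meson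
    obtain d3 where d3: "d3 > 0" "\<And>z. dist z x < d3 \<Longrightarrow> z \<in> S"
      using assms(1,3) unfolding open_dist by meson
    define d where "d = min d1 (min d2 d3)"
    \<comment> \<open>Keeps the parallelogram spanned by \<open>s *\<^sub>R v\<close> and
      \<open>s *\<^sub>R w\<close> within distance \<open>d\<close> of \<open>x\<close>; the summand
      1 makes the denominator positive even when both vectors vanish.\<close>
    define s where "s = d / (2 * (norm v + norm w + 1))"
    have np: "norm v + norm w + 1 > 0" by (smt (verit) norm_ge_zero)
    have "d > 0" using d1 d2 d3 by (simp add: d_def)
    then have "s > 0" using np by (simp add: s_def)
    have near: "dist (x + a *\<^sub>R v + b *\<^sub>R w) x < d" if "0 \<le> a" "a \<le> s" "0 \<le> b" "b \<le> s" for a b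
    proof -
      have "dist (x + a *\<^sub>R v + b *\<^sub>R w) x = norm (a *\<^sub>R v + b *\<^sub>R w)" by (simp add: dist_norm)
      also have "\<dots> \<le> a * norm v + b * norm w" using that norm_triangle_ineq[of "a *\<^sub>R v" "b *\<^sub>R w"] by simp
      also have "\<dots> \<le> s * norm v + s * norm w" using that by (intro add_mono mult_right_mono) auto
      also have "\<dots> < s * (norm v + norm w + 1)" using \<open>s > 0\<close> by (simp add: algebra_simps)
      also have "\<dots> = d / 2"
        unfolding s_def using np by (simp add: divide_simps del: distrib_left_numeral)
      finally show ?thesis using \<open>d > 0\<close> by simp
    qed
    have dS: "f differentiable (at z)" "(\<lambda>z. \<D> f z u) differentiable (at z)" if "z \<in> S" for z u
      using smooth_on_differentiable assms(2) sm that by blast+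
    have inS: "x + a *\<^sub>R v + b *\<^sub>R w \<in> S" "x + b *\<^sub>R w + a *\<^sub>R v \<in> S"
      if "0 \<le> a" "a \<le> s" "0 \<le> b" "b \<le> s" for a b
    proof -
      show "x + a *\<^sub>R v + b *\<^sub>R w \<in> S" using near[OF that] d3(2) by (simp add: d_def)
      then show "x + b *\<^sub>R w + a *\<^sub>R v \<in> S" by (simp add: algebra_simps)
    qed
    obtain a b where ab: "0 < a" "a < s" "0 < b" "b < s"
      "f (x + s *\<^sub>R v + s *\<^sub>R w) - f (x + s *\<^sub>R v) - f (x + s *\<^sub>R w) + f x
      = s * s * ?P (x + a *\<^sub>R v + b *\<^sub>R w)"
      by (rule second_difference_mvt[OF \<open>s > 0\<close>, of x v w S f]) (use inS dS in auto)
    obtain a' b' where ab': "0 < a'" "a' < s" "0 < b'" "b' < s"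
      "f (x + s *\<^sub>R w + s *\<^sub>R v) - f (x + s *\<^sub>R w) - f (x + s *\<^sub>R v) + f x
      = s * s * ?Q (x + a' *\<^sub>R w + b' *\<^sub>R v)"
      by (rule second_difference_mvt[OF \<open>s > 0\<close>, of x w v S f]) (use inS dS in auto)
    have "s * s * ?P (x + a *\<^sub>R v + b *\<^sub>R w) = s * s * ?Q (x + b' *\<^sub>R v + a' *\<^sub>R w)"
      using ab(5) ab'(5) by (simp add: algebra_simps)
    then have "?P (x + a *\<^sub>R v + b *\<^sub>R w) = ?Q (x + b' *\<^sub>R v + a' *\<^sub>R w)" using \<open>s > 0\<close> by simp
    moreover have "\<bar>?P (x + a *\<^sub>R v + b *\<^sub>R w) - ?P x\<bar> < \<epsilon>"
      using d1(2) near[of a b] ab by (auto simp: d_def)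
    moreover have "\<bar>?Q (x + b' *\<^sub>R v + a' *\<^sub>R w) - ?Q x\<bar> < \<epsilon>"
      using d2(2) near[of b' a'] ab' by (auto simp: d_def)
    ultimately show False unfolding \<epsilon>_def by (smt (verit) field_sum_of_halves)
  qed
qed

lemma second_derivative_symmetric:
  fixes f :: "'a::real_normed_vector \<Rightarrow> 'b::euclidean_space"
  assumes "open S" "smooth_on S f" "x \<in> S"
  shows "\<D> (\<lambda>z. \<D> f z v) x w
       = \<D> (\<lambda>z. \<D> f z w) x v"
proof (rule euclidean_eqI)
  fix b :: 'b
  let ?f = "\<lambda>z. f z \<bullet> b"
  have inner_D: "\<D> (\<lambda>z. h z \<bullet> b) z u = \<D> h z u \<bullet> b"
    if "smooth_on S h" "z \<in> S" for h :: "'a \<Rightarrow> 'b" and z u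
    using frechet_derivative_eqI[OF bounded_linear.has_derivative[OF bounded_linear_inner_left
          frechet_derivative_has[OF smooth_on_differentiable[OF that]]]] by metis
  have "\<D> (\<lambda>z. \<D> f z v') x w' \<bullet> b
      = \<D> (\<lambda>z. \<D> ?f z v') x w'" for v' w'
  proof -
    have "\<D> (\<lambda>z. \<D> ?f z v') x
        = \<D> (\<lambda>z. \<D> f z v' \<bullet> b) x"
      by (rule frechet_derivative_cong_open[OF assms(1,3)]) (simp add: inner_D assms(2))
    then show ?thesis by (simp add: inner_D smooth_on_derivative assms(2,3))
  qed
  moreover have "smooth_on S ?f"
    by (rule smooth_on_bounded_linear[OF assms(1) bounded_linear_inner_left assms(2)])
  ultimately show "\<D> (\<lambda>z. \<D> f z v) x w \<bullet> b
       = \<D> (\<lambda>z. \<D> f z w) x v \<bullet> b"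
    using second_derivative_symmetric_real[OF assms(1) _ assms(3)] by simp
qed

text \<open>The product rule for a moving linear map applied to a moving vector. For
  \<open>L\<close> only the derivatives along fixed vectors are assumed, which is what second
  derivatives supply; a finite basis recovers the rest.\<close>

lemma has_derivative_linear_family:
  fixes f :: "'a::real_normed_vector \<Rightarrow> 'b::euclidean_space"
  assumes S: "open S" "x \<in> S"
    and lin: "\<And>y. y \<in> S \<Longrightarrow> linear (L y)"
    and L: "\<And>b. ((\<lambda>y. L y b) has_derivative (\<lambda>w. L' w b)) (at x)"
    and f: "(f has_derivative f') (at x)"
  shows "((\<lambda>y. L y (f y)) has_derivative (\<lambda>w. L' w (f x) + L x (f' w))) (at x)"
proof -
  have L'lin: "linear (L' w)" for w
  proof (rule linearI)
    fix a b :: 'b and r :: real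
    have "((\<lambda>y. L y (a + b)) has_derivative (\<lambda>w. L' w a + L' w b)) (at x)"
      by (rule has_derivative_transform_within_open[OF has_derivative_add[OF L L] S])
        (simp add: lin linear_add)
    then show "L' w (a + b) = L' w a + L' w b" using has_derivative_unique[OF L] by metis
    have "((\<lambda>y. L y (r *\<^sub>R a)) has_derivative (\<lambda>w. r *\<^sub>R L' w a)) (at x)"
      by (rule has_derivative_transform_within_open[OF has_derivative_scaleR_right[OF L] S])
        (simp add: lin linear_scale)
    then show "L' w (r *\<^sub>R a) = r *\<^sub>R L' w a" using has_derivative_unique[OF L] by metis
  qed
  have "((\<lambda>y. \<Sum>b\<in>Basis. (f y \<bullet> b) *\<^sub>R L y b) has_derivative
     (\<lambda>w. \<Sum>b\<in>Basis. (f x \<bullet> b) *\<^sub>R L' w b + (f' w \<bullet> b) *\<^sub>R L x b)) (at x)"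
    by (intro has_derivative_sum has_derivative_scaleR L
        bounded_linear.has_derivative[OF bounded_linear_inner_left f])
  moreover have "(\<Sum>b\<in>Basis. (f x \<bullet> b) *\<^sub>R L' w b + (f' w \<bullet> b) *\<^sub>R L x b) = L' w (f x) + L x (f' w)" for w
    by (simp add: sum.distrib linear_euclidean_expansion[OF L'lin, of w "f x"]
        linear_euclidean_expansion[OF lin[OF S(2)], of "f' w"])
  ultimately have "((\<lambda>y. \<Sum>b\<in>Basis. (f y \<bullet> b) *\<^sub>R L y b) has_derivative (\<lambda>w. L' w (f x) + L x (f' w))) (at x)"
    by simp
  then show ?thesis
    by (rule has_derivative_transform_within_open[OF _ S])
      (simp add: linear_euclidean_expansion[OF lin, symmetric])
qed

lemma has_derivative_eventually_eq:
  assumes "(f has_derivative f') (at x)" "eventually (\<lambda>y. f y = g y) (nhds x)"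
  shows "(g has_derivative f') (at x)"
proof -
  obtain S where "open S" "x \<in> S" "\<And>y. y \<in> S \<Longrightarrow> f y = g y"
    using assms(2) unfolding eventually_nhds by blast
  then show ?thesis using has_derivative_transform_within_open[OF assms(1)] by metis
qed

lemma isCont_eventually_in:
  "isCont f x \<Longrightarrow> open S \<Longrightarrow> f x \<in> S \<Longrightarrow> eventually (\<lambda>y. f y \<in> S) (nhds x)"
  unfolding continuous_at_open eventually_nhds by blast

section \<open>Charts\<close>

context
  fixes c :: "('g::topological_space, 'n::finite) chart"
  assumes c: "is_chart c"
begin

lemma open_chart_domain: "open (fst c)" and open_chart_image: "open (chart_image c)"
  using c by (auto simp: is_chart_def)

lemma chart_inv_chart: "x \<in> fst c \<Longrightarrow> chart_inv c (snd c x) = x"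
  using c by (auto simp: is_chart_def homeomorphism_def)

lemma chart_chart_inv: "p \<in> chart_image c \<Longrightarrow> snd c (chart_inv c p) = p"
  using c by (auto simp: is_chart_def homeomorphism_def)

lemma chart_in_image: "x \<in> fst c \<Longrightarrow> snd c x \<in> chart_image c"
  by (auto simp: chart_image_def)

lemma chart_inv_in_domain: "p \<in> chart_image c \<Longrightarrow> chart_inv c p \<in> fst c"
  using c unfolding is_chart_def homeomorphism_def by blast

lemma isCont_chart_inv: "p \<in> chart_image c \<Longrightarrow> isCont (chart_inv c) p"
  using c open_chart_image continuous_on_eq_continuous_at
  unfolding is_chart_def homeomorphism_def by blast

end

lemma isCont_chart:
  fixes c :: "('g::t2_space, 'n::finite) chart"
  shows "is_chart c \<Longrightarrow> x \<in> fst c \<Longrightarrow> isCont (snd c) x"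
  using open_chart_domain continuous_on_eq_continuous_at
  unfolding is_chart_def homeomorphism_def by blast

text \<open>Continuity of \<sigma> at \<open>t\<close> is demanded as well: the coordinate map is
  meaningful on its domain only, so \<sigma> has to stay there near \<open>t\<close> for
  \<open>L\<close> to be its derivative.\<close>

definition has_chart_deriv ::
  "('a::real_normed_vector \<Rightarrow> 'g::topological_space) \<Rightarrow> 'a \<Rightarrow> ('g, 'n::finite) chart \<Rightarrow>
    ('a \<Rightarrow> real ^ 'n) \<Rightarrow> bool" where
  "has_chart_deriv \<sigma> t c L \<longleftrightarrow>
     \<sigma> t \<in> fst c \<and> isCont \<sigma> t \<and> ((\<lambda>s. snd c (\<sigma> s)) has_derivative L) (at t)"

lemma has_chart_deriv_chart_inv:
  assumes "is_chart c" "p \<in> chart_image c"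
  shows "has_chart_deriv (chart_inv c) p c (\<lambda>v. v)"
  unfolding has_chart_deriv_def
proof (intro conjI)
  show "((\<lambda>s. snd c (chart_inv c s)) has_derivative (\<lambda>v. v)) (at p)"
    by (rule has_derivative_transform_within_open[OF has_derivative_ident open_chart_image[OF assms(1)] assms(2)])
      (simp add: chart_chart_inv assms)
qed (simp_all add: assms chart_inv_in_domain isCont_chart_inv)

lemma has_chart_deriv_const:
  "x \<in> fst c \<Longrightarrow> has_chart_deriv (\<lambda>t. x) t c (\<lambda>v. 0)"
  by (simp add: has_chart_deriv_def)

lemma has_chart_deriv_unique:
  "has_chart_deriv \<sigma> t c L \<Longrightarrow> has_chart_deriv \<sigma> t c L' \<Longrightarrow> L = L'"
  unfolding has_chart_deriv_def using has_derivative_unique by blast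

lemma has_chart_deriv_compose:
  assumes "(h has_derivative h') (at t)" "has_chart_deriv \<sigma> (h t) c L"
  shows "has_chart_deriv (\<lambda>s. \<sigma> (h s)) t c (\<lambda>v. L (h' v))"
  using assms diff_chain_at[OF assms(1), of "\<lambda>s. snd c (\<sigma> s)" L]
    isCont_o2[OF has_derivative_continuous[OF assms(1)], of \<sigma>]
  unfolding has_chart_deriv_def by (simp add: o_def)

section \<open>Multiplication, inversion and translations of a Lie group in charts\<close>

locale lie =
  fixes G :: "('g::{t2_space,second_countable_topology}) monoid"
    and A :: "('g, 'n::finite) chart set"
  assumes lie_group: "lie_group G A"
begin

abbreviation mul :: "'g \<Rightarrow> 'g \<Rightarrow> 'g" (infixl "\<cdot>" 70) where "a \<cdot> b \<equiv> a \<otimes>\<^bsub>G\<^esub> b"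
abbreviation iv :: "'g \<Rightarrow> 'g" where "iv a \<equiv> inv\<^bsub>G\<^esub> a"
abbreviation unit :: 'g where "unit \<equiv> \<one>\<^bsub>G\<^esub>"

lemma group_G: "group G" and carrier_G: "carrier G = UNIV" and atlas: "smooth_atlas A"
  using lie_group by (auto simp: lie_group_def)

lemma mul_assoc: "a \<cdot> b \<cdot> x = a \<cdot> (b \<cdot> x)"
  using group_G carrier_G by (simp add: group.is_monoid monoid.m_assoc)

lemma mul_unit [simp]: "unit \<cdot> a = a" "a \<cdot> unit = a"
  using group_G carrier_G by (simp_all add: group.is_monoid)

lemma mul_iv [simp]: "a \<cdot> iv a = unit" "iv a \<cdot> a = unit" "a \<cdot> (iv a \<cdot> b) = b" "iv a \<cdot> (a \<cdot> b) = b"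
  using group_G carrier_G by (simp_all add: group.r_inv group.l_inv flip: mul_assoc)

lemma iv_iv [simp]: "iv (iv a) = a" and iv_unit [simp]: "iv unit = unit"
  and iv_mul: "iv (a \<cdot> b) = iv b \<cdot> iv a"
  using group_G carrier_G
  by (simp_all add: group.inv_inv group.inv_mult_group monoid.inv_one group.is_monoid)

lemma chart_in_charts: "c \<in> A \<Longrightarrow> c \<in> charts A"
  using atlas by (auto simp: smooth_atlas_def charts_def)

lemma is_chart: "c \<in> charts A \<Longrightarrow> is_chart c"
  by (auto simp: charts_def)

lemma chart_at: "chart_at A x \<in> charts A" "x \<in> fst (chart_at A x)"
proof -
  have "x \<in> (\<Union>c\<in>A. fst c)" using atlas by (simp add: smooth_atlas_def)
  then have "\<exists>c. c \<in> A \<and> x \<in> fst c" by blast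
  from someI_ex[OF this] show "chart_at A x \<in> charts A" "x \<in> fst (chart_at A x)"
    unfolding chart_at_def using chart_in_charts by auto
qed

lemma isCont_mul:
  fixes \<sigma> \<tau> :: "'a::t2_space \<Rightarrow> 'g"
  assumes "isCont \<sigma> t" "isCont \<tau> t"
  shows "isCont (\<lambda>t. \<sigma> t \<cdot> \<tau> t) t"
proof -
  have "isCont (\<lambda>(a, b). a \<cdot> b) (\<sigma> t, \<tau> t)"
    using lie_group by (simp add: lie_group_def continuous_on_eq_continuous_at)
  from isCont_o2[OF continuous_Pair[OF assms] this] show ?thesis by simp
qed

lemma isCont_iv:
  fixes \<sigma> :: "'a::t2_space \<Rightarrow> 'g"
  assumes "isCont \<sigma> t"
  shows "isCont (\<lambda>t. iv (\<sigma> t)) t"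
proof -
  have "isCont (\<lambda>a. iv a) (\<sigma> t)"
    using lie_group by (simp add: lie_group_def continuous_on_eq_continuous_at)
  from isCont_o2[OF assms this] show ?thesis .
qed

definition chart_mul ::
  "('g, 'n) chart \<Rightarrow> ('g, 'n) chart \<Rightarrow> ('g, 'n) chart \<Rightarrow> (real ^ 'n) \<times> (real ^ 'n) \<Rightarrow> real ^ 'n" where
  "chart_mul c d e = (\<lambda>(p, q). snd e (chart_inv c p \<cdot> chart_inv d q))"

definition mul_domain ::
  "('g, 'n) chart \<Rightarrow> ('g, 'n) chart \<Rightarrow> ('g, 'n) chart \<Rightarrow> ((real ^ 'n) \<times> (real ^ 'n)) set" where
  "mul_domain c d e = {(p, q). p \<in> chart_image c \<and> q \<in> chart_image d \<and>
     chart_inv c p \<cdot> chart_inv d q \<in> fst e}"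

lemma smooth_chart_mul:
  "c \<in> charts A \<Longrightarrow> d \<in> charts A \<Longrightarrow> e \<in> charts A \<Longrightarrow> smooth_on (mul_domain c d e) (chart_mul c d e)"
  using lie_group by (simp add: lie_group_def mul_domain_def chart_mul_def)

lemma open_mul_domain:
  assumes "c \<in> charts A" "d \<in> charts A" "e \<in> charts A"
  shows "open (mul_domain c d e)"
proof -
  let ?P = "chart_image c \<times> chart_image d"
  let ?f = "\<lambda>z. chart_inv c (fst z) \<cdot> chart_inv d (snd z)"
  note ch = assms[THEN is_chart]
  have P: "open ?P" by (intro open_Times open_chart_image ch)
  have "isCont ?f z" if "z \<in> ?P" for z
    using that by (intro isCont_mul isCont_o2[OF _ isCont_chart_inv] ch continuous_intros) auto
  then have "continuous_on ?P ?f" by (simp add: continuous_at_imp_continuous_on)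
  then have "open (?P \<inter> ?f -` fst e)"
    using P open_chart_domain[OF ch(3)] by (rule continuous_open_preimage)
  also have "?P \<inter> ?f -` fst e = mul_domain c d e" by (auto simp: mul_domain_def)
  finally show ?thesis .
qed

lemma smooth_chart_iv:
  "c \<in> charts A \<Longrightarrow> e \<in> charts A \<Longrightarrow>
    smooth_on {p \<in> chart_image c. iv (chart_inv c p) \<in> fst e} (\<lambda>p. snd e (iv (chart_inv c p)))"
  using lie_group by (simp add: lie_group_def)

lemma open_iv_domain:
  assumes "c \<in> charts A" "e \<in> charts A"
  shows "open {p \<in> chart_image c. iv (chart_inv c p) \<in> fst e}"
proof -
  let ?f = "\<lambda>p. iv (chart_inv c p)"
  note ch = assms[THEN is_chart]
  have "continuous_on (chart_image c) ?f"
    by (intro continuous_at_imp_continuous_on ballI isCont_iv isCont_chart_inv ch)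
  then have "open (chart_image c \<inter> ?f -` fst e)"
    using open_chart_image[OF ch(1)] open_chart_domain[OF ch(2)] by (rule continuous_open_preimage)
  also have "chart_image c \<inter> ?f -` fst e = {p \<in> chart_image c. ?f p \<in> fst e}" by auto
  finally show ?thesis .
qed

lemma mul_domainI:
  "c \<in> charts A \<Longrightarrow> d \<in> charts A \<Longrightarrow> x \<in> fst c \<Longrightarrow> y \<in> fst d \<Longrightarrow> x \<cdot> y \<in> fst e \<Longrightarrow>
    (snd c x, snd d y) \<in> mul_domain c d e"
  by (simp add: mul_domain_def chart_in_image is_chart chart_inv_chart)

lemma chart_mul_chart:
  "c \<in> charts A \<Longrightarrow> d \<in> charts A \<Longrightarrow> x \<in> fst c \<Longrightarrow> y \<in> fst d \<Longrightarrow>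
    chart_mul c d e (snd c x, snd d y) = snd e (x \<cdot> y)"
  by (simp add: chart_mul_def is_chart chart_inv_chart)

lemma has_chart_deriv_mul:
  assumes ch: "c \<in> charts A" "d \<in> charts A" "e \<in> charts A"
    and \<sigma>: "has_chart_deriv \<sigma> t c L" and \<tau>: "has_chart_deriv \<tau> t d K"
    and e: "\<sigma> t \<cdot> \<tau> t \<in> fst e"
  shows "has_chart_deriv (\<lambda>t. \<sigma> t \<cdot> \<tau> t) t e
    (\<lambda>v. \<D> (chart_mul c d e) (snd c (\<sigma> t), snd d (\<tau> t)) (L v, K v))"
  unfolding has_chart_deriv_def
proof (intro conjI)
  let ?m = "chart_mul c d e"
  have in_dom: "\<sigma> t \<in> fst c" "\<tau> t \<in> fst d" and cont: "isCont \<sigma> t" "isCont \<tau> t"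
    and der: "((\<lambda>s. snd c (\<sigma> s)) has_derivative L) (at t)" "((\<lambda>s. snd d (\<tau> s)) has_derivative K) (at t)"
    using \<sigma> \<tau> by (auto simp: has_chart_deriv_def)
  show "isCont (\<lambda>t. \<sigma> t \<cdot> \<tau> t) t" using cont by (rule isCont_mul)
  have "?m differentiable (at (snd c (\<sigma> t), snd d (\<tau> t)))"
    by (rule smooth_on_differentiable[OF smooth_chart_mul[OF ch] mul_domainI[OF ch(1,2) in_dom e]])
  from diff_chain_at[OF has_derivative_Pair[OF der] frechet_derivative_has[OF this]]
  have d: "((\<lambda>s. ?m (snd c (\<sigma> s), snd d (\<tau> s))) has_derivative
      (\<lambda>v. \<D> ?m (snd c (\<sigma> t), snd d (\<tau> t)) (L v, K v))) (at t)"
    by (simp add: o_def)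
  have "eventually (\<lambda>s. \<sigma> s \<in> fst c) (nhds t)" "eventually (\<lambda>s. \<tau> s \<in> fst d) (nhds t)"
    using isCont_eventually_in cont in_dom open_chart_domain ch is_chart by blast+
  then have "eventually (\<lambda>s. ?m (snd c (\<sigma> s), snd d (\<tau> s)) = snd e (\<sigma> s \<cdot> \<tau> s)) (nhds t)"
    by eventually_elim (simp add: chart_mul_chart ch)
  with d show "((\<lambda>s. snd e (\<sigma> s \<cdot> \<tau> s)) has_derivative
      (\<lambda>v. \<D> ?m (snd c (\<sigma> t), snd d (\<tau> t)) (L v, K v))) (at t)"
    by (rule has_derivative_eventually_eq)
qed (rule e)

text \<open>Only existence is recorded. Where the value matters, it is found by differentiating
  \<open>\<sigma> t \<cdot> iv (\<sigma> t) = unit\<close>.\<close>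

lemma has_chart_deriv_iv:
  assumes ch: "c \<in> charts A" "e \<in> charts A"
    and \<sigma>: "has_chart_deriv \<sigma> t c L" and e: "iv (\<sigma> t) \<in> fst e"
  shows "\<exists>K. has_chart_deriv (\<lambda>t. iv (\<sigma> t)) t e K"
proof -
  let ?m = "\<lambda>p. snd e (iv (chart_inv c p))"
  have in_dom: "\<sigma> t \<in> fst c" and cont: "isCont \<sigma> t"
    and der: "((\<lambda>s. snd c (\<sigma> s)) has_derivative L) (at t)"
    using \<sigma> by (auto simp: has_chart_deriv_def)
  have "?m differentiable (at (snd c (\<sigma> t)))"
    by (rule smooth_on_differentiable[OF smooth_chart_iv[OF ch]])
      (simp add: in_dom e ch is_chart chart_in_image chart_inv_chart)
  from diff_chain_at[OF der frechet_derivative_has[OF this]]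
  obtain K where d: "((\<lambda>s. ?m (snd c (\<sigma> s))) has_derivative K) (at t)"
    by (auto simp: o_def)
  have "eventually (\<lambda>s. \<sigma> s \<in> fst c) (nhds t)"
    using isCont_eventually_in cont in_dom open_chart_domain ch is_chart by blast
  then have "eventually (\<lambda>s. ?m (snd c (\<sigma> s)) = snd e (iv (\<sigma> s))) (nhds t)"
    by eventually_elim (simp add: chart_inv_chart ch is_chart)
  with d have "((\<lambda>s. snd e (iv (\<sigma> s))) has_derivative K) (at t)"
    by (rule has_derivative_eventually_eq)
  then show ?thesis using isCont_iv[OF cont] e unfolding has_chart_deriv_def by blast
qed

text \<open>The differentials of left and right translations, from the point with coordinates \<open>p\<close> in the
  chart \<open>c\<close> to the chart \<open>d\<close>. With the unit as first argument this is a change of coordinates.\<close>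

definition LT :: "'g \<Rightarrow> ('g, 'n) chart \<Rightarrow> ('g, 'n) chart \<Rightarrow> real ^ 'n \<Rightarrow> real ^ 'n \<Rightarrow> real ^ 'n" where
  "LT a c d p = \<D> (\<lambda>q. snd d (a \<cdot> chart_inv c q)) p"

definition RT :: "'g \<Rightarrow> ('g, 'n) chart \<Rightarrow> ('g, 'n) chart \<Rightarrow> real ^ 'n \<Rightarrow> real ^ 'n \<Rightarrow> real ^ 'n" where
  "RT a c d p = \<D> (\<lambda>q. snd d (chart_inv c q \<cdot> a)) p"

text \<open>Written as partial derivatives of the multiplication, the differentials of translations
  depend smoothly on the translating element as well as on the point.\<close>

lemma
  assumes ch: "b \<in> charts A" "c \<in> charts A" "d \<in> charts A"
    and p: "p \<in> chart_image c" and d: "a \<cdot> chart_inv c p \<in> fst d" and b: "a \<in> fst b"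
  shows LT_eq: "LT a c d p = (\<lambda>v. \<D> (chart_mul b c d) (snd b a, p) (0, v))"
    and has_chart_deriv_LT: "has_chart_deriv (\<lambda>q. a \<cdot> chart_inv c q) p d (LT a c d p)"
proof -
  have D: "has_chart_deriv (\<lambda>q. a \<cdot> chart_inv c q) p d
      (\<lambda>v. \<D> (chart_mul b c d) (snd b a, p) (0, v))"
    using has_chart_deriv_mul[OF ch has_chart_deriv_const[OF b]
        has_chart_deriv_chart_inv[OF is_chart[OF ch(2)] p] d]
    by (simp add: chart_chart_inv is_chart ch p)
  then show eq: "LT a c d p = (\<lambda>v. \<D> (chart_mul b c d) (snd b a, p) (0, v))"
    unfolding LT_def has_chart_deriv_def by (simp add: frechet_derivative_eqI)
  show "has_chart_deriv (\<lambda>q. a \<cdot> chart_inv c q) p d (LT a c d p)" using D eq by simp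
qed

lemma
  assumes ch: "b \<in> charts A" "c \<in> charts A" "d \<in> charts A"
    and p: "p \<in> chart_image c" and d: "chart_inv c p \<cdot> a \<in> fst d" and b: "a \<in> fst b"
  shows RT_eq: "RT a c d p = (\<lambda>v. \<D> (chart_mul c b d) (p, snd b a) (v, 0))"
    and has_chart_deriv_RT: "has_chart_deriv (\<lambda>q. chart_inv c q \<cdot> a) p d (RT a c d p)"
proof -
  have D: "has_chart_deriv (\<lambda>q. chart_inv c q \<cdot> a) p d
      (\<lambda>v. \<D> (chart_mul c b d) (p, snd b a) (v, 0))"
    using has_chart_deriv_mul[OF ch(2,1,3) has_chart_deriv_chart_inv[OF is_chart[OF ch(2)] p]
         has_chart_deriv_const[OF b] d]
    by (simp add: chart_chart_inv is_chart ch p)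
  then show eq: "RT a c d p = (\<lambda>v. \<D> (chart_mul c b d) (p, snd b a) (v, 0))"
    unfolding RT_def has_chart_deriv_def by (simp add: frechet_derivative_eqI)
  show "has_chart_deriv (\<lambda>q. chart_inv c q \<cdot> a) p d (RT a c d p)" using D eq by simp
qed

lemma has_chart_deriv_product:
  assumes ch: "c \<in> charts A" "d \<in> charts A" "e \<in> charts A"
    and \<sigma>: "has_chart_deriv \<sigma> t c L" and \<tau>: "has_chart_deriv \<tau> t d K"
    and e: "\<sigma> t \<cdot> \<tau> t \<in> fst e"
  shows "has_chart_deriv (\<lambda>t. \<sigma> t \<cdot> \<tau> t) t e
    (\<lambda>v. RT (\<tau> t) c e (snd c (\<sigma> t)) (L v) + LT (\<sigma> t) d e (snd d (\<tau> t)) (K v))"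
proof -
  let ?m = "chart_mul c d e" let ?z = "(snd c (\<sigma> t), snd d (\<tau> t))"
  have in_dom: "\<sigma> t \<in> fst c" "\<tau> t \<in> fst d" using \<sigma> \<tau> by (auto simp: has_chart_deriv_def)
  have "linear (\<D> ?m ?z)"
    by (rule linear_frechet_derivative[OF smooth_on_differentiable[OF smooth_chart_mul[OF ch] mul_domainI[OF ch(1,2) in_dom e]]])
  from linear_add[OF this, of "(L v, 0)" "(0, K v)" for v]
  have "\<D> ?m ?z (L v, K v)
      = RT (\<tau> t) c e (snd c (\<sigma> t)) (L v) + LT (\<sigma> t) d e (snd d (\<tau> t)) (K v)" for v
    using in_dom e ch by (simp add: RT_eq[OF ch(2,1,3)] LT_eq[OF ch] chart_in_image is_chart chart_inv_chart)
  with has_chart_deriv_mul[OF assms] show ?thesis by simp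
qed

lemma has_chart_deriv_left:
  assumes ch: "c \<in> charts A" "d \<in> charts A" and \<tau>: "has_chart_deriv \<tau> t c K" and d: "a \<cdot> \<tau> t \<in> fst d"
  shows "has_chart_deriv (\<lambda>t. a \<cdot> \<tau> t) t d (\<lambda>v. LT a c d (snd c (\<tau> t)) (K v))"
proof -
  let ?b = "chart_at A a"
  have in_dom: "\<tau> t \<in> fst c" using \<tau> by (auto simp: has_chart_deriv_def)
  show ?thesis
    using has_chart_deriv_mul[OF chart_at(1) ch has_chart_deriv_const[OF chart_at(2)] \<tau> d]
    by (simp add: LT_eq[OF chart_at(1) ch _ _ chart_at(2)] chart_in_image is_chart ch in_dom chart_inv_chart d)
qed

lemma has_chart_deriv_right:
  assumes ch: "c \<in> charts A" "d \<in> charts A" and \<tau>: "has_chart_deriv \<tau> t c K" and d: "\<tau> t \<cdot> a \<in> fst d"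
  shows "has_chart_deriv (\<lambda>t. \<tau> t \<cdot> a) t d (\<lambda>v. RT a c d (snd c (\<tau> t)) (K v))"
proof -
  let ?b = "chart_at A a"
  have in_dom: "\<tau> t \<in> fst c" using \<tau> by (auto simp: has_chart_deriv_def)
  show ?thesis
    using has_chart_deriv_mul[OF ch(1) chart_at(1) ch(2) \<tau> has_chart_deriv_const[OF chart_at(2)] d]
    by (simp add: RT_eq[OF chart_at(1) ch _ _ chart_at(2)] chart_in_image is_chart ch in_dom chart_inv_chart d)
qed

lemma linear_LT:
  assumes "c \<in> charts A" "d \<in> charts A" "p \<in> chart_image c" "a \<cdot> chart_inv c p \<in> fst d"
  shows "linear (LT a c d p)"
  using has_chart_deriv_LT[OF chart_at(1) assms chart_at(2)]
  unfolding has_chart_deriv_def by (meson has_derivative_linear)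

lemma linear_RT:
  assumes "c \<in> charts A" "d \<in> charts A" "p \<in> chart_image c" "chart_inv c p \<cdot> a \<in> fst d"
  shows "linear (RT a c d p)"
  using has_chart_deriv_RT[OF chart_at(1) assms chart_at(2)]
  unfolding has_chart_deriv_def by (meson has_derivative_linear)

text \<open>The chain rule. As \<open>LT unit\<close> is a change of coordinates, this covers every
  mixture of translations and chart changes, and so removes the selected charts from the intrinsic
  definitions.\<close>

lemma LT_LT:
  assumes ch: "c \<in> charts A" "d \<in> charts A" "e \<in> charts A" and x: "x \<in> fst c" "b \<cdot> x \<in> fst d" "a \<cdot> (b \<cdot> x) \<in> fst e"
  shows "LT a d e (snd d (b \<cdot> x)) (LT b c d (snd c x) v) = LT (a \<cdot> b) c e (snd c x) v"
proof -
  have p: "snd c x \<in> chart_image c" and ix: "chart_inv c (snd c x) = x"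
    using x ch by (simp_all add: chart_in_image is_chart chart_inv_chart)
  have "has_chart_deriv (\<lambda>q. b \<cdot> chart_inv c q) (snd c x) d (LT b c d (snd c x))"
    by (rule has_chart_deriv_LT[OF chart_at(1) ch(1,2) p _ chart_at(2)]) (simp add: ix x)
  from has_chart_deriv_left[OF ch(2,3) this, of a]
  have "has_chart_deriv (\<lambda>q. a \<cdot> b \<cdot> chart_inv c q) (snd c x) e
      (\<lambda>v. LT a d e (snd d (b \<cdot> x)) (LT b c d (snd c x) v))"
    using x by (simp add: ix mul_assoc)
  moreover have "has_chart_deriv (\<lambda>q. a \<cdot> b \<cdot> chart_inv c q) (snd c x) e (LT (a \<cdot> b) c e (snd c x))"
    by (rule has_chart_deriv_LT[OF chart_at(1) ch(1,3) p _ chart_at(2)]) (simp add: ix x mul_assoc)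
  ultimately show ?thesis using has_chart_deriv_unique by metis
qed

lemma LT_unit [simp]:
  assumes "c \<in> charts A" "p \<in> chart_image c"
  shows "LT unit c c p v = v"
proof -
  have "has_chart_deriv (\<lambda>q. unit \<cdot> chart_inv c q) p c (LT unit c c p)"
    by (rule has_chart_deriv_LT[OF chart_at(1) assms(1,1,2) _ chart_at(2)])
      (simp add: chart_inv_in_domain is_chart assms)
  moreover have "has_chart_deriv (\<lambda>q. unit \<cdot> chart_inv c q) p c (\<lambda>v. v)"
    using has_chart_deriv_chart_inv[OF is_chart[OF assms(1)] assms(2)] by simp
  ultimately show ?thesis using has_chart_deriv_unique by metis
qed

lemma RT_unit [simp]:
  assumes "c \<in> charts A" "p \<in> chart_image c"
  shows "RT unit c c p v = v"
proof -
  have "RT unit c c p = LT unit c c p" by (simp add: RT_def LT_def)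
  then show ?thesis using LT_unit[OF assms] by simp
qed

text \<open>Element and point move together, and the derivative is a second derivative of the
  multiplication. This is the source of the bracket.\<close>

lemma LT_differentiable:
  assumes ch: "c \<in> charts A" "d \<in> charts A" "e \<in> charts A"
    and \<sigma>: "has_chart_deriv \<sigma> t c L" and \<tau>: "has_chart_deriv \<tau> t d K"
    and e: "\<sigma> t \<cdot> \<tau> t \<in> fst e"
  shows "((\<lambda>s. LT (\<sigma> s) d e (snd d (\<tau> s)) v) has_derivative
     (\<lambda>w. \<D> (\<lambda>z. \<D> (chart_mul c d e) z (0, v)) (snd c (\<sigma> t), snd d (\<tau> t)) (L w, K w))) (at t)"
    and RT_differentiable: "((\<lambda>s. RT (\<tau> s) c e (snd c (\<sigma> s)) v) has_derivative
     (\<lambda>w. \<D> (\<lambda>z. \<D> (chart_mul c d e) z (v, 0)) (snd c (\<sigma> t), snd d (\<tau> t)) (L w, K w))) (at t)"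
proof -
  let ?m = "chart_mul c d e"
  have in_dom: "\<sigma> t \<in> fst c" "\<tau> t \<in> fst d" and cont: "isCont \<sigma> t" "isCont \<tau> t"
    and der: "((\<lambda>s. snd c (\<sigma> s)) has_derivative L) (at t)" "((\<lambda>s. snd d (\<tau> s)) has_derivative K) (at t)"
    using \<sigma> \<tau> by (auto simp: has_chart_deriv_def)
  have D: "((\<lambda>s. \<D> ?m (snd c (\<sigma> s), snd d (\<tau> s)) u) has_derivative
      (\<lambda>w. \<D> (\<lambda>z. \<D> ?m z u) (snd c (\<sigma> t), snd d (\<tau> t)) (L w, K w))) (at t)"
    for u
  proof -
    have "(\<lambda>z. \<D> ?m z u) differentiable (at (snd c (\<sigma> t), snd d (\<tau> t)))"
      by (rule smooth_on_differentiable[OF smooth_on_derivative[OF smooth_chart_mul[OF ch]]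
            mul_domainI[OF ch(1,2) in_dom e]])
    from diff_chain_at[OF has_derivative_Pair[OF der] frechet_derivative_has[OF this]]
    show ?thesis by (simp add: o_def)
  qed
  have ev: "eventually (\<lambda>s. \<sigma> s \<in> fst c) (nhds t)" "eventually (\<lambda>s. \<tau> s \<in> fst d) (nhds t)"
    "eventually (\<lambda>s. \<sigma> s \<cdot> \<tau> s \<in> fst e) (nhds t)"
    using isCont_eventually_in[OF cont(1)] isCont_eventually_in[OF cont(2)]
      isCont_eventually_in[OF isCont_mul[OF cont]] in_dom e
    by (simp_all add: open_chart_domain ch is_chart)
  from ev have "eventually (\<lambda>s. \<D> ?m (snd c (\<sigma> s), snd d (\<tau> s)) (0, v)
      = LT (\<sigma> s) d e (snd d (\<tau> s)) v) (nhds t)"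
    by eventually_elim (simp add: LT_eq[OF ch] chart_in_image is_chart ch chart_inv_chart)
  with D show "((\<lambda>s. LT (\<sigma> s) d e (snd d (\<tau> s)) v) has_derivative
     (\<lambda>w. \<D> (\<lambda>z. \<D> (chart_mul c d e) z (0, v)) (snd c (\<sigma> t), snd d (\<tau> t)) (L w, K w))) (at t)"
    by (rule has_derivative_eventually_eq)
  from ev have "eventually (\<lambda>s. \<D> ?m (snd c (\<sigma> s), snd d (\<tau> s)) (v, 0)
      = RT (\<tau> s) c e (snd c (\<sigma> s)) v) (nhds t)"
    by eventually_elim (simp add: RT_eq[OF ch(2,1,3)] chart_in_image is_chart ch chart_inv_chart)
  with D show "((\<lambda>s. RT (\<tau> s) c e (snd c (\<sigma> s)) v) has_derivative
     (\<lambda>w. \<D> (\<lambda>z. \<D> (chart_mul c d e) z (v, 0)) (snd c (\<sigma> t), snd d (\<tau> t)) (L w, K w))) (at t)"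
    by (rule has_derivative_eventually_eq)
qed

end

section \<open>Left invariant frames, the Maurer-Cartan form and the bracket\<close>

context lie
begin

abbreviation e0 :: "('g, 'n) chart" where "e0 \<equiv> chart_at A unit"
abbreviation q0 :: "real ^ 'n" where "q0 \<equiv> snd e0 unit"
abbreviation bracket :: "real ^ 'n \<Rightarrow> real ^ 'n \<Rightarrow> real ^ 'n" where "bracket \<equiv> lie_bracket G A"

lemma q0_in_image [simp]: "q0 \<in> chart_image e0"
  by (simp add: chart_in_image is_chart chart_at)

lemma chart_inv_q0 [simp]: "chart_inv e0 q0 = unit"
  by (simp add: chart_inv_chart is_chart chart_at)

text \<open>\<open>frame c p v\<close> is the value at \<open>p\<close> of the left invariant field of \<open>v\<close>, and the inverse
  \<open>coframe c p\<close> is the Maurer-Cartan form, both in the coordinates of \<open>c\<close>.\<close>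

definition frame :: "('g, 'n) chart \<Rightarrow> real ^ 'n \<Rightarrow> real ^ 'n \<Rightarrow> real ^ 'n" where
  "frame c p = LT (chart_inv c p) e0 c q0"

definition coframe :: "('g, 'n) chart \<Rightarrow> real ^ 'n \<Rightarrow> real ^ 'n \<Rightarrow> real ^ 'n" where
  "coframe c p = LT (iv (chart_inv c p)) c e0 p"

context
  fixes c p
  assumes c: "c \<in> charts A" and p: "p \<in> chart_image c"
begin

lemma frame_coframe: "frame c p (coframe c p v) = v"
  using LT_LT[of c e0 c "chart_inv c p" "iv (chart_inv c p)" "chart_inv c p" v, OF c chart_at(1) c]
  by (simp add: frame_def coframe_def c p is_chart chart_inv_in_domain chart_chart_inv chart_at)

lemma coframe_frame: "coframe c p (frame c p v) = v"
  using LT_LT[of e0 c e0 unit "chart_inv c p" "iv (chart_inv c p)" v, OF chart_at(1) c chart_at(1)]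
  by (simp add: frame_def coframe_def c p is_chart chart_inv_in_domain chart_chart_inv chart_at)

lemma linear_frame: "linear (frame c p)"
  unfolding frame_def
  by (rule linear_LT[OF chart_at(1) c]) (simp_all add: c p is_chart chart_inv_in_domain)

lemma linear_coframe: "linear (coframe c p)"
  unfolding coframe_def
  by (rule linear_LT[OF c chart_at(1) p]) (simp add: chart_at)

lemma has_derivative_frame:
  "((\<lambda>p. frame c p v) has_derivative
     (\<lambda>w. \<D> (\<lambda>z. \<D> (chart_mul c e0 c) z (0, v)) (p, q0) (w, 0)))
     (at p)"
  using LT_differentiable[of c e0 c, OF c chart_at(1) c has_chart_deriv_chart_inv[OF is_chart[OF c] p]
      has_chart_deriv_const[OF chart_at(2)], where v=v]
  by (simp add: frame_def c p is_chart chart_inv_in_domain chart_chart_inv)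

lemma coframe_differentiable: "(\<lambda>p. coframe c p y) differentiable (at p)"
proof -
  let ?x = "chart_inv c p"
  have inv: "has_chart_deriv (chart_inv c) p c (\<lambda>v. v)"
    by (rule has_chart_deriv_chart_inv[OF is_chart[OF c] p])
  obtain K where K: "has_chart_deriv (\<lambda>p. iv (chart_inv c p)) p (chart_at A (iv ?x)) K"
    using has_chart_deriv_iv[OF c chart_at(1) inv chart_at(2)] by blast
  have *: "iv ?x \<cdot> ?x \<in> fst e0" by (simp add: chart_at)
  from LT_differentiable[OF chart_at(1) c chart_at(1) K inv *]
  have "(\<lambda>s. LT (iv (chart_inv c s)) c e0 (snd c (chart_inv c s)) y) differentiable (at p)"
    unfolding differentiable_def by blast
  then show ?thesis
    by (subst differentiable_cong_open[OF open_chart_image[OF is_chart[OF c]] p, of _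
          "\<lambda>s. LT (iv (chart_inv c s)) c e0 (snd c (chart_inv c s)) y"])
      (simp_all add: coframe_def chart_chart_inv c is_chart)
qed

end

lemma left_translation_differential_eq:
  "left_translation_differential G A a x = LT a (chart_at A x) (chart_at A (a \<cdot> x)) (snd (chart_at A x) x)"
  by (simp add: left_translation_differential_def differential_def LT_def o_def fun_eq_iff)

lemma tangent_vector_eq:
  "tangent_vector A c p = LT unit c (chart_at A (chart_inv c p)) p"
  by (simp add: tangent_vector_def LT_def o_def fun_eq_iff)

lemma components_eq: "components A c x = LT unit (chart_at A x) c (snd (chart_at A x) x)"
  by (simp add: components_def LT_def o_def fun_eq_iff)

text \<open>Both the tangent vector and the translation refer to the selected chart at the point; in
  the composite it cancels.\<close>

lemma left_translation_tangent_vector: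
  assumes "c \<in> charts A" "p \<in> chart_image c"
  shows "left_translation_differential G A (iv (chart_inv c p)) (chart_inv c p) (tangent_vector A c p y)
    = coframe c p y"
  using LT_LT[of c "chart_at A (chart_inv c p)" e0 "chart_inv c p" unit "iv (chart_inv c p)" y,
      OF assms(1) chart_at(1) chart_at(1)]
  by (simp add: left_translation_differential_eq tangent_vector_eq coframe_def assms is_chart
      chart_inv_in_domain chart_chart_inv chart_at)

lemma left_invariant_in_chart:
  assumes "c \<in> charts A" "p \<in> chart_image c" "\<And>x y. F x y = F unit (left_translation_differential G A (iv x) x y)"
  shows "in_chart A F c p y = F unit (coframe c p y)"
  using assms(3)[of "chart_inv c p" "tangent_vector A c p y"] left_translation_tangent_vector[OF assms(1,2)]
  by (simp add: in_chart_def)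

lemma field_in_chart_eq_frame:
  assumes "q \<in> chart_image e0"
  shows "field_in_chart A e0 (left_invariant_extension G A v) q = frame e0 q v"
  using LT_LT[of e0 "chart_at A (chart_inv e0 q)" e0 unit "chart_inv e0 q" unit v,
      OF chart_at(1) chart_at(1) chart_at(1)]
  by (simp add: field_in_chart_def left_invariant_extension_def left_translation_differential_eq
      components_eq frame_def assms chart_inv_in_domain chart_at is_chart)

text \<open>The mixed second-order term of the multiplication at the unit, in the chart
  \<open>e0\<close>. Its antisymmetric part is the bracket.\<close>

definition mul2 :: "real ^ 'n \<Rightarrow> real ^ 'n \<Rightarrow> real ^ 'n" where
  "mul2 w v = \<D> (\<lambda>z. \<D> (chart_mul e0 e0 e0) z (0, v)) (q0, q0) (w, 0)"

lemma q0_mul_domain: "(q0, q0) \<in> mul_domain e0 e0 e0"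
  by (simp add: mul_domain_def chart_at)

lemma mul2_swap:
  "mul2 w v = \<D> (\<lambda>z. \<D> (chart_mul e0 e0 e0) z (w, 0)) (q0, q0) (0, v)"
  unfolding mul2_def
  by (rule second_derivative_symmetric[OF open_mul_domain smooth_chart_mul q0_mul_domain])
    (rule chart_at)+

lemma linear_mul2_left: "linear (\<lambda>w. mul2 w v)"
proof -
  have "linear (\<D> (\<lambda>z. \<D> (chart_mul e0 e0 e0) z (0, v)) (q0, q0))"
    by (rule linear_frechet_derivative[OF smooth_on_differentiable[OF smooth_on_derivative[OF
            smooth_chart_mul[OF chart_at(1) chart_at(1) chart_at(1)]] q0_mul_domain]])
  moreover have "linear (\<lambda>w :: real ^ 'n. (w, 0 :: real ^ 'n))" by (simp add: linear_iff)
  ultimately have "linear (\<D> (\<lambda>z. \<D> (chart_mul e0 e0 e0) z (0, v)) (q0, q0) \<circ> (\<lambda>w. (w, 0)))" by (rule linear_compose[rotated])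
  then show ?thesis by (simp only: mul2_def o_def)
qed

lemma linear_mul2_right: "linear (mul2 w)"
proof -
  have "linear (\<D> (\<lambda>z. \<D> (chart_mul e0 e0 e0) z (w, 0)) (q0, q0))"
    by (rule linear_frechet_derivative[OF smooth_on_differentiable[OF smooth_on_derivative[OF
            smooth_chart_mul[OF chart_at(1) chart_at(1) chart_at(1)]] q0_mul_domain]])
  moreover have "linear (\<lambda>v :: real ^ 'n. (0 :: real ^ 'n, v))" by (simp add: linear_iff)
  ultimately have "linear (\<D> (\<lambda>z. \<D> (chart_mul e0 e0 e0) z (w, 0)) (q0, q0) \<circ> (\<lambda>v. (0, v)))" by (rule linear_compose[rotated])
  then show ?thesis by (simp only: mul2_swap[abs_def] o_def)
qed

lemma has_derivative_frame_unit: "((\<lambda>q. frame e0 q v) has_derivative (\<lambda>w. mul2 w v)) (at q0)"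
  using has_derivative_frame[OF chart_at(1) q0_in_image] by (simp add: mul2_def)

lemma frame_unit: "frame e0 q0 v = v"
  by (simp add: frame_def chart_at)

lemma bracket_eq: "bracket v w = mul2 v w - mul2 w v"
proof -
  have "\<D> (field_in_chart A e0 (left_invariant_extension G A v)) q0 = (\<lambda>w. mul2 w v)" for v
  proof -
    have "\<D> (field_in_chart A e0 (left_invariant_extension G A v)) q0
        = \<D> (\<lambda>q. frame e0 q v) q0"
      by (rule frechet_derivative_cong_open[OF open_chart_image[OF is_chart[OF chart_at(1)]] q0_in_image])
        (rule field_in_chart_eq_frame)
    then show ?thesis by (simp add: frechet_derivative_eqI[OF has_derivative_frame_unit])
  qed
  then show ?thesis
    by (simp add: lie_bracket_def field_bracket_def Let_def field_in_chart_eq_frame frame_unit)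
qed

lemma bilinear_bracket: "bilinear bracket"
proof -
  have "linear (\<lambda>w. mul2 v w - mul2 w v)" "linear (\<lambda>v. mul2 v w - mul2 w v)" for v w
    by (intro linear_compose_sub linear_mul2_left linear_mul2_right)+
  then show ?thesis unfolding bilinear_def bracket_eq by simp
qed

text \<open>Left translation by the point \<open>x\<close> with coordinates \<open>p\<close>, written \<open>\<tau>\<close> in coordinates, carries the frame at
  the unit to the frame at \<open>x\<close>. In the derivative of this identity the second derivative of \<open>\<tau>\<close> is
  symmetric and drops out of the commutator.\<close>

lemma frame_bracket:
  assumes c: "c \<in> charts A" and p: "p \<in> chart_image c"
  shows "\<D> (\<lambda>p. frame c p w) p (frame c p v)
       - \<D> (\<lambda>p. frame c p v) p (frame c p w) = frame c p (bracket v w)"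
proof -
  let ?x = "chart_inv c p" let ?b = "chart_at A ?x"
  define \<tau> where "\<tau> q = snd c (?x \<cdot> chart_inv e0 q)" for q
  let ?T = "{q \<in> chart_image e0. ?x \<cdot> chart_inv e0 q \<in> fst c}"
  have inc: "?x \<in> fst c" by (simp add: c p chart_inv_in_domain is_chart)
  have T_eq: "?T = (\<lambda>q. (snd ?b ?x, q)) -` mul_domain ?b e0 c"
    by (auto simp: mul_domain_def chart_in_image chart_inv_chart is_chart chart_at)
  have T: "open ?T" unfolding T_eq
    by (intro open_vimage open_mul_domain chart_at c continuous_intros)
  have q0T: "q0 \<in> ?T" by (simp add: inc)
  have sm: "smooth_on ?T \<tau>"
  proof -
    have "smooth_on ?T (\<lambda>q. chart_mul ?b e0 c (snd ?b ?x, q))"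
      by (rule smooth_on_compose[OF T open_mul_domain[OF chart_at(1) chart_at(1) c] smooth_on_Pair[OF T smooth_on_const smooth_on_ident]
            smooth_chart_mul[OF chart_at(1) chart_at(1) c]]) (auto simp: T_eq)
    then show ?thesis
      by (subst smooth_on_cong[OF T]) (auto simp: \<tau>_def chart_mul_def chart_inv_chart is_chart chart_at)
  qed
  have D\<tau>: "LT ?x e0 c q = \<D> \<tau> q" for q by (simp add: LT_def \<tau>_def[abs_def])
  have Dfr: "((\<lambda>p. frame c p v) has_derivative \<D> (\<lambda>p. frame c p v) p) (at p)" for v
    by (rule frechet_derivative_has) (use has_derivative_frame[OF c p] in \<open>auto simp: differentiable_def\<close>)
  have \<tau>q0: "\<tau> q0 = p" by (simp add: \<tau>_def chart_chart_inv is_chart c p)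
  have \<tau>d: "(\<tau> has_derivative frame c p) (at q0)"
    using frechet_derivative_has[OF smooth_on_differentiable[OF sm q0T]] D\<tau>[of q0]
    by (simp add: frame_def)
  have key: "\<D> (\<lambda>p. frame c p v) p (frame c p w)
      = \<D> (\<lambda>q. \<D> \<tau> q v) q0 w + frame c p (mul2 w v)" for v w
  proof -
    have "((\<lambda>q. \<D> \<tau> q (frame e0 q v)) has_derivative
       (\<lambda>w. \<D> (\<lambda>q. \<D> \<tau> q (frame e0 q0 v)) q0 w
          + \<D> \<tau> q0 (mul2 w v))) (at q0)"
      by (rule has_derivative_linear_family[OF T q0T _ _ has_derivative_frame_unit,
            where L'="\<lambda>w b. \<D> (\<lambda>q. \<D> \<tau> q b) q0 w"])
        (use linear_frechet_derivative smooth_on_differentiable[OF sm] frechet_derivative_has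
          smooth_on_differentiable[OF smooth_on_derivative[OF sm] q0T] in blast)+
    then have 1: "((\<lambda>q. \<D> \<tau> q (frame e0 q v)) has_derivative
       (\<lambda>w. \<D> (\<lambda>q. \<D> \<tau> q v) q0 w + frame c p (mul2 w v))) (at q0)"
      by (simp add: frame_unit frame_def[of c p] D\<tau>)
    have 2: "((\<lambda>q. frame c (\<tau> q) v) has_derivative
       (\<lambda>w. \<D> (\<lambda>p. frame c p v) p (frame c p w))) (at q0)"
      using diff_chain_at[OF \<tau>d, of "\<lambda>p. frame c p v"] Dfr by (simp add: o_def \<tau>q0)
    have "((\<lambda>q. \<D> \<tau> q (frame e0 q v)) has_derivative
       (\<lambda>w. \<D> (\<lambda>p. frame c p v) p (frame c p w))) (at q0)"
    proof (rule has_derivative_transform_within_open[OF 2 T q0T])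
      fix q assume q: "q \<in> ?T"
      then have "\<D> \<tau> q (frame e0 q v)
          = LT (?x \<cdot> chart_inv e0 q) e0 c q0 v"
        using LT_LT[of e0 e0 c unit "chart_inv e0 q" ?x v, OF chart_at(1) chart_at(1) c]
        by (simp add: frame_def D\<tau>[symmetric] chart_at chart_inv_in_domain is_chart chart_chart_inv)
      also have "\<dots> = frame c (\<tau> q) v"
        using q by (simp add: frame_def \<tau>_def chart_inv_chart is_chart c)
      finally show "frame c (\<tau> q) v = \<D> \<tau> q (frame e0 q v)" by simp
    qed
    from has_derivative_unique[OF this 1] show ?thesis by metis
  qed
  have "\<D> (\<lambda>q. \<D> \<tau> q v) q0 w
      = \<D> (\<lambda>q. \<D> \<tau> q w) q0 v"
    by (rule second_derivative_symmetric[OF T sm q0T])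
  then show ?thesis
    by (simp add: key bracket_eq linear_diff[OF linear_frame[OF c p]])
qed

text \<open>Differentiating \<open>coframe c p (frame c p v) = v\<close> expresses the derivative of
  the coframe by that of the frame, with a minus sign; the commutator of the frame fields then gives
  the structure equation.\<close>

lemma maurer_cartan:
  assumes c: "c \<in> charts A" and p: "p \<in> chart_image c"
  shows "\<D> (\<lambda>p. coframe c p z) p w - \<D> (\<lambda>p. coframe c p w) p z
       = - bracket (coframe c p w) (coframe c p z)"
proof -
  let ?D = "\<lambda>w z. \<D> (\<lambda>p. coframe c p z) p w"
  let ?Df = "\<lambda>w v. \<D> (\<lambda>p. frame c p v) p w"
  note op = open_chart_image[OF is_chart[OF c]]
  have key: "?D w (frame c p v) = - coframe c p (?Df w v)" for v w
  proof -
    have fr: "((\<lambda>p. frame c p v) has_derivative \<D> (\<lambda>p. frame c p v) p) (at p)"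
      by (rule frechet_derivative_has) (use has_derivative_frame[OF c p] in \<open>auto simp: differentiable_def\<close>)
    have "((\<lambda>p. coframe c p (frame c p v)) has_derivative (\<lambda>w. ?D w (frame c p v) + coframe c p (?Df w v))) (at p)"
      by (rule has_derivative_linear_family[OF op p _ _ fr])
        (simp_all add: linear_coframe c frechet_derivative_has coframe_differentiable p)
    then have "((\<lambda>p. v) has_derivative (\<lambda>w. ?D w (frame c p v) + coframe c p (?Df w v))) (at p)"
      by (rule has_derivative_transform_within_open[OF _ op p]) (simp add: coframe_frame c)
    from has_derivative_unique[OF this has_derivative_const]
    have "?D w (frame c p v) + coframe c p (?Df w v) = 0" by metis
    then show ?thesis by (simp add: eq_neg_iff_add_eq_0)
  qed
  have "?D w z - ?D z w = ?D w (frame c p (coframe c p z)) - ?D z (frame c p (coframe c p w))"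
    by (simp add: frame_coframe c p)
  also have "\<dots> = - coframe c p (?Df w (coframe c p z) - ?Df z (coframe c p w))"
    by (simp add: key linear_diff[OF linear_coframe[OF c p]])
  also have "?Df w (coframe c p z) - ?Df z (coframe c p w) = frame c p (bracket (coframe c p w) (coframe c p z))"
    using frame_bracket[OF c p, of "coframe c p z" "coframe c p w"] by (simp add: frame_coframe c p)
  finally show ?thesis by (simp add: coframe_frame c p)
qed

section \<open>The adjoint representation\<close>

text \<open>The differential at the unit of conjugation by \<open>a\<close>, factored into left
  translation to \<open>a\<close> and right translation back, so that the dependence on
  \<open>a\<close> can be differentiated factor by factor.\<close>

definition Ad :: "'g \<Rightarrow> real ^ 'n \<Rightarrow> real ^ 'n" where
  "Ad a v = RT (iv a) (chart_at A a) e0 (snd (chart_at A a) a) (LT a e0 (chart_at A a) q0 v)"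

lemma has_chart_deriv_conj:
  assumes \<tau>: "has_chart_deriv \<tau> t e0 K" and t: "\<tau> t = unit" and d: "d \<in> charts A" "a \<in> fst d"
  shows "has_chart_deriv (\<lambda>t. a \<cdot> \<tau> t \<cdot> iv a) t e0
    (\<lambda>v. RT (iv a) d e0 (snd d a) (LT a e0 d q0 (K v)))"
proof -
  have "has_chart_deriv (\<lambda>t. a \<cdot> \<tau> t) t d (\<lambda>v. LT a e0 d q0 (K v))"
    using has_chart_deriv_left[OF chart_at(1) d(1) \<tau>, of a] t d(2) by simp
  from has_chart_deriv_right[OF d(1) chart_at(1) this, of "iv a" unit] t
  show ?thesis by (simp add: chart_at)
qed

lemma has_chart_deriv_Ad:
  assumes "has_chart_deriv \<tau> t e0 K" "\<tau> t = unit"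
  shows "has_chart_deriv (\<lambda>t. a \<cdot> \<tau> t \<cdot> iv a) t e0 (\<lambda>v. Ad a (K v))"
  using has_chart_deriv_conj[OF assms chart_at] by (simp add: Ad_def)

lemma has_chart_deriv_e0_inv: "has_chart_deriv (chart_inv e0) q0 e0 (\<lambda>v. v)"
  by (rule has_chart_deriv_chart_inv) (simp_all add: is_chart chart_at)

text \<open>Frees \<open>Ad\<close> from the selected chart at \<open>a\<close>, which may jump with
  \<open>a\<close>; near the unit the fixed chart \<open>e0\<close> can take its place.\<close>

lemma Ad_eq:
  assumes "d \<in> charts A" "a \<in> fst d"
  shows "Ad a v = RT (iv a) d e0 (snd d a) (LT a e0 d q0 v)"
  using has_chart_deriv_unique[OF has_chart_deriv_Ad has_chart_deriv_conj[OF _ _ assms],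
      OF has_chart_deriv_e0_inv _ has_chart_deriv_e0_inv] chart_inv_q0 by metis

lemma linear_Ad: "linear (Ad a)"
  using has_chart_deriv_Ad[OF has_chart_deriv_e0_inv chart_inv_q0]
  unfolding has_chart_deriv_def by (auto dest: has_derivative_linear)

lemma Ad_mul: "Ad (a \<cdot> b) v = Ad a (Ad b v)"
proof -
  have "has_chart_deriv (\<lambda>q. a \<cdot> (b \<cdot> chart_inv e0 q \<cdot> iv b) \<cdot> iv a) q0 e0 (\<lambda>v. Ad a (Ad b v))"
    by (rule has_chart_deriv_Ad[OF has_chart_deriv_Ad[OF has_chart_deriv_e0_inv]]) simp_all
  moreover have "has_chart_deriv (\<lambda>q. a \<cdot> b \<cdot> chart_inv e0 q \<cdot> iv (a \<cdot> b)) q0 e0 (\<lambda>v. Ad (a \<cdot> b) v)"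
    by (rule has_chart_deriv_Ad[OF has_chart_deriv_e0_inv]) simp
  ultimately show ?thesis
    using has_chart_deriv_unique by (metis (no_types, lifting) mul_assoc iv_mul ext)
qed

lemma Ad_unit: "Ad unit v = v"
  by (simp add: Ad_def chart_at)

text \<open>The derivative of \<open>a x = (a x a\<inverse>) a\<close> in \<open>x\<close> expresses the frame at \<open>a\<close> by \<open>Ad a\<close>; differentiating
  once more in \<open>a\<close> gives the bracket.\<close>

lemma has_derivative_Ad_unit:
  "((\<lambda>q. Ad (chart_inv e0 q) v) has_derivative (\<lambda>w. bracket w v)) (at q0)"
proof -
  note op = open_chart_image[OF is_chart[OF chart_at(1)], of unit]
  note inv = has_chart_deriv_e0_inv
  have ive0: "iv (chart_inv e0 q0) \<in> fst e0" by (simp add: chart_at)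
  obtain K where K: "has_chart_deriv (\<lambda>p. iv (chart_inv e0 p)) q0 e0 K"
    using has_chart_deriv_iv[OF chart_at(1) chart_at(1) inv ive0] by blast
  obtain L' where L': "((\<lambda>q. RT (iv (chart_inv e0 q)) e0 e0 q b) has_derivative (\<lambda>w. L' w b)) (at q0)" for b
  proof
    fix b
    have "((\<lambda>q. RT (iv (chart_inv e0 q)) e0 e0 (snd e0 (chart_inv e0 q)) b) has_derivative
        (\<lambda>w. \<D> (\<lambda>z. \<D> (chart_mul e0 e0 e0) z (b, 0)) (q0, q0) (w, K w))) (at q0)"
      using RT_differentiable[of e0 e0 e0, OF chart_at(1) chart_at(1) chart_at(1) inv K, of b] by (simp add: chart_at)
    then show "((\<lambda>q. RT (iv (chart_inv e0 q)) e0 e0 q b) has_derivative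
        (\<lambda>w. (\<lambda>w b. \<D> (\<lambda>z. \<D> (chart_mul e0 e0 e0) z (b, 0)) (q0, q0) (w, K w)) w b)) (at q0)"
      by (rule has_derivative_transform_within_open[OF _ op q0_in_image])
        (simp add: chart_chart_inv is_chart chart_at)
  qed
  have "((\<lambda>q. RT (iv (chart_inv e0 q)) e0 e0 q (frame e0 q v)) has_derivative
     (\<lambda>w. L' w (frame e0 q0 v) + RT (iv (chart_inv e0 q0)) e0 e0 q0 (mul2 w v))) (at q0)"
    by (rule has_derivative_linear_family[OF op q0_in_image _ L' has_derivative_frame_unit])
      (rule linear_RT, simp_all add: chart_at)
  then have "((\<lambda>q. Ad (chart_inv e0 q) v) has_derivative
     (\<lambda>w. L' w (frame e0 q0 v) + RT (iv (chart_inv e0 q0)) e0 e0 q0 (mul2 w v))) (at q0)"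
    by (rule has_derivative_transform_within_open[OF _ op q0_in_image])
      (simp add: Ad_eq[of e0] chart_inv_in_domain chart_chart_inv is_chart chart_at frame_def)
  \<comment> \<open>Only differentiability is kept from this factorization, since \<open>L'\<close>
    involves the derivative of inversion. The value of \<open>D\<close> comes from the second
    identity.\<close>
  then obtain D where D: "((\<lambda>q. Ad (chart_inv e0 q) v) has_derivative D) (at q0)" by blast
  have R: "((\<lambda>q. RT (chart_inv e0 q) e0 e0 q0 (Ad (chart_inv e0 q) v)) has_derivative
     (\<lambda>w. mul2 (Ad (chart_inv e0 q0) v) w + RT (chart_inv e0 q0) e0 e0 q0 (D w))) (at q0)"
  proof (rule has_derivative_linear_family[OF op q0_in_image _ _ D])
    fix q assume "q \<in> chart_image e0"
    then show "linear (RT (chart_inv e0 q) e0 e0 q0)"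
      by (intro linear_RT) (simp_all add: chart_at chart_inv_in_domain is_chart)
  next
    fix b
    show "((\<lambda>q. RT (chart_inv e0 q) e0 e0 q0 b) has_derivative mul2 b) (at q0)"
      using RT_differentiable[of e0 e0 e0, OF chart_at(1) chart_at(1) chart_at(1) has_chart_deriv_const[OF chart_at(2)] inv, of b]
      by (simp add: chart_at mul2_swap[abs_def])
  qed
  have "((\<lambda>q. frame e0 q v) has_derivative (\<lambda>w. mul2 v w + D w)) (at q0)"
  proof -
    have "RT (chart_inv e0 q) e0 e0 q0 (Ad (chart_inv e0 q) v) = frame e0 q v" if q: "q \<in> chart_image e0" for q
    proof -
      let ?a = "chart_inv e0 q"
      have a: "?a \<in> fst e0" using q by (simp add: chart_inv_in_domain is_chart chart_at)
      have "has_chart_deriv (\<lambda>s. ?a \<cdot> chart_inv e0 s \<cdot> iv ?a) q0 e0 (Ad ?a)"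
        by (rule has_chart_deriv_Ad[OF inv]) simp
      from has_chart_deriv_right[OF chart_at(1) chart_at(1) this, of ?a unit]
      have "has_chart_deriv (\<lambda>s. ?a \<cdot> chart_inv e0 s) q0 e0 (\<lambda>v. RT ?a e0 e0 q0 (Ad ?a v))"
        by (simp add: mul_assoc a)
      moreover have "has_chart_deriv (\<lambda>s. ?a \<cdot> chart_inv e0 s) q0 e0 (LT ?a e0 e0 q0)"
        by (rule has_chart_deriv_LT[OF chart_at(1) _ _ _ _ chart_at(2)]) (simp_all add: chart_at a)
      ultimately show ?thesis unfolding frame_def using has_chart_deriv_unique by metis
    qed
    then have "((\<lambda>q. frame e0 q v) has_derivative
     (\<lambda>w. mul2 (Ad (chart_inv e0 q0) v) w + RT (chart_inv e0 q0) e0 e0 q0 (D w))) (at q0)"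
      by (rule has_derivative_transform_within_open[OF R op q0_in_image])
    then show ?thesis by (simp add: Ad_unit chart_at)
  qed
  \<comment> \<open>The two derivatives of the frame give \<open>mul2 v w + D w = mul2 w v\<close>,
    which is solved by the bracket.\<close>
  from has_derivative_unique[OF this has_derivative_frame_unit]
  have "D w = bracket w v" for w
    unfolding bracket_eq by (metis add_diff_cancel_left')
  then have "D = (\<lambda>w. bracket w v)" by blast
  with D show ?thesis by simp
qed

lemma has_derivative_Ad:
  assumes \<sigma>: "has_chart_deriv \<sigma> t e0 L" and t: "\<sigma> t = unit"
  shows "((\<lambda>s. Ad (\<sigma> s) v) has_derivative (\<lambda>w. bracket (L w) v)) (at t)"
proof -
  have cont: "isCont \<sigma> t" and d: "((\<lambda>s. snd e0 (\<sigma> s)) has_derivative L) (at t)"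
    using \<sigma> by (auto simp: has_chart_deriv_def)
  have 1: "((\<lambda>s. Ad (chart_inv e0 (snd e0 (\<sigma> s))) v) has_derivative (\<lambda>w. bracket (L w) v)) (at t)"
  proof -
    have "((\<lambda>q. Ad (chart_inv e0 q) v) has_derivative (\<lambda>w. bracket w v)) (at (snd e0 (\<sigma> t)))"
      using has_derivative_Ad_unit t by simp
    from diff_chain_at[OF d this] show ?thesis by (simp add: o_def)
  qed
  have "eventually (\<lambda>s. \<sigma> s \<in> fst e0) (nhds t)"
    by (rule isCont_eventually_in[OF cont]) (simp_all add: open_chart_domain is_chart chart_at t)
  then have "eventually (\<lambda>s. Ad (chart_inv e0 (snd e0 (\<sigma> s))) v = Ad (\<sigma> s) v) (nhds t)"
    by eventually_elim (simp add: chart_inv_chart is_chart chart_at)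
  with 1 show ?thesis by (rule has_derivative_eventually_eq)
qed

text \<open>The product rule for \<open>\<tau> t \<cdot> iv (\<tau> t) = unit\<close> yields
  \<open>- K\<close> for the inverse factor; the conjugated factor contributes
  \<open>Ad a\<close>.\<close>

lemma has_chart_deriv_commutator:
  assumes \<tau>: "has_chart_deriv \<tau> t e0 K" and t: "\<tau> t = unit"
  shows "has_chart_deriv (\<lambda>t. a \<cdot> \<tau> t \<cdot> iv a \<cdot> iv (\<tau> t)) t e0 (\<lambda>v. Ad a (K v) - K v)"
proof -
  have e: "iv (\<tau> t) \<in> fst e0" by (simp add: t chart_at)
  obtain L where L: "has_chart_deriv (\<lambda>t. iv (\<tau> t)) t e0 L"
    using has_chart_deriv_iv[OF chart_at(1) chart_at(1) \<tau> e] by blast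
  have "has_chart_deriv (\<lambda>t. \<tau> t \<cdot> iv (\<tau> t)) t e0 (\<lambda>v. K v + L v)"
    using has_chart_deriv_product[of e0 e0 e0, OF chart_at(1) chart_at(1) chart_at(1) \<tau> L] by (simp add: t chart_at)
  then have "has_chart_deriv (\<lambda>t. unit) t e0 (\<lambda>v. K v + L v)" by simp
  from has_chart_deriv_unique[OF this has_chart_deriv_const[OF chart_at(2)]]
  have "K v + L v = 0" for v by metis
  then have L_eq: "L v = - K v" for v by (metis eq_neg_iff_add_eq_0 add.commute)
  show ?thesis
    using has_chart_deriv_product[of e0 e0 e0, OF chart_at(1) chart_at(1) chart_at(1) has_chart_deriv_Ad[OF \<tau> t] L]
    by (simp add: t chart_at L_eq)
qed

end

text \<open>The family is closed under differentiation, so the induction closes at once. It serves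
  to build smooth curves on the whole real line.\<close>

lemma Ck_on_sin_cos:
  fixes a b :: "'a::real_normed_vector"
  shows "Ck_on k UNIV (\<lambda>t::real. sin t *\<^sub>R a + cos t *\<^sub>R b)"
proof (induction k arbitrary: a b)
  case 0
  show ?case by (auto intro!: continuous_intros)
next
  case (Suc k)
  have d: "((\<lambda>t::real. sin t *\<^sub>R a + cos t *\<^sub>R b) has_derivative
      (\<lambda>v. sin t *\<^sub>R (- v *\<^sub>R b) + cos t *\<^sub>R (v *\<^sub>R a))) (at t)" for t
    by (auto intro!: derivative_eq_intros simp: algebra_simps)
  have "Ck_on k UNIV (\<lambda>t. \<D> (\<lambda>t::real. sin t *\<^sub>R a + cos t *\<^sub>R b) t v)" for v
    unfolding frechet_derivative_eqI[OF d] by (rule Suc)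
  moreover have "(\<lambda>t::real. sin t *\<^sub>R a + cos t *\<^sub>R b) differentiable (at t)" for t
    by (rule differentiableI[OF d])
  ultimately show ?case by (simp only: Ck_on.simps) blast
qed

text \<open>A subspace is the orthogonal complement of its orthogonal complement, hence cut out by
  linear equations, and these pass to the derivative.\<close>

lemma has_derivative_in_subspace:
  fixes f :: "'a::real_normed_vector \<Rightarrow> 'b::euclidean_space"
  assumes f: "(f has_derivative f') (at x)" and S: "subspace S" and ev: "eventually (\<lambda>y. f y \<in> S) (nhds x)"
  shows "f' v \<in> S"
proof -
  have "f' v \<bullet> y = 0" if y: "y \<in> orthogonal_comp S" for y
  proof -
    have "((\<lambda>z. f z \<bullet> y) has_derivative (\<lambda>v. f' v \<bullet> y)) (at x)"
      by (rule bounded_linear.has_derivative[OF bounded_linear_inner_left f])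
    moreover have "eventually (\<lambda>z. f z \<bullet> y = 0) (nhds x)"
      using ev by eventually_elim (use y in \<open>auto simp: orthogonal_comp_def orthogonal_def\<close>)
    ultimately have "((\<lambda>z. 0) has_derivative (\<lambda>v. f' v \<bullet> y)) (at x)"
      by (rule has_derivative_eventually_eq)
    from has_derivative_unique[OF this has_derivative_const] show ?thesis by metis
  qed
  then have "f' v \<in> orthogonal_comp (orthogonal_comp S)"
    by (auto simp: orthogonal_comp_def orthogonal_def inner_commute)
  then show ?thesis by (simp add: orthogonal_comp_self S)
qed

context lie
begin

section \<open>The Lie algebra of the commutator group\<close>

lemma smooth_curve_open_vimage:
  assumes "smooth_curve A \<gamma>" "c \<in> charts A"
  shows "open (\<gamma> -` fst c)"
  using assms by (simp add: smooth_curve_def open_vimage open_chart_domain is_chart)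

lemma smooth_curve_chart:
  "smooth_curve A \<gamma> \<Longrightarrow> c \<in> charts A \<Longrightarrow> smooth_on (\<gamma> -` fst c) (\<lambda>t. snd c (\<gamma> t))"
  by (simp add: smooth_curve_def o_def)

lemma smooth_curve_isCont: "smooth_curve A \<gamma> \<Longrightarrow> isCont \<gamma> t"
  by (simp add: smooth_curve_def continuous_on_eq_continuous_at)

lemma smooth_curve_const: "smooth_curve A (\<lambda>t. a)"
  by (simp add: smooth_curve_def o_def smooth_on_const)

lemma smooth_curve_mul:
  assumes "smooth_curve A \<gamma>" "smooth_curve A \<delta>"
  shows "smooth_curve A (\<lambda>t. \<gamma> t \<cdot> \<delta> t)"
proof -
  have cont: "isCont (\<lambda>t. \<gamma> t \<cdot> \<delta> t) t" for t
    using assms by (intro isCont_mul smooth_curve_isCont)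
  then have cu: "continuous_on UNIV (\<lambda>t. \<gamma> t \<cdot> \<delta> t)" by (simp add: continuous_at_imp_continuous_on)
  moreover have "smooth_on ((\<lambda>t. \<gamma> t \<cdot> \<delta> t) -` fst e) (\<lambda>t. snd e (\<gamma> t \<cdot> \<delta> t))" if e: "e \<in> charts A" for e
  proof (rule smooth_on_local)
    fix t assume t: "t \<in> (\<lambda>t. \<gamma> t \<cdot> \<delta> t) -` fst e"
    let ?c = "chart_at A (\<gamma> t)" and ?d = "chart_at A (\<delta> t)"
    let ?T = "\<gamma> -` fst ?c \<inter> \<delta> -` fst ?d \<inter> (\<lambda>t. \<gamma> t \<cdot> \<delta> t) -` fst e"
    have T: "open ?T"
      using assms cu e by (intro open_Int smooth_curve_open_vimage open_vimage open_chart_domain is_chart chart_at)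
    have "smooth_on ?T (\<lambda>s. chart_mul ?c ?d e (snd ?c (\<gamma> s), snd ?d (\<delta> s)))"
    proof (rule smooth_on_compose[OF T open_mul_domain[OF chart_at(1) chart_at(1) e] _
          smooth_chart_mul[OF chart_at(1) chart_at(1) e]])
      show "smooth_on ?T (\<lambda>s. (snd ?c (\<gamma> s), snd ?d (\<delta> s)))"
        by (intro smooth_on_Pair[OF T] smooth_on_subset[OF smooth_curve_chart] assms chart_at) auto
      show "(\<lambda>s. (snd ?c (\<gamma> s), snd ?d (\<delta> s))) ` ?T \<subseteq> mul_domain ?c ?d e"
        using mul_domainI[OF chart_at(1) chart_at(1)] by blast
    qed
    then have "smooth_on ?T (\<lambda>t. snd e (\<gamma> t \<cdot> \<delta> t))"
      by (subst (asm) smooth_on_cong[OF T]) (auto simp: chart_mul_chart chart_at)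
    moreover have "t \<in> ?T" using t chart_at by auto
    ultimately show "\<exists>T. open T \<and> t \<in> T \<and> smooth_on T (\<lambda>t. snd e (\<gamma> t \<cdot> \<delta> t))" using T by blast
  qed
  ultimately show ?thesis by (simp add: smooth_curve_def o_def)
qed

lemma smooth_curve_iv:
  assumes "smooth_curve A \<gamma>"
  shows "smooth_curve A (\<lambda>t. iv (\<gamma> t))"
proof -
  have cont: "isCont (\<lambda>t. iv (\<gamma> t)) t" for t
    using assms by (intro isCont_iv smooth_curve_isCont)
  then have cu: "continuous_on UNIV (\<lambda>t. iv (\<gamma> t))" by (simp add: continuous_at_imp_continuous_on)
  moreover have "smooth_on ((\<lambda>t. iv (\<gamma> t)) -` fst e) (\<lambda>t. snd e (iv (\<gamma> t)))" if e: "e \<in> charts A" for e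
  proof (rule smooth_on_local)
    fix t assume t: "t \<in> (\<lambda>t. iv (\<gamma> t)) -` fst e"
    let ?c = "chart_at A (\<gamma> t)"
    let ?T = "\<gamma> -` fst ?c \<inter> (\<lambda>t. iv (\<gamma> t)) -` fst e"
    have T: "open ?T"
      using assms cu e by (intro open_Int smooth_curve_open_vimage open_vimage open_chart_domain is_chart chart_at)
    have "smooth_on ?T (\<lambda>s. snd e (iv (chart_inv ?c (snd ?c (\<gamma> s)))))"
    proof (rule smooth_on_compose[OF T open_iv_domain[OF chart_at(1) e] _ smooth_chart_iv[OF chart_at(1) e]])
      show "smooth_on ?T (\<lambda>s. snd ?c (\<gamma> s))"
        by (intro smooth_on_subset[OF smooth_curve_chart] assms chart_at) auto
      show "(\<lambda>s. snd ?c (\<gamma> s)) ` ?T \<subseteq> {p \<in> chart_image ?c. iv (chart_inv ?c p) \<in> fst e}"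
        using chart_in_image[OF is_chart[OF chart_at(1)]] chart_inv_chart[OF is_chart[OF chart_at(1)]] by auto
    qed
    then have "smooth_on ?T (\<lambda>t. snd e (iv (\<gamma> t)))"
      by (subst (asm) smooth_on_cong[OF T]) (auto simp: chart_inv_chart is_chart chart_at)
    moreover have "t \<in> ?T" using t chart_at by auto
    ultimately show "\<exists>T. open T \<and> t \<in> T \<and> smooth_on T (\<lambda>t. snd e (iv (\<gamma> t)))" using T by blast
  qed
  ultimately show ?thesis by (simp add: smooth_curve_def o_def)
qed

text \<open>Curves are defined for all real times, so to remain in one chart the segment in
  direction \<open>v\<close> is traversed with parameter \<open>sin t\<close>. The factor
  \<open>r\<close> fits it into a coordinate ball; it is divided out once a span is reached.\<close>

lemma ex_smooth_curve:
  obtains \<gamma> r where "smooth_curve A \<gamma>" "\<gamma> 0 = unit" "r > 0"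
    "has_chart_deriv \<gamma> 0 e0 (\<lambda>t. t *\<^sub>R r *\<^sub>R v)"
proof -
  note op = open_chart_image[OF is_chart[OF chart_at(1)], of unit]
  obtain \<epsilon> where \<epsilon>: "\<epsilon> > 0" "ball q0 \<epsilon> \<subseteq> chart_image e0"
    using op q0_in_image unfolding open_contains_ball by blast
  define r where "r = \<epsilon> / (norm v + 1)"
  have np: "norm v + 1 > 0" by (smt (verit) norm_ge_zero)
  have r: "r > 0" using \<epsilon> np by (simp add: r_def)
  have rv: "norm (r *\<^sub>R v) < \<epsilon>" using \<epsilon> np by (simp add: r_def field_simps)
  define \<eta> where "\<eta> t = q0 + sin t *\<^sub>R r *\<^sub>R v" for t
  have \<eta>_in: "\<eta> t \<in> chart_image e0" for t
  proof -
    have "norm (sin t *\<^sub>R r *\<^sub>R v) \<le> 1 * norm (r *\<^sub>R v)"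
      unfolding norm_scaleR[of "sin t"] by (intro mult_right_mono) auto
    then have "\<eta> t \<in> ball q0 \<epsilon>" using rv by (simp add: \<eta>_def dist_norm)
    then show ?thesis using \<epsilon> by blast
  qed
  have \<eta>_smooth: "smooth_on UNIV \<eta>"
  proof -
    have "smooth_on UNIV (\<lambda>t. sin t *\<^sub>R r *\<^sub>R v + cos t *\<^sub>R 0)"
      unfolding smooth_on_def by (intro allI Ck_on_sin_cos)
    from smooth_on_add[OF open_UNIV smooth_on_const[of UNIV q0] this] show ?thesis by (simp add: \<eta>_def[abs_def])
  qed
  have \<eta>_d: "(\<eta> has_derivative (\<lambda>t. t *\<^sub>R r *\<^sub>R v)) (at 0)"
    unfolding \<eta>_def by (auto intro!: derivative_eq_intros simp: algebra_simps)
  let ?\<gamma> = "\<lambda>t. chart_inv e0 (\<eta> t)"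
  have \<eta>_cont: "isCont \<eta> t" for t
    using smooth_on_continuous[OF \<eta>_smooth] by (simp add: continuous_on_eq_continuous_at)
  have cont: "isCont ?\<gamma> t" for t
    by (rule isCont_o2[OF \<eta>_cont isCont_chart_inv[OF is_chart[OF chart_at(1)] \<eta>_in]])
  then have cu: "continuous_on UNIV ?\<gamma>" by (simp add: continuous_at_imp_continuous_on)
  have "smooth_on (?\<gamma> -` fst d) (\<lambda>t. snd d (?\<gamma> t))" if d: "d \<in> charts A" for d
  proof -
    have T: "open (?\<gamma> -` fst d)" using cu d by (intro open_vimage open_chart_domain is_chart)
    \<comment> \<open>Left multiplication by the unit is the coordinate change from
      \<open>e0\<close> to \<open>d\<close>, so its smoothness is a case of that of the
      product.\<close>
    have "smooth_on (?\<gamma> -` fst d) (\<lambda>t. chart_mul e0 e0 d (q0, \<eta> t))"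
      by (rule smooth_on_compose[OF T open_mul_domain[OF chart_at(1) chart_at(1) d]
            smooth_on_Pair[OF T smooth_on_const smooth_on_subset[OF \<eta>_smooth]]
            smooth_chart_mul[OF chart_at(1) chart_at(1) d]])
        (auto simp: mul_domain_def \<eta>_in)
    then show ?thesis by (simp add: chart_mul_def)
  qed
  then have "smooth_curve A ?\<gamma>" using cu by (simp add: smooth_curve_def o_def)
  moreover have "?\<gamma> 0 = unit" by (simp add: \<eta>_def)
  moreover have "has_chart_deriv ?\<gamma> 0 e0 (\<lambda>t. t *\<^sub>R r *\<^sub>R v)"
    by (rule has_chart_deriv_compose[OF \<eta>_d
          has_chart_deriv_chart_inv[OF is_chart[OF chart_at(1)] \<eta>_in]])
  ultimately show thesis using that r by blast
qed

lemma velocity_eq: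
  assumes "has_chart_deriv \<gamma> 0 e0 (\<lambda>t. t *\<^sub>R v)" "\<gamma> 0 = unit"
  shows "velocity A \<gamma> 0 = v"
  using assms unfolding has_chart_deriv_def velocity_def
  by (simp add: o_def has_vector_derivative_def vector_derivative_at)

lemma Ad_minus_id_in_span: "Ad a v - v \<in> span (commutator_lie_algebra G A)"
proof -
  obtain \<gamma> r where \<gamma>: "smooth_curve A \<gamma>" "\<gamma> 0 = unit" "r > 0"
    "has_chart_deriv \<gamma> 0 e0 (\<lambda>t. t *\<^sub>R r *\<^sub>R v)"
    by (rule ex_smooth_curve)
  let ?\<delta> = "\<lambda>t. a \<cdot> \<gamma> t \<cdot> iv a \<cdot> iv (\<gamma> t)"
  have "smooth_curve A ?\<delta>"
    by (intro smooth_curve_mul smooth_curve_iv smooth_curve_const \<gamma>)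
  moreover have "?\<delta> 0 = unit" by (simp add: \<gamma>)
  moreover have "range ?\<delta> \<subseteq> derived G (carrier G)"
    unfolding derived_def by (auto simp: carrier_G intro!: generate.incl)
  ultimately have "velocity A ?\<delta> 0 \<in> commutator_lie_algebra G A"
    unfolding commutator_lie_algebra_def lie_algebra_of_subgroup_def by blast
  moreover have "velocity A ?\<delta> 0 = r *\<^sub>R (Ad a v - v)"
    by (rule velocity_eq)
      (use has_chart_deriv_commutator[OF \<gamma>(4,2), of a] \<gamma>(2)
       in \<open>simp_all add: linear_scale[OF linear_Ad] scaleR_diff_right\<close>)
  ultimately have "r *\<^sub>R (Ad a v - v) \<in> span (commutator_lie_algebra G A)" by (simp add: span_base)
  from span_scale[OF this, of "1 / r"] show ?thesis using \<gamma>(3) by simp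
qed

text \<open>For every \<open>a\<close> the vector \<open>Ad a v - v\<close> lies in one fixed
  subspace; hence so does its derivative in \<open>a\<close> at the unit.\<close>

lemma bracket_in_span: "bracket w v \<in> span (commutator_lie_algebra G A)"
proof -
  have "((\<lambda>q. Ad (chart_inv e0 q) v - v) has_derivative (\<lambda>w. bracket w v)) (at q0)"
    using has_derivative_diff[OF has_derivative_Ad_unit has_derivative_const] by simp
  then show ?thesis
    by (rule has_derivative_in_subspace) (simp_all add: Ad_minus_id_in_span subspace_span)
qed

text \<open>\<open>H\<close> is a union of left translates of \<open>W\<close>, and so is its
  complement: both are open, and connectedness leaves no room for the complement.\<close>

lemma subgroup_eq_UNIV:
  assumes conn: "connected (UNIV :: 'g set)"
    and mulH: "\<And>a b. a \<in> H \<Longrightarrow> b \<in> H \<Longrightarrow> a \<cdot> b \<in> H" and ivH: "\<And>a. a \<in> H \<Longrightarrow> iv a \<in> H"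
    and W: "open W" "unit \<in> W" "W \<subseteq> H"
  shows "H = UNIV"
proof -
  have left: "open {z. iv x \<cdot> z \<in> W}" for x
  proof -
    have "continuous_on UNIV (\<lambda>z. iv x \<cdot> z)"
      by (intro continuous_at_imp_continuous_on ballI isCont_mul) auto
    from open_vimage[OF W(1) this] show ?thesis by (simp add: vimage_def)
  qed
  have "open H"
  proof (subst open_subopen, intro ballI exI conjI)
    fix x assume x: "x \<in> H"
    show "{z. iv x \<cdot> z \<in> W} \<subseteq> H"
    proof
      fix z assume "z \<in> {z. iv x \<cdot> z \<in> W}"
      then have "x \<cdot> (iv x \<cdot> z) \<in> H" using x W mulH by blast
      then show "z \<in> H" by simp
    qed
  qed (use left W in auto)
  moreover have "open (- H)"
  proof (subst open_subopen, intro ballI exI conjI)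
    fix x assume x: "x \<in> - H"
    show "{z. iv x \<cdot> z \<in> W} \<subseteq> - H"
    proof
      fix z assume "z \<in> {z. iv x \<cdot> z \<in> W}"
      then have w: "iv x \<cdot> z \<in> H" using W by blast
      have "z \<notin> H"
      proof
        assume "z \<in> H"
        from mulH[OF this ivH[OF w]] have "x \<in> H" by (simp add: iv_mul)
        with x show False by simp
      qed
      then show "z \<in> - H" by simp
    qed
  qed (use left W in auto)
  ultimately have "H = {} \<or> H = UNIV"
    using conn by (simp add: connected_clopen closed_def)
  then show ?thesis using W by blast
qed

text \<open>A zero derivative gives constancy on a coordinate ball; its preimage is a neighbourhood
  of the unit as \<open>subgroup_eq_UNIV\<close> asks for.\<close>

lemma locally_constant_at_unit:
  fixes f :: "real ^ 'n \<Rightarrow> 'b::real_normed_vector"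
  assumes T: "open T" "q0 \<in> T" "T \<subseteq> chart_image e0"
    and d: "\<And>q. q \<in> T \<Longrightarrow> (f has_derivative (\<lambda>w. 0)) (at q)"
  obtains W where "open W" "unit \<in> W" "W \<subseteq> fst e0" "\<And>x. x \<in> W \<Longrightarrow> snd e0 x \<in> T \<and> f (snd e0 x) = f q0"
proof -
  obtain \<epsilon> where \<epsilon>: "\<epsilon> > 0" "ball q0 \<epsilon> \<subseteq> T" using T unfolding open_contains_ball by blast
  have const: "f q = f q0" if "q \<in> ball q0 \<epsilon>" for q
    by (rule has_derivative_zero_unique_connected[of "ball q0 \<epsilon>"])
      (use \<epsilon> d that in auto)
  have "continuous_on (fst e0) (snd e0)"
    by (intro continuous_at_imp_continuous_on ballI isCont_chart is_chart chart_at)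
  then have "open (fst e0 \<inter> snd e0 -` ball q0 \<epsilon>)"
    using open_chart_domain[OF is_chart[OF chart_at(1)]] by (rule continuous_open_preimage) simp
  then show thesis
  proof (rule that)
    fix x assume x: "x \<in> fst e0 \<inter> snd e0 -` ball q0 \<epsilon>"
    then have "snd e0 x \<in> ball q0 \<epsilon>" by simp
    with const[OF this] \<epsilon> show "snd e0 x \<in> T \<and> f (snd e0 x) = f q0" by blast
  qed (use \<epsilon> chart_at(2)[of unit] in simp_all)
qed

text \<open>By \<open>Ad s = Ad a (Ad (iv a \<cdot> s))\<close> the derivative at \<open>a\<close>
  comes from the one at the unit, which is a bracket. So \<open>Ad\<close> is constant near the
  unit, and the elements that act trivially form a subgroup.\<close>

lemma Ad_trivial:
  assumes conn: "connected (UNIV :: 'g set)" and zero: "\<And>v w. bracket v w = 0"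
  shows "Ad a v = v"
proof -
  have op: "open (chart_image e0)" by (intro open_chart_image is_chart chart_at)
  have D: "((\<lambda>s. Ad (chart_inv e0 s) v) has_derivative (\<lambda>w. 0)) (at q)" if q: "q \<in> chart_image e0" for q v
  proof -
    let ?a = "chart_inv e0 q"
    have "has_chart_deriv (\<lambda>s. iv ?a \<cdot> chart_inv e0 s) q e0 (LT (iv ?a) e0 e0 q)"
      by (rule has_chart_deriv_LT[OF chart_at(1) _ _ q _ chart_at(2)]) (simp_all add: chart_at)
    from has_derivative_Ad[OF this] have "((\<lambda>s. Ad (iv ?a \<cdot> chart_inv e0 s) v) has_derivative (\<lambda>w. 0)) (at q)"
      by (simp add: zero)
    from bounded_linear.has_derivative[OF linear_conv_bounded_linear[THEN iffD1, OF linear_Ad] this, of ?a]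
    show ?thesis by (simp add: Ad_mul[symmetric] linear_0[OF linear_Ad])
  qed
  have "{a. \<forall>v. Ad a v = v} = UNIV"
  proof -
    \<comment> \<open>Local constancy is available for one vector at a time; a common neighbourhood
      exists because a basis is finite.\<close>
    have ev: "\<exists>W. open W \<and> unit \<in> W \<and> (\<forall>x\<in>W. \<forall>b\<in>Basis. Ad x b = b)"
    proof -
      have "\<exists>W. open W \<and> unit \<in> W \<and> (\<forall>x\<in>W. Ad x b = b)" for b
      proof -
        obtain W where W: "open W" "unit \<in> W" "W \<subseteq> fst e0"
          "\<And>x. x \<in> W \<Longrightarrow> snd e0 x \<in> chart_image e0 \<and> Ad (chart_inv e0 (snd e0 x)) b = Ad (chart_inv e0 q0) b"
          by (rule locally_constant_at_unit[OF op q0_in_image order_refl, of "\<lambda>q. Ad (chart_inv e0 q) b"])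
            (rule D, blast+)
        have "Ad x b = b" if "x \<in> W" for x
          using W(4)[OF that] chart_inv_chart[OF is_chart[OF chart_at(1)] subsetD[OF W(3) that]]
          by (simp add: Ad_unit)
        with W show ?thesis by blast
      qed
      then obtain W where W: "\<And>b. open (W b) \<and> unit \<in> W b \<and> (\<forall>x\<in>W b. Ad x b = b)" by metis
      show ?thesis
        by (intro exI[of _ "\<Inter>b\<in>Basis. W b"]) (use W in \<open>auto intro!: open_INT\<close>)
    qed
    then obtain W where W: "open W" "unit \<in> W" "\<And>x b. x \<in> W \<Longrightarrow> b \<in> Basis \<Longrightarrow> Ad x b = b" by blast
    have "Ad x v = v" if "x \<in> W" for x v
    proof -
      have "Ad x v = (\<Sum>b\<in>Basis. (v \<bullet> b) *\<^sub>R Ad x b)" by (rule linear_euclidean_expansion[OF linear_Ad])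
      also have "\<dots> = (\<Sum>b\<in>Basis. (v \<bullet> b) *\<^sub>R b)" using W(3)[OF that] by simp
      finally show ?thesis by (simp add: euclidean_representation)
    qed
    then have sub: "W \<subseteq> {a. \<forall>v. Ad a v = v}" by blast
    show ?thesis
    proof (rule subgroup_eq_UNIV[OF conn _ _ W(1,2) sub])
      fix a b assume "a \<in> {a. \<forall>v. Ad a v = v}" "b \<in> {a. \<forall>v. Ad a v = v}"
      then show "a \<cdot> b \<in> {a. \<forall>v. Ad a v = v}" by (simp add: Ad_mul)
    next
      fix a assume a: "a \<in> {a. \<forall>v. Ad a v = v}"
      have "Ad (iv a) v = v" for v
      proof -
        have "Ad (iv a) v = Ad (iv a) (Ad a v)" using a by simp
        also have "\<dots> = v" by (simp add: Ad_mul[symmetric] Ad_unit)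
        finally show ?thesis .
      qed
      then show "iv a \<in> {a. \<forall>v. Ad a v = v}" by simp
    qed
  qed
  then show ?thesis by blast
qed

text \<open>The map \<open>f x = a x a\<inverse> x\<inverse>\<close> satisfies \<open>f (x z) = (a x a\<inverse>) (f z) x\<inverse>\<close>, so its derivative vanishes
  everywhere once it vanishes at the unit, where it is \<open>Ad a - 1\<close>.\<close>

lemma commutative:
  assumes conn: "connected (UNIV :: 'g set)" and zero: "\<And>v w. bracket v w = 0"
  shows "a \<cdot> b = b \<cdot> a"
proof -
  let ?f = "\<lambda>x. a \<cdot> x \<cdot> iv a \<cdot> iv x"
  \<comment> \<open>The value of \<open>?f\<close> must stay in the domain of \<open>e0\<close> too:
    only there do equal coordinates mean equal group elements.\<close>
  let ?T = "{q \<in> chart_image e0. ?f (chart_inv e0 q) \<in> fst e0}"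
  have chi: "is_chart e0" by (intro is_chart chart_at)
  have cont: "continuous_on (chart_image e0) (\<lambda>q. ?f (chart_inv e0 q))"
    by (intro continuous_at_imp_continuous_on ballI isCont_mul isCont_iv isCont_chart_inv chi) auto
  have "open (chart_image e0 \<inter> (\<lambda>q. ?f (chart_inv e0 q)) -` fst e0)"
    by (rule continuous_open_preimage[OF cont open_chart_image[OF chi] open_chart_domain[OF chi]])
  also have "chart_image e0 \<inter> (\<lambda>q. ?f (chart_inv e0 q)) -` fst e0 = ?T" by auto
  finally have T: "open ?T" .
  have q0T: "q0 \<in> ?T" by (simp add: chart_at)
  have D: "((\<lambda>s. snd e0 (?f (chart_inv e0 s))) has_derivative (\<lambda>w. 0)) (at q)" if q: "q \<in> ?T" for q
  proof -
    let ?x = "chart_inv e0 q" let ?y = "a \<cdot> ?x \<cdot> iv a" let ?d = "chart_at A ?y"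
    have qi: "q \<in> chart_image e0" using q by simp
    have "has_chart_deriv (\<lambda>s. iv ?x \<cdot> chart_inv e0 s) q e0 (LT (iv ?x) e0 e0 q)"
      by (rule has_chart_deriv_LT[OF chart_at(1) _ _ qi _ chart_at(2)]) (simp_all add: chart_at)
    from has_chart_deriv_commutator[OF this, of a]
    have c: "has_chart_deriv (\<lambda>s. ?f (iv ?x \<cdot> chart_inv e0 s)) q e0 (\<lambda>v. 0)"
      by (simp add: Ad_trivial[OF conn zero])
    have "has_chart_deriv (\<lambda>s. ?y \<cdot> ?f (iv ?x \<cdot> chart_inv e0 s)) q ?d
      (\<lambda>v. LT ?y e0 ?d (snd e0 (?f (iv ?x \<cdot> ?x))) 0)"
      by (rule has_chart_deriv_left[OF chart_at(1) chart_at(1) c]) (simp add: chart_at)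
    from has_chart_deriv_right[OF chart_at(1) chart_at(1) this, of "iv ?x" unit]
    \<comment> \<open>The inner derivative is zero, so the composite derivative is a constant linear
      map, which is zero.\<close>
    obtain L where L: "has_chart_deriv (\<lambda>s. ?y \<cdot> ?f (iv ?x \<cdot> chart_inv e0 s) \<cdot> iv ?x) q e0 L"
      "\<And>v. L v = L 0"
      using q by (force simp: mul_assoc)
    moreover have "?y \<cdot> ?f (iv ?x \<cdot> chart_inv e0 s) \<cdot> iv ?x = ?f (chart_inv e0 s)" for s
      by (simp add: mul_assoc iv_mul)
    moreover have "L v = 0" for v
    proof -
      have "linear L" using L(1) unfolding has_chart_deriv_def by (auto dest: has_derivative_linear)
      then show ?thesis using L(2)[of v] linear_0 by simp
    qed
    then have "L = (\<lambda>v. 0)" by blast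
    ultimately show ?thesis by (simp add: has_chart_deriv_def)
  qed
  obtain W where W: "open W" "unit \<in> W" "W \<subseteq> fst e0"
    "\<And>x. x \<in> W \<Longrightarrow> snd e0 x \<in> ?T \<and> snd e0 (?f (chart_inv e0 (snd e0 x))) = snd e0 (?f (chart_inv e0 q0))"
    by (rule locally_constant_at_unit[OF T q0T, of "\<lambda>q. snd e0 (?f (chart_inv e0 q))"])
      (blast, rule D, blast+)
  have "a \<cdot> x = x \<cdot> a" if "x \<in> W" for x
  proof -
    have x: "chart_inv e0 (snd e0 x) = x" using that W(3) chart_inv_chart[OF chi] by blast
    have "?f x \<in> fst e0" "snd e0 (?f x) = snd e0 unit" using W(4)[OF that] by (simp_all add: x)
    then have "?f x = unit" using chart_inv_chart[OF chi] chart_at(2)[of unit] by metis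
    then have "?f x \<cdot> x \<cdot> a = unit \<cdot> x \<cdot> a" by simp
    then show ?thesis by (simp add: mul_assoc)
  qed
  then have "W \<subseteq> {x. a \<cdot> x = x \<cdot> a}" by blast
  then have "{x. a \<cdot> x = x \<cdot> a} = UNIV"
  proof (intro subgroup_eq_UNIV[OF conn _ _ W(1,2)])
    fix x y assume "x \<in> {x. a \<cdot> x = x \<cdot> a}" "y \<in> {x. a \<cdot> x = x \<cdot> a}"
    then show "x \<cdot> y \<in> {x. a \<cdot> x = x \<cdot> a}" by (simp add: mul_assoc) (metis mul_assoc)
  next
    fix x assume "x \<in> {x. a \<cdot> x = x \<cdot> a}"
    then have "iv x \<cdot> (a \<cdot> x) \<cdot> iv x = iv x \<cdot> (x \<cdot> a) \<cdot> iv x" by simp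
    then show "iv x \<in> {x. a \<cdot> x = x \<cdot> a}" by (simp add: mul_assoc)
  qed
  then show ?thesis by blast
qed

text \<open>If all brackets vanished, the group would be abelian, its commutator group trivial and
  every curve in it constant, against dimension one.\<close>

lemma bracket_nonzero:
  assumes conn: "connected (UNIV :: 'g set)" and dim: "dim (commutator_lie_algebra G A) = 1"
  obtains v w where "bracket v w \<noteq> 0"
proof -
  have False if zero: "\<And>v w. bracket v w = 0"
  proof -
    have "derived_set G (carrier G) \<subseteq> {unit}"
    proof -
      have "x \<cdot> y \<cdot> iv x \<cdot> iv y = unit" for x y
        using commutative[OF conn zero, of x y] by (simp add: mul_assoc)
      then show ?thesis by auto
    qed
    moreover have "x = unit" if "x \<in> generate G K" "K \<subseteq> {unit}" for x K
      using that by (induction rule: generate.induct) auto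
    ultimately have der: "derived G (carrier G) \<subseteq> {unit}" unfolding derived_def by blast
    have "v = 0" if v: "v \<in> commutator_lie_algebra G A" for v
    proof -
      from v obtain \<gamma> where "v = velocity A \<gamma> 0" "range \<gamma> \<subseteq> {unit}"
        using der unfolding commutator_lie_algebra_def lie_algebra_of_subgroup_def by blast
      moreover from this have "\<gamma> = (\<lambda>t. unit)" by auto
      ultimately show ?thesis by (simp add: velocity_def o_def)
    qed
    then have "dim (commutator_lie_algebra G A) = 0" by (auto simp: dim_eq_0)
    with dim show False by simp
  qed
  then show thesis using that by blast
qed

end

section \<open>Squared Minkowski norms\<close>

lemma partial_deriv_eq:
  assumes "(f has_derivative f') (at x)"
  shows "partial_deriv f i x = f' (axis i 1)"
proof -
  have "((\<lambda>t. x + t *\<^sub>R axis i 1) has_derivative (\<lambda>t. t *\<^sub>R axis i 1)) (at (0::real))"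
    by (auto intro!: derivative_eq_intros)
  then have "((\<lambda>t. f (x + t *\<^sub>R axis i 1)) has_derivative (\<lambda>t. f' (t *\<^sub>R axis i 1))) (at 0)"
    using diff_chain_at[of "\<lambda>t. x + t *\<^sub>R axis i 1" "\<lambda>t. t *\<^sub>R axis i 1" 0 f f'] assms by (simp add: o_def)
  moreover have "(\<lambda>t. f' (t *\<^sub>R axis i 1)) = (*) (f' (axis i 1))"
    using has_derivative_linear[OF assms] by (simp add: linear_scale fun_eq_iff)
  ultimately show ?thesis
    unfolding partial_deriv_def by (simp add: has_field_derivative_def DERIV_imp_deriv)
qed

lemma linear_axis_expansion:
  fixes L :: "real ^ 'n \<Rightarrow> 'b::real_vector"
  assumes "linear L"
  shows "(\<Sum>i\<in>UNIV. y $ i *\<^sub>R L (axis i 1)) = L y"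
proof -
  have "L (\<Sum>i\<in>UNIV. y $ i *\<^sub>R axis i 1) = (\<Sum>i\<in>UNIV. y $ i *\<^sub>R L (axis i 1))"
    by (simp add: linear_sum[OF assms] linear_scale[OF assms])
  then show ?thesis using basis_expansion[of y] by (simp add: scalar_mult_eq_scaleR)
qed

lemma linear_axis_expansion_real:
  fixes L :: "real ^ 'n \<Rightarrow> real"
  assumes "linear L"
  shows "(\<Sum>i\<in>UNIV. L (axis i 1) * y $ i) = L y"
  using linear_axis_expansion[OF assms, of y] by (simp add: mult.commute)

text \<open>Serves for the Hessian of a squared norm as well as for \<open>g\<close>: positivity
  makes \<open>s \<mapsto> b _ s\<close> injective, hence onto in finite dimension.\<close>

lemma riesz_representation:
  fixes b :: "real ^ 'n \<Rightarrow> real ^ 'n \<Rightarrow> real"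
  assumes b: "bilinear b" and pos: "\<And>v. v \<noteq> 0 \<Longrightarrow> b v v > 0" and f: "linear f"
  obtains s where "\<And>v. b v s = f v"
proof -
  let ?T = "\<lambda>s. \<chi> i. b (axis i 1) s"
  have lin: "linear (\<lambda>v. b v s)" "linear (b v)" for v s
    using b by (auto simp: bilinear_def)
  have T: "linear ?T"
    by (rule linearI) (simp_all add: vec_eq_iff linear_add[OF lin(2)] linear_scale[OF lin(2)])
  have "s = 0" if "?T s = 0" for s
  proof (rule ccontr)
    assume "s \<noteq> 0"
    have "b (axis i 1) s = 0" for i using that by (simp add: vec_eq_iff)
    then have "b s s = 0" using linear_axis_expansion_real[OF lin(1), of s s] by simp
    with pos[OF \<open>s \<noteq> 0\<close>] show False by simp
  qed
  then have "inj ?T" using linear_injective_0[OF T] by blast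
  then have "surj ?T" by (rule linear_injective_imp_surjective[OF T]) simp
  from surjD[OF this, of "\<chi> i. f (axis i 1)"]
  obtain s where "(\<chi> i. f (axis i 1)) = ?T s" by blast
  then have "b (axis i 1) s = f (axis i 1)" for i by (simp add: vec_eq_iff)
  then have "b v s = f v" for v
    using linear_axis_expansion_real[OF lin(1), of s v] linear_axis_expansion_real[OF f, of v] by simp
  then show thesis using that by blast
qed

locale minkowski =
  fixes M :: "real ^ 'n::finite \<Rightarrow> real"
  assumes smooth: "smooth_on (- {0}) M"
    and homogeneous: "l > 0 \<Longrightarrow> M (l *\<^sub>R y) = l\<^sup>2 * M y"
    and positive_definite: "y \<noteq> 0 \<Longrightarrow> v \<noteq> 0 \<Longrightarrow>
      \<D> (\<lambda>z. \<D> M z v) y v > 0"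
begin

definition M1 :: "real ^ 'n \<Rightarrow> real ^ 'n \<Rightarrow> real" where
  "M1 y a = \<D> M y a"

definition M2 :: "real ^ 'n \<Rightarrow> real ^ 'n \<Rightarrow> real ^ 'n \<Rightarrow> real" where
  "M2 y a b = \<D> (\<lambda>z. M1 z a) y b"

definition M3 :: "real ^ 'n \<Rightarrow> real ^ 'n \<Rightarrow> real ^ 'n \<Rightarrow> real ^ 'n \<Rightarrow> real" where
  "M3 y a b c = \<D> (\<lambda>z. M2 z a b) y c"

lemma open_nonzero: "open (- {0 :: real ^ 'n})"
  by (rule open_Compl[OF closed_singleton])

lemma smooth_M1: "smooth_on (- {0}) (\<lambda>z. M1 z a)"
  unfolding M1_def by (rule smooth_on_derivative[OF smooth])

lemma smooth_M2: "smooth_on (- {0}) (\<lambda>z. M2 z a b)"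
  unfolding M2_def by (rule smooth_on_derivative[OF smooth_M1])

context
  fixes y :: "real ^ 'n"
  assumes y: "y \<noteq> 0"
begin

lemma has_derivative_M: "(M has_derivative M1 y) (at y)"
  using frechet_derivative_has[OF smooth_on_differentiable[OF smooth]] y by (simp add: M1_def[abs_def])

lemma has_derivative_M1: "((\<lambda>z. M1 z a) has_derivative M2 y a) (at y)"
  using frechet_derivative_has[OF smooth_on_differentiable[OF smooth_M1]] y by (simp add: M2_def[abs_def])

lemma has_derivative_M2: "((\<lambda>z. M2 z a b) has_derivative M3 y a b) (at y)"
  using frechet_derivative_has[OF smooth_on_differentiable[OF smooth_M2]] y by (simp add: M3_def[abs_def])

lemma linear_M1: "linear (M1 y)"
  using has_derivative_M by (rule has_derivative_linear)

lemma M2_sym: "M2 y a b = M2 y b a"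
  using second_derivative_symmetric[OF open_nonzero smooth, of y a b] y by (simp add: M2_def M1_def)

lemma linear_M2: "linear (M2 y a)"
  using has_derivative_M1 by (rule has_derivative_linear)

lemma linear_M2': "linear (\<lambda>a. M2 y a b)"
  using linear_M2 by (simp add: M2_sym[of _ b])

lemma bilinear_M2: "bilinear (M2 y)"
  by (simp add: bilinear_def linear_M2 linear_M2')

lemma linear_M3: "linear (M3 y a b)"
  using has_derivative_M2 by (rule has_derivative_linear)

lemma M3_sym: "M3 y a b c = M3 y a c b"
  using second_derivative_symmetric[OF open_nonzero smooth_M1[of a], of y b c] y by (simp add: M3_def M2_def)

lemma M2_pos: "v \<noteq> 0 \<Longrightarrow> M2 y v v > 0"
  using positive_definite[OF y] by (simp add: M2_def M1_def)

lemma M2_cancel: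
  assumes "\<And>z. M2 y z s = M2 y z s'"
  shows "s = s'"
proof (rule ccontr)
  assume "s \<noteq> s'"
  then have "M2 y (s - s') (s - s') > 0" by (simp add: M2_pos)
  moreover have "M2 y (s - s') (s - s') = 0" by (simp add: linear_diff[OF linear_M2] assms)
  ultimately show False by simp
qed

end

lemma M3_sym': "y \<noteq> 0 \<Longrightarrow> M3 y a b c = M3 y b a c"
proof -
  assume y: "y \<noteq> 0"
  have "((\<lambda>z. M2 z b a) has_derivative M3 y a b) (at y)"
    by (rule has_derivative_transform_within_open[OF has_derivative_M2[OF y] open_nonzero])
      (simp_all add: y M2_sym)
  from has_derivative_unique[OF this has_derivative_M2[OF y]] show ?thesis by simp
qed

text \<open>Euler's identity, by differentiating in \<open>l\<close> at 1. It is used in the degrees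
  2, 1 and 0, for \<open>M\<close>, \<open>M1\<close> and \<open>M2\<close>; degree 0 makes
  \<open>M3\<close> vanish in the direction \<open>y\<close>.\<close>

lemma euler_homogeneous:
  fixes f :: "real ^ 'n \<Rightarrow> real"
  assumes d: "(f has_derivative f') (at y)" and hom: "\<And>l. l > 0 \<Longrightarrow> f (l *\<^sub>R y) = l ^ k * f y"
  shows "f' y = k * f y"
proof -
  have "((\<lambda>l. f (l *\<^sub>R y)) has_derivative (\<lambda>t. f' (t *\<^sub>R y))) (at 1)"
  proof -
    have "((\<lambda>l. l *\<^sub>R y) has_derivative (\<lambda>t. t *\<^sub>R y)) (at (1::real))"
      by (auto intro!: derivative_eq_intros)
    from diff_chain_at[OF this, of f f'] d show ?thesis by (simp add: o_def)
  qed
  moreover have "((\<lambda>l. f (l *\<^sub>R y)) has_derivative (\<lambda>t::real. k * t * f y)) (at 1)"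
  proof (rule has_derivative_transform_within_open[of "\<lambda>l. l ^ k * f y" _ _ _ "{0<..}"])
    show "((\<lambda>l. l ^ k * f y) has_derivative (\<lambda>t. k * t * f y)) (at (1::real))"
      by (auto intro!: derivative_eq_intros simp: algebra_simps)
  qed (auto simp: hom)
  ultimately have "(\<lambda>t. f' (t *\<^sub>R y)) = (\<lambda>t::real. k * t * f y)" by (rule has_derivative_unique)
  from fun_cong[OF this, of 1] show ?thesis by simp
qed

lemma M1_homogeneous: "y \<noteq> 0 \<Longrightarrow> l > 0 \<Longrightarrow> M1 (l *\<^sub>R y) a = l * M1 y a"
proof -
  assume y: "y \<noteq> 0" and l: "l > 0"
  have "((\<lambda>z. l *\<^sub>R z) has_derivative (\<lambda>a. l *\<^sub>R a)) (at y)"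
    by (auto intro!: derivative_eq_intros)
  from diff_chain_at[OF this has_derivative_M] y l
  have "((\<lambda>z. M (l *\<^sub>R z)) has_derivative (\<lambda>a. M1 (l *\<^sub>R y) (l *\<^sub>R a))) (at y)" by (simp add: o_def)
  moreover have "((\<lambda>z. M (l *\<^sub>R z)) has_derivative (\<lambda>a. l\<^sup>2 * M1 y a)) (at y)"
    unfolding homogeneous[OF l] by (rule has_derivative_mult_right[OF has_derivative_M[OF y]])
  ultimately have "M1 (l *\<^sub>R y) (l *\<^sub>R a) = l\<^sup>2 * M1 y a" using has_derivative_unique by metis
  then show ?thesis
    using linear_scale[OF linear_M1, of "l *\<^sub>R y"] y l by (simp add: power2_eq_square)
qed

lemma M2_homogeneous: "y \<noteq> 0 \<Longrightarrow> l > 0 \<Longrightarrow> M2 (l *\<^sub>R y) a b = M2 y a b"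
proof -
  assume y: "y \<noteq> 0" and l: "l > 0"
  have "((\<lambda>z. l *\<^sub>R z) has_derivative (\<lambda>a. l *\<^sub>R a)) (at y)"
    by (auto intro!: derivative_eq_intros)
  from diff_chain_at[OF this has_derivative_M1, of a] y l
  have 1: "((\<lambda>z. M1 (l *\<^sub>R z) a) has_derivative (\<lambda>b. M2 (l *\<^sub>R y) a (l *\<^sub>R b))) (at y)" by (simp add: o_def)
  have "((\<lambda>z. M1 (l *\<^sub>R z) a) has_derivative (\<lambda>b. l * M2 y a b)) (at y)"
    by (rule has_derivative_transform_within_open[OF has_derivative_mult_right[OF has_derivative_M1[OF y]] open_nonzero])
      (simp_all add: y l M1_homogeneous)
  from has_derivative_unique[OF 1 this] have "M2 (l *\<^sub>R y) a (l *\<^sub>R b) = l * M2 y a b" by metis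
  then show ?thesis
    using linear_scale[OF linear_M2, of "l *\<^sub>R y"] y l by simp
qed

lemma M1_self: "y \<noteq> 0 \<Longrightarrow> M1 y y = 2 * M y"
  using euler_homogeneous[OF has_derivative_M, of y 2] homogeneous by simp

lemma M2_self: "y \<noteq> 0 \<Longrightarrow> M2 y a y = M1 y a"
  using euler_homogeneous[OF has_derivative_M1, of y a 1] M1_homogeneous by simp

lemma M3_self: "y \<noteq> 0 \<Longrightarrow> M3 y a b y = 0"
  using euler_homogeneous[OF has_derivative_M2, of y a b 0] M2_homogeneous by simp

lemma M_pos: "y \<noteq> 0 \<Longrightarrow> M y > 0"
  using M2_pos[of y y] M2_self[of y y] M1_self[of y] by simp

lemma quadratic_spray_isometry:
  assumes Q: "bilinear Q" and br: "bilinear br" and alt: "\<And>a. br a a = 0"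
    and spray: "\<And>y z. y \<noteq> 0 \<Longrightarrow> M2 y z (Q y y) = M1 y (br y z)"
    and y: "y \<noteq> 0"
  shows "M1 y (Q z y + Q y z + br y z) = 0"
proof -
  have lin: "linear (\<lambda>a. Q a b)" "linear (Q a)" for a b using Q by (auto simp: bilinear_def)
  \<comment> \<open>At \<open>z = y\<close> the right side of \<open>spray\<close> is zero because
    \<open>br\<close> is alternating, and Euler's identity turns the left side into
    \<open>M1 y (Q y y)\<close>.\<close>
  have zero: "M1 y (Q y y) = 0" if "y \<noteq> 0" for y
    using spray[OF that, of y] M2_self[OF that, of "Q y y"] M2_sym[OF that] alt
    by (simp add: linear_0[OF linear_M1[OF that]])
  have Qd: "((\<lambda>y. Q y y) has_derivative (\<lambda>z. Q z y + Q y z)) (at y)"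
    by (rule has_derivative_linear_family[OF open_UNIV UNIV_I lin(2)])
      (auto intro: linear_imp_has_derivative lin)
  have "((\<lambda>y. M1 y (Q y y)) has_derivative (\<lambda>z. M2 y (Q y y) z + M1 y (Q z y + Q y z))) (at y)"
    by (rule has_derivative_linear_family[OF open_nonzero _ _ _ Qd, where L'="\<lambda>w b. M2 y b w"])
      (use y linear_M1 has_derivative_M1 in auto)
  then have "((\<lambda>y. 0) has_derivative (\<lambda>z. M2 y (Q y y) z + M1 y (Q z y + Q y z))) (at y)"
    by (rule has_derivative_transform_within_open[OF _ open_nonzero]) (use y zero in auto)
  from has_derivative_unique[OF this has_derivative_const]
  have "M2 y (Q y y) z + M1 y (Q z y + Q y z) = 0" by metis
  then show ?thesis
    using spray[OF y, of z] M2_sym[OF y] linear_add[OF linear_M1[OF y]] by simp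
qed

end

text \<open>A Finsler metric \<open>L\<close> on an open set \<open>U\<close> of the coordinate space which is the pullback of one
  Minkowski norm, with square \<open>M\<close>, by the coframe \<open>E\<close>, with inverse \<open>E'\<close>.\<close>

locale finsler_coframe = minkowski M
  for M :: "real ^ 'n::finite \<Rightarrow> real" +
  fixes U :: "(real ^ 'n) set" and E E' :: "real ^ 'n \<Rightarrow> real ^ 'n \<Rightarrow> real ^ 'n"
    and br :: "real ^ 'n \<Rightarrow> real ^ 'n \<Rightarrow> real ^ 'n" and L :: "real ^ 'n \<Rightarrow> real ^ 'n \<Rightarrow> real"
  assumes U: "open U"
    and linear_E: "p \<in> U \<Longrightarrow> linear (E p)"
    and E_E': "p \<in> U \<Longrightarrow> E p (E' p v) = v" and E'_E: "p \<in> U \<Longrightarrow> E' p (E p v) = v"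
    and E_differentiable: "p \<in> U \<Longrightarrow> (\<lambda>p. E p v) differentiable (at p)"
    and structure_equation: "p \<in> U \<Longrightarrow>
      \<D> (\<lambda>p. E p z) p w - \<D> (\<lambda>p. E p w) p z
        = - br (E p w) (E p z)"
    and bilinear_br: "bilinear br"
    and L_sq: "p \<in> U \<Longrightarrow> (L p y)\<^sup>2 = M (E p y)"
begin

definition DE :: "real ^ 'n \<Rightarrow> real ^ 'n \<Rightarrow> real ^ 'n \<Rightarrow> real ^ 'n" where
  "DE p w z = \<D> (\<lambda>p. E p z) p w"

context
  fixes p
  assumes p: "p \<in> U"
begin

lemma has_derivative_E: "((\<lambda>p. E p z) has_derivative (\<lambda>w. DE p w z)) (at p)"
  unfolding DE_def by (rule frechet_derivative_has[OF E_differentiable[OF p]])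

lemma linear_DE_left: "linear (\<lambda>w. DE p w z)"
  using has_derivative_E by (rule has_derivative_linear)

lemma DE_swap: "DE p w z = DE p z w - br (E p w) (E p z)"
  using structure_equation[OF p, of z w] by (simp add: DE_def algebra_simps)

text \<open>Linearity in the direction of differentiation is clear; the structure equation carries
  it over to the other argument.\<close>

lemma linear_DE_right: "linear (DE p w)"
proof -
  have br: "linear (br a)" for a using bilinear_br by (simp add: bilinear_def)
  have "linear (\<lambda>z. DE p z w - br (E p w) (E p z))"
    by (intro linear_compose_sub linear_DE_left linear_compose[OF linear_E[OF p] br, unfolded o_def])
  then show ?thesis by (simp add: DE_swap[of w, symmetric])
qed

lemma E_nonzero: "y \<noteq> 0 \<Longrightarrow> E p y \<noteq> 0"
  using E'_E[OF p] linear_0[OF linear_E[OF p]] by metis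

lemma linear_E': "linear (E' p)"
proof (rule linearI)
  fix a b :: "real ^ 'n" and r :: real
  have "E' p (E p (E' p a) + E p (E' p b)) = E' p a + E' p b"
    by (simp only: linear_add[OF linear_E[OF p], symmetric] E'_E[OF p])
  then show "E' p (a + b) = E' p a + E' p b" by (simp add: E_E' p)
  have "E' p (r *\<^sub>R E p (E' p a)) = r *\<^sub>R E' p a"
    by (simp only: linear_scale[OF linear_E[OF p], symmetric] E'_E[OF p])
  then show "E' p (r *\<^sub>R a) = r *\<^sub>R E' p a" by (simp add: E_E' p)
qed

lemma has_derivative_E_const: "(E p has_derivative E p) (at y)"
  by (rule linear_imp_has_derivative[OF linear_E[OF p]])

lemma has_derivative_L_sq:
  assumes y: "y \<noteq> 0"
  shows "((\<lambda>y. (L p y)\<^sup>2) has_derivative (\<lambda>v. M1 (E p y) (E p v))) (at y)"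
  unfolding L_sq[OF p]
  using diff_chain_at[OF has_derivative_E_const has_derivative_M[OF E_nonzero[OF y]]] by (simp add: o_def)

lemma partial_L_sq:
  "y \<noteq> 0 \<Longrightarrow> partial_deriv (\<lambda>y. (L p y)\<^sup>2) j y = M1 (E p y) (E p (axis j 1))"
  using partial_deriv_eq[OF has_derivative_L_sq] .

lemma fundamental_tensor_eq:
  assumes y: "y \<noteq> 0"
  shows "fundamental_tensor L p y $ i $ j = 1/2 * M2 (E p y) (E p (axis j 1)) (E p (axis i 1))"
proof -
  have "((\<lambda>y. M1 (E p y) (E p (axis j 1))) has_derivative
      (\<lambda>v. M2 (E p y) (E p (axis j 1)) (E p v))) (at y)"
    using diff_chain_at[OF has_derivative_E_const has_derivative_M1[OF E_nonzero[OF y]]] by (simp add: o_def)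
  then have "((\<lambda>y. partial_deriv (\<lambda>y. (L p y)\<^sup>2) j y) has_derivative
      (\<lambda>v. M2 (E p y) (E p (axis j 1)) (E p v))) (at y)"
    by (rule has_derivative_transform_within_open[OF _ open_nonzero]) (simp_all add: y partial_L_sq)
  from partial_deriv_eq[OF this] show ?thesis by (simp add: fundamental_tensor_def)
qed

lemma fundamental_tensor_mult:
  assumes y: "y \<noteq> 0"
  shows "(fundamental_tensor L p y *v x) $ l = 1/2 * M2 (E p y) (E p (axis l 1)) (E p x)"
proof -
  have lin: "linear (\<lambda>x. M2 (E p y) (E p (axis l 1)) (E p x))"
    using linear_compose[OF linear_E[OF p] linear_M2[OF E_nonzero[OF y]]] by (simp add: o_def)
  have "(fundamental_tensor L p y *v x) $ l
      = 1/2 * (\<Sum>j\<in>UNIV. M2 (E p y) (E p (axis l 1)) (E p (axis j 1)) * x $ j)"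
    by (simp add: matrix_vector_mult_def fundamental_tensor_eq[OF y] sum_distrib_left mult.assoc
        M2_sym[OF E_nonzero[OF y], of "E p (axis l 1)"])
  then show ?thesis by (simp add: linear_axis_expansion_real[OF lin])
qed

text \<open>Raises an index without computing the inverse matrix: once the covector \<open>r\<close>
  is recognised as the pairing with a vector \<open>x\<close>, the contraction is \<open>x\<close>.
  Spray coefficients and Chern symbols are both evaluated this way.\<close>

lemma matrix_inv_fundamental_tensor:
  assumes y: "y \<noteq> 0" and r: "\<And>l. r l = 1/2 * M2 (E p y) (E p (axis l 1)) (E p x)"
  shows "(\<Sum>l\<in>UNIV. matrix_inv (fundamental_tensor L p y) $ i $ l * r l) = x $ i"
proof -
  let ?g = "fundamental_tensor L p y"
  have "x = 0" if "?g *v x = 0" for x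
  proof (rule ccontr)
    assume "x \<noteq> 0"
    have lin: "linear (\<lambda>z. M2 (E p y) (E p z) (E p x))"
      using linear_compose[OF linear_E[OF p] linear_M2'[OF E_nonzero[OF y]]] by (simp add: o_def)
    have "M2 (E p y) (E p (axis l 1)) (E p x) = 0" for l
      using fundamental_tensor_mult[OF y, of x l] that by simp
    then have "M2 (E p y) (E p x) (E p x) = 0"
      using linear_axis_expansion_real[OF lin, of x] by simp
    with M2_pos[OF E_nonzero[OF y] E_nonzero[OF \<open>x \<noteq> 0\<close>]] show False by simp
  qed
  then have "invertible ?g"
    using invertible_left_inverse matrix_left_invertible_ker by metis
  then have "matrix_inv ?g ** ?g = mat 1" 
    unfolding matrix_inv_def invertible_def by (metis (mono_tags, lifting) someI_ex)
  moreover have "(\<chi> l. r l) = ?g *v x" by (simp add: vec_eq_iff r fundamental_tensor_mult[OF y])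
  ultimately have "matrix_inv ?g *v (\<chi> l. r l) = x"
    by (simp add: matrix_vector_mul_assoc)
  then show ?thesis by (simp add: vec_eq_iff matrix_vector_mult_def)
qed

lemma M1_E_derivative:
  assumes y: "y \<noteq> 0"
  shows "((\<lambda>q. M1 (E q y) (E q a)) has_derivative
    (\<lambda>w. M2 (E p y) (E p a) (DE p w y) + M1 (E p y) (DE p w a))) (at p)"
proof (rule has_derivative_linear_family[OF U p _ _ has_derivative_E,
        where L'="\<lambda>w b. M2 (E p y) b (DE p w y)"])
  fix b
  show "((\<lambda>q. M1 (E q y) b) has_derivative (\<lambda>w. M2 (E p y) b (DE p w y))) (at p)"
    using diff_chain_at[OF has_derivative_E has_derivative_M1[OF E_nonzero[OF y]]] by (simp add: o_def)
qed (rule linear_M1, metis E'_E linear_0 linear_E y)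

lemma M2_E_derivative:
  assumes y: "y \<noteq> 0"
  shows "((\<lambda>q. M2 (E q y) (E q a) (E q b)) has_derivative
    (\<lambda>w. M3 (E p y) (E p a) (E p b) (DE p w y) + M2 (E p y) (E p a) (DE p w b)
       + M2 (E p y) (DE p w a) (E p b))) (at p)"
proof (rule has_derivative_linear_family[OF U p _ _ has_derivative_E,
        where L'="\<lambda>w c. M3 (E p y) c (E p b) (DE p w y) + M2 (E p y) c (DE p w b)"])
  fix c
  show "((\<lambda>q. M2 (E q y) c (E q b)) has_derivative
     (\<lambda>w. M3 (E p y) c (E p b) (DE p w y) + M2 (E p y) c (DE p w b))) (at p)"
  proof (rule has_derivative_linear_family[OF U p _ _ has_derivative_E,
        where L'="\<lambda>w b. M3 (E p y) c b (DE p w y)"])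
    fix b
    show "((\<lambda>q. M2 (E q y) c b) has_derivative (\<lambda>w. M3 (E p y) c b (DE p w y))) (at p)"
      using diff_chain_at[OF has_derivative_E has_derivative_M2[OF E_nonzero[OF y]]] by (simp add: o_def)
  qed (rule linear_M2, metis E'_E linear_0 linear_E y)
qed (rule linear_M2', metis E'_E linear_0 linear_E y)

text \<open>\<open>S\<close> is the part that lives on the Lie algebra, \<open>DE p y y\<close> the
  contribution of the coordinates. The difference of the two coframe derivatives inside
  \<open>M1\<close> is a bracket by the structure equation, and the defining equation of
  \<open>S\<close> absorbs it into the Hessian.\<close>

lemma spray_coeff_eq:
  assumes y: "y \<noteq> 0" and S: "\<And>z. M2 (E p y) z S = M1 (E p y) (br (E p y) z)"
  shows "spray_coeff L i p y = ((1/2) *\<^sub>R E' p (DE p y y - S)) $ i"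
proof -
  let ?\<eta> = "E p y"
  note \<eta> = E_nonzero[OF y]
  have r: "(\<Sum>m\<in>UNIV. partial_deriv (\<lambda>p'. partial_deriv (\<lambda>y'. (L p' y')\<^sup>2) l y) m p * y $ m)
        - partial_deriv (\<lambda>p'. (L p' y)\<^sup>2) l p
      = 1/2 * M2 ?\<eta> (E p (axis l 1)) (E p (2 *\<^sub>R E' p (DE p y y - S)))" for l
  proof -
    let ?e = "axis l 1 :: real ^ 'n"
    let ?A = "\<lambda>w. M2 ?\<eta> (E p ?e) (DE p w y) + M1 ?\<eta> (DE p w ?e)"
    have "((\<lambda>p'. partial_deriv (\<lambda>y'. (L p' y')\<^sup>2) l y) has_derivative ?A) (at p)"
    proof (rule has_derivative_transform_within_open[OF M1_E_derivative[OF y] U p])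
      fix q assume q: "q \<in> U"
      then have "((\<lambda>y. (L q y)\<^sup>2) has_derivative (\<lambda>v. M1 (E q y) (E q v))) (at y)"
        unfolding L_sq[OF q]
        using diff_chain_at[OF linear_imp_has_derivative[OF linear_E[OF q]], of M "M1 (E q y)" y]
          has_derivative_M[of "E q y"] y E'_E[OF q] linear_0[OF linear_E[OF q]]
        by (metis (no_types, lifting) comp_apply ext)
      from partial_deriv_eq[OF this]
      show "M1 (E q y) (E q ?e) = partial_deriv (\<lambda>y'. (L q y')\<^sup>2) l y" by simp
    qed
    note 1 = partial_deriv_eq[OF this]
    have linA: "linear ?A"
      by (intro linear_compose_add linear_compose[OF linear_DE_left linear_M2[OF \<eta>], unfolded o_def]
          linear_compose[OF linear_DE_left linear_M1[OF \<eta>], unfolded o_def])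
    have "((\<lambda>p'. M (E p' y)) has_derivative (\<lambda>w. M1 ?\<eta> (DE p w y))) (at p)"
      using diff_chain_at[OF has_derivative_E has_derivative_M[OF \<eta>]] by (simp add: o_def)
    then have "((\<lambda>p'. (L p' y)\<^sup>2) has_derivative (\<lambda>w. M1 ?\<eta> (DE p w y))) (at p)"
      by (rule has_derivative_transform_within_open[OF _ U p]) (simp add: L_sq)
    note 2 = partial_deriv_eq[OF this]
    have "(\<Sum>m\<in>UNIV. ?A (axis m 1) * y $ m) - M1 ?\<eta> (DE p ?e y)
      = M2 ?\<eta> (E p ?e) (DE p y y) + (M1 ?\<eta> (DE p y ?e) - M1 ?\<eta> (DE p ?e y))"
      by (simp add: linear_axis_expansion_real[OF linA])
    also have "M1 ?\<eta> (DE p y ?e) - M1 ?\<eta> (DE p ?e y) = - M1 ?\<eta> (br ?\<eta> (E p ?e))"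
      unfolding DE_swap[of y ?e] by (simp add: linear_diff[OF linear_M1[OF \<eta>]])
    also have "M2 ?\<eta> (E p ?e) (DE p y y) + - M1 ?\<eta> (br ?\<eta> (E p ?e))
      = M2 ?\<eta> (E p ?e) (DE p y y - S)"
      by (simp add: linear_diff[OF linear_M2[OF \<eta>]] S)
    finally show ?thesis
      by (simp add: 1 2 linear_scale[OF linear_E[OF p]] linear_scale[OF linear_M2[OF \<eta>]] E_E' p)
  qed
  show ?thesis
    unfolding spray_coeff_def matrix_inv_fundamental_tensor[OF y r] by simp
qed

end

end

context minkowski
begin

text \<open>\<open>K\<close> generates linear isometries of the norm. The two identities are the
  first and second derivatives of \<open>M1 y (K y) = 0\<close>; the second serves to eliminate
  \<open>M3\<close>.\<close>

lemma isometry_derivatives: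
  assumes lin: "linear K" and iso: "\<And>y. y \<noteq> 0 \<Longrightarrow> M1 y (K y) = 0" and y: "y \<noteq> 0"
  shows "M2 y (K y) z + M1 y (K z) = 0"
    and "M3 y z (K y) z' + M2 y z (K z') + M2 y (K z) z' = 0"
proof -
  have K: "(K has_derivative K) (at y)" for y by (rule linear_imp_has_derivative[OF lin])
  have 1: "M2 y (K y) z + M1 y (K z) = 0" if y: "y \<noteq> 0" for y z
  proof -
    have "((\<lambda>y. M1 y (K y)) has_derivative (\<lambda>z. M2 y (K y) z + M1 y (K z))) (at y)"
      by (rule has_derivative_linear_family[OF open_nonzero _ _ _ K, where L'="\<lambda>w b. M2 y b w"])
        (use y linear_M1 has_derivative_M1 in auto)
    then have "((\<lambda>y. 0) has_derivative (\<lambda>z. M2 y (K y) z + M1 y (K z))) (at y)"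
      by (rule has_derivative_transform_within_open[OF _ open_nonzero]) (use y iso in auto)
    from has_derivative_unique[OF this has_derivative_const] show ?thesis by metis
  qed
  show "M2 y (K y) z + M1 y (K z) = 0" using 1[OF y] .
  have "((\<lambda>y. M2 y z (K y)) has_derivative (\<lambda>z'. M3 y z (K y) z' + M2 y z (K z'))) (at y)"
    by (rule has_derivative_linear_family[OF open_nonzero _ _ _ K, where L'="\<lambda>w b. M3 y z b w"])
      (use y linear_M2 has_derivative_M2 in auto)
  from has_derivative_add[OF this has_derivative_M1[OF y]]
  have "((\<lambda>y. M2 y z (K y) + M1 y (K z)) has_derivative
      (\<lambda>z'. M3 y z (K y) z' + M2 y z (K z') + M2 y (K z) z')) (at y)" .
  then have "((\<lambda>y. 0) has_derivative (\<lambda>z'. M3 y z (K y) z' + M2 y z (K z') + M2 y (K z) z')) (at y)"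
    by (rule has_derivative_transform_within_open[OF _ open_nonzero]) (use y 1 M2_sym in auto)
  from has_derivative_unique[OF this has_derivative_const]
  show "M3 y z (K y) z' + M2 y z (K z') + M2 y (K z) z' = 0" by metis
qed

lemma ex_spray_vector:
  assumes y: "y \<noteq> 0" and br: "bilinear br"
  obtains S where "\<And>z. M2 y z S = M1 y (br y z)"
proof -
  have "linear (\<lambda>z. M1 y (br y z))"
    using linear_compose[OF _ linear_M1[OF y], of "br y"] br by (simp add: bilinear_def o_def)
  from riesz_representation[OF bilinear_M2[OF y] M2_pos[OF y] this] show thesis using that by blast
qed

end

section \<open>Chern connection and quadratic sprays in a coframe\<close>

context finsler_coframe
begin

context
  fixes p
  assumes p: "p \<in> U"
begin

text \<open>The derivative in the base point and the vertical correction both enter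
  \<open>M3\<close> linearly in its last argument, so they merge there into one vector, the
  horizontal variation of \<open>E p y\<close>.\<close>

lemma horizontal_deriv_fundamental_tensor:
  assumes y: "y \<noteq> 0"
  shows "horizontal_deriv L (\<lambda>p' y'. fundamental_tensor L p' y' $ j $ l) k p y =
    1/2 * (M3 (E p y) (E p (axis l 1)) (E p (axis j 1))
             (DE p (axis k 1) y - (\<Sum>m\<in>UNIV. nonlinear_connection L m k p y *\<^sub>R E p (axis m 1)))
         + M2 (E p y) (E p (axis l 1)) (DE p (axis k 1) (axis j 1))
         + M2 (E p y) (DE p (axis k 1) (axis l 1)) (E p (axis j 1)))"
proof -
  let ?\<eta> = "E p y" and ?l = "E p (axis l 1)" and ?j = "E p (axis j 1)"
  note \<eta> = E_nonzero[OF p y]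
  note lin = linear_M3[OF \<eta>]
  have "((\<lambda>q. fundamental_tensor L q y $ j $ l) has_derivative (\<lambda>w. 1/2 *
      (M3 ?\<eta> ?l ?j (DE p w y) + M2 ?\<eta> ?l (DE p w (axis j 1)) + M2 ?\<eta> (DE p w (axis l 1)) ?j))) (at p)"
    by (rule has_derivative_transform_within_open[OF has_derivative_mult_right[OF M2_E_derivative[OF p y]] U p])
      (simp add: fundamental_tensor_eq y)
  note 1 = partial_deriv_eq[OF this, of k]
  have "((\<lambda>y. M2 (E p y) ?l ?j) has_derivative (\<lambda>v. M3 ?\<eta> ?l ?j (E p v))) (at y)"
    using diff_chain_at[OF has_derivative_E_const[OF p] has_derivative_M2[OF \<eta>]] by (simp add: o_def)
  from has_derivative_mult_right[OF this, of "1/2"]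
  have "((\<lambda>y. fundamental_tensor L p y $ j $ l) has_derivative (\<lambda>v. 1/2 * M3 ?\<eta> ?l ?j (E p v))) (at y)"
    by (rule has_derivative_transform_within_open[OF _ open_nonzero])
      (simp_all add: fundamental_tensor_eq p y)
  note 2 = partial_deriv_eq[OF this]
  show ?thesis
    unfolding horizontal_deriv_def 1 2 linear_diff[OF lin] linear_sum[OF lin] linear_scale[OF lin]
    by (simp add: algebra_simps sum_distrib_left)
qed

text \<open>The terms with the nonlinear connection contain the third derivative of \<open>M\<close> in the direction
  \<open>\<eta>\<close> itself and vanish by homogeneity, so only the spray remains.\<close>

lemma chern_contraction:
  assumes y: "y \<noteq> 0" and S: "\<And>z. M2 (E p y) z S = M1 (E p y) (br (E p y) z)"
  shows "(\<Sum>j\<in>UNIV. \<Sum>k\<in>UNIV. chern_christoffel L i j k p y * y $ j * y $ k) = E' p (DE p y y - S) $ i"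
proof -
  let ?\<eta> = "E p y"
  note \<eta> = E_nonzero[OF p y]
  define h where "h k j l = horizontal_deriv L (\<lambda>p' y'. fundamental_tensor L p' y' $ j $ l) k p y" for k j l
  \<comment> \<open>This vector is never computed: it occurs only in \<open>M3\<close>, which
    vanishes as soon as \<open>E p y\<close> fills another place.\<close>
  define W where "W k = DE p (axis k 1) y - (\<Sum>m\<in>UNIV. nonlinear_connection L m k p y *\<^sub>R E p (axis m 1))" for k
  define K where "K k l a = 1/2 * (M3 ?\<eta> (E p (axis l 1)) (E p a) (W k)
      + M2 ?\<eta> (E p (axis l 1)) (DE p (axis k 1) a) + M2 ?\<eta> (DE p (axis k 1) (axis l 1)) (E p a))" for k l a
  define R where "R l w = 1/2 * (M2 ?\<eta> (E p (axis l 1)) (DE p w y) + M1 ?\<eta> (DE p w (axis l 1)))" for l w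
  have hK: "h k j l = K k l (axis j 1)" for k j l
    unfolding h_def K_def W_def by (rule horizontal_deriv_fundamental_tensor[OF y])
  \<comment> \<open>The symmetry of the fundamental tensor lets either of its indices be the one
    that is contracted linearly.\<close>
  have hK': "h k j l = K k j (axis l 1)" for k j l
    unfolding hK K_def using M3_sym'[OF \<eta>] M2_sym[OF \<eta>] by simp
  have linK: "linear (K k l)" for k l
  proof -
    have "linear (\<lambda>a. M3 ?\<eta> (E p (axis l 1)) (E p a) (W k))"
      using linear_compose[OF linear_E[OF p] linear_M3[OF \<eta>, of "E p (axis l 1)" "W k"]]
      by (simp add: o_def M3_sym[OF \<eta>, of _ "W k"])
    moreover have "linear (\<lambda>a. M2 ?\<eta> (E p (axis l 1)) (DE p (axis k 1) a))"
      using linear_compose[OF linear_DE_right[OF p] linear_M2[OF \<eta>]] by (simp add: o_def)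
    moreover have "linear (\<lambda>a. M2 ?\<eta> (DE p (axis k 1) (axis l 1)) (E p a))"
      using linear_compose[OF linear_E[OF p] linear_M2[OF \<eta>]] by (simp add: o_def)
    ultimately have "linear (\<lambda>a. (1/2) *\<^sub>R (M3 ?\<eta> (E p (axis l 1)) (E p a) (W k)
      + M2 ?\<eta> (E p (axis l 1)) (DE p (axis k 1) a) + M2 ?\<eta> (DE p (axis k 1) (axis l 1)) (E p a)))"
      by (intro linear_compose_scale_right linear_compose_add)
    then show ?thesis by (simp add: K_def[abs_def])
  qed
  have linR: "linear (R l)" for l
  proof -
    have "linear (\<lambda>w. (1/2) *\<^sub>R (M2 ?\<eta> (E p (axis l 1)) (DE p w y) + M1 ?\<eta> (DE p w (axis l 1))))"
      using linear_compose[OF linear_DE_left[OF p] linear_M2[OF \<eta>]]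
        linear_compose[OF linear_DE_left[OF p] linear_M1[OF \<eta>]]
      by (intro linear_compose_scale_right linear_compose_add) (simp_all add: o_def)
    then show ?thesis by (simp add: R_def[abs_def])
  qed
  have Ky: "K k l y = R l (axis k 1)" for k l
    by (simp add: K_def R_def M3_sym'[OF \<eta>, of "E p (axis l 1)"] M3_sym[OF \<eta>, of "E p y"])
      (simp add: M3_sym'[OF \<eta>, of "E p y"] M3_sym[OF \<eta>, of _ "E p y"] M3_self[OF \<eta>] M2_self[OF \<eta>])
  have sumK: "(\<Sum>j\<in>UNIV. K k l (axis j 1) * y $ j) = R l (axis k 1)" for k l
    by (simp add: linear_axis_expansion_real[OF linK] Ky)
  have s1: "(\<Sum>j\<in>UNIV. \<Sum>k\<in>UNIV. h k j l * y $ j * y $ k) = R l y" for l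
  proof -
    have "(\<Sum>j\<in>UNIV. \<Sum>k\<in>UNIV. h k j l * y $ j * y $ k) = (\<Sum>k\<in>UNIV. (\<Sum>j\<in>UNIV. K k l (axis j 1) * y $ j) * y $ k)"
      unfolding hK sum_distrib_right by (rule sum.swap)
    then show ?thesis by (simp add: sumK linear_axis_expansion_real[OF linR])
  qed
  have s2: "(\<Sum>j\<in>UNIV. \<Sum>k\<in>UNIV. h j l k * y $ j * y $ k) = R l y" for l
  proof -
    have "(\<Sum>j\<in>UNIV. \<Sum>k\<in>UNIV. h j l k * y $ j * y $ k) = (\<Sum>j\<in>UNIV. (\<Sum>k\<in>UNIV. K j l (axis k 1) * y $ k) * y $ j)"
      unfolding hK' sum_distrib_right by (simp add: mult_ac)
    then show ?thesis by (simp add: sumK linear_axis_expansion_real[OF linR])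
  qed
  have s3: "(\<Sum>j\<in>UNIV. \<Sum>k\<in>UNIV. h l j k * y $ j * y $ k) = M1 ?\<eta> (DE p (axis l 1) y)" for l
  proof -
    have "(\<Sum>j\<in>UNIV. \<Sum>k\<in>UNIV. h l j k * y $ j * y $ k) = (\<Sum>k\<in>UNIV. (\<Sum>j\<in>UNIV. K l k (axis j 1) * y $ j) * y $ k)"
      unfolding hK sum_distrib_right by (rule sum.swap)
    also have "\<dots> = (\<Sum>k\<in>UNIV. R k (axis l 1) * y $ k)" by (simp add: sumK)
    also have "\<dots> = M1 ?\<eta> (DE p (axis l 1) y)"
    proof -
      have "linear (\<lambda>a. (1/2) *\<^sub>R (M2 ?\<eta> (E p a) (DE p (axis l 1) y) + M1 ?\<eta> (DE p (axis l 1) a)))"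
        using linear_compose[OF linear_E[OF p] linear_M2'[OF \<eta>]]
          linear_compose[OF linear_DE_right[OF p] linear_M1[OF \<eta>]]
        by (intro linear_compose_scale_right linear_compose_add) (simp_all add: o_def)
      from linear_axis_expansion_real[OF this, of y] show ?thesis
        by (simp add: R_def M2_sym[OF \<eta>, of ?\<eta>] M2_self[OF \<eta>])
    qed
    finally show ?thesis .
  qed
  let ?g = "\<lambda>l. matrix_inv (fundamental_tensor L p y) $ i $ l"
  let ?c = "\<lambda>j k l. h k j l + h j l k - h l j k"
  have r: "1/2 * (\<Sum>j\<in>UNIV. \<Sum>k\<in>UNIV. ?c j k l * y $ j * y $ k)
      = 1/2 * M2 ?\<eta> (E p (axis l 1)) (E p (E' p (DE p y y - S)))" for l
  proof -
    have "(\<Sum>j\<in>UNIV. \<Sum>k\<in>UNIV. ?c j k l * y $ j * y $ k)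
      = R l y + R l y - M1 ?\<eta> (DE p (axis l 1) y)"
      unfolding s1[symmetric, of l] s3[symmetric]
      unfolding s1 unfolding s2[symmetric, of l]
      by (simp add: left_diff_distrib distrib_right sum_subtractf sum.distrib s1 s2)
    also have "\<dots> = M2 ?\<eta> (E p (axis l 1)) (DE p y y) + (M1 ?\<eta> (DE p y (axis l 1)) - M1 ?\<eta> (DE p (axis l 1) y))"
      by (simp add: R_def)
    also have "M1 ?\<eta> (DE p y (axis l 1)) - M1 ?\<eta> (DE p (axis l 1) y) = - M1 ?\<eta> (br ?\<eta> (E p (axis l 1)))"
      unfolding DE_swap[OF p, of y "axis l 1"] by (simp add: linear_diff[OF linear_M1[OF \<eta>]])
    also have "M2 ?\<eta> (E p (axis l 1)) (DE p y y) + - M1 ?\<eta> (br ?\<eta> (E p (axis l 1)))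
      = M2 ?\<eta> (E p (axis l 1)) (DE p y y - S)"
      by (simp add: linear_diff[OF linear_M2[OF \<eta>]] S)
    finally show ?thesis by (simp add: E_E' p)
  qed
  have "(\<Sum>j\<in>UNIV. \<Sum>k\<in>UNIV. chern_christoffel L i j k p y * y $ j * y $ k)
      = (\<Sum>j\<in>UNIV. \<Sum>k\<in>UNIV. \<Sum>l\<in>UNIV. ?g l * (1/2 * (?c j k l * y $ j * y $ k)))"
    unfolding chern_christoffel_def h_def[symmetric] sum_distrib_left sum_distrib_right
    by (simp add: mult_ac)
  also have "\<dots> = (\<Sum>j\<in>UNIV. \<Sum>l\<in>UNIV. \<Sum>k\<in>UNIV. ?g l * (1/2 * (?c j k l * y $ j * y $ k)))"
    by (rule sum.cong[OF refl], rule sum.swap)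
  also have "\<dots> = (\<Sum>l\<in>UNIV. \<Sum>j\<in>UNIV. \<Sum>k\<in>UNIV. ?g l * (1/2 * (?c j k l * y $ j * y $ k)))"
    by (rule sum.swap)
  also have "\<dots> = (\<Sum>l\<in>UNIV. ?g l * (1/2 * (\<Sum>j\<in>UNIV. \<Sum>k\<in>UNIV. ?c j k l * y $ j * y $ k)))"
    by (simp add: sum_distrib_left)
  also have "\<dots> = E' p (DE p y y - S) $ i"
    by (rule matrix_inv_fundamental_tensor[OF p y]) (rule r)
  finally show ?thesis .
qed

text \<open>At a single point the coordinate symbols \<Gamma> and the derivative of the coframe
  combine into one bilinear map on the Lie algebra.\<close>

lemma quadratic_spray_vector:
  fixes \<Gamma> :: "'n \<Rightarrow> 'n \<Rightarrow> 'n \<Rightarrow> real"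
  assumes spray: "\<And>y i. y \<noteq> 0 \<Longrightarrow> spray_coeff L i p y =
      1/2 * (\<Sum>j\<in>UNIV. \<Sum>k\<in>UNIV. \<Gamma> i j k * y $ j * y $ k) + P y * y $ i"
  obtains Q where "bilinear Q"
    "\<And>\<eta> z. \<eta> \<noteq> 0 \<Longrightarrow> M2 \<eta> z (Q \<eta> \<eta> - (2 * P (E' p \<eta>)) *\<^sub>R \<eta>) = M1 \<eta> (br \<eta> z)"
proof -
  define C where "C a b = (\<chi> i. \<Sum>j\<in>UNIV. \<Sum>k\<in>UNIV. \<Gamma> i j k * a $ j * b $ k)" for a b :: "real ^ 'n"
  have C: "bilinear C"
    unfolding bilinear_def C_def
    by (auto intro!: linearI simp: vec_eq_iff algebra_simps sum.distrib sum_distrib_left)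
  \<comment> \<open>Found by solving \<open>spray_coeff_eq\<close> for \<open>S\<close>: the part of
    \<open>S\<close> that is quadratic in \<eta>.\<close>
  define Q where "Q a b = DE p (E' p a) (E' p b) - E p (C (E' p a) (E' p b))" for a b
  have "bilinear Q"
    unfolding bilinear_def Q_def using C linear_E[OF p]
    by (auto intro!: linear_compose_sub linear_compose[OF linear_E'[OF p] linear_DE_left[OF p], unfolded o_def]
        linear_compose[OF linear_E'[OF p] linear_DE_right[OF p], unfolded o_def]
        linear_compose[OF linear_compose[OF linear_E'[OF p]] linear_E[OF p], unfolded o_def] simp: bilinear_def)
  moreover have "M2 \<eta> z (Q \<eta> \<eta> - (2 * P (E' p \<eta>)) *\<^sub>R \<eta>) = M1 \<eta> (br \<eta> z)" if \<eta>: "\<eta> \<noteq> 0" for \<eta> z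
  proof -
    let ?y = "E' p \<eta>"
    have Ey: "E p ?y = \<eta>" by (rule E_E'[OF p])
    have y: "?y \<noteq> 0" using Ey \<eta> linear_0[OF linear_E[OF p]] by metis
    obtain S where S: "\<And>z. M2 \<eta> z S = M1 \<eta> (br \<eta> z)"
      using ex_spray_vector[OF \<eta> bilinear_br] by blast
    have "spray_coeff L i p ?y = ((1/2) *\<^sub>R E' p (DE p ?y ?y - S)) $ i" for i
      by (rule spray_coeff_eq[OF p y]) (simp add: Ey S)
    then have "((1/2) *\<^sub>R E' p (DE p ?y ?y - S)) = (1/2) *\<^sub>R C ?y ?y + P ?y *\<^sub>R ?y"
      by (simp add: vec_eq_iff spray[OF y] C_def)
    then have "2 *\<^sub>R ((1/2) *\<^sub>R E' p (DE p ?y ?y - S)) = 2 *\<^sub>R ((1/2) *\<^sub>R C ?y ?y + P ?y *\<^sub>R ?y)" by (rule arg_cong)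
    then have "E' p (DE p ?y ?y - S) = C ?y ?y + (2 * P ?y) *\<^sub>R ?y" by (simp add: scaleR_add_right)
    then have "E p (E' p (DE p ?y ?y - S)) = E p (C ?y ?y + (2 * P ?y) *\<^sub>R ?y)" by simp
    then have "DE p ?y ?y - S = E p (C ?y ?y) + (2 * P ?y) *\<^sub>R \<eta>"
      by (simp add: E_E'[OF p] linear_add[OF linear_E[OF p]] linear_scale[OF linear_E[OF p]])
    then have "S = Q \<eta> \<eta> - (2 * P ?y) *\<^sub>R \<eta>" by (simp add: Q_def algebra_simps)
    then show ?thesis using S by simp
  qed
  ultimately show thesis using that by blast
qed

text \<open>Contracted twice with \<open>y\<close>, the Chern symbols give twice the spray
  coefficients. Freezing the symbols at one nonzero vector therefore makes the spray
  quadratic.\<close>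

lemma berwald_imp_quadratic_spray:
  assumes "\<And>y y' i j k. y \<noteq> 0 \<Longrightarrow> y' \<noteq> 0 \<Longrightarrow> chern_christoffel L i j k p y = chern_christoffel L i j k p y'"
  obtains Q where "bilinear Q" "\<And>\<eta> z. \<eta> \<noteq> 0 \<Longrightarrow> M2 \<eta> z (Q \<eta> \<eta>) = M1 \<eta> (br \<eta> z)"
proof -
  obtain y0 :: "real ^ 'n" where y0: "y0 \<noteq> 0" by (metis axis_eq_0_iff zero_neq_one)
  define \<Gamma> where "\<Gamma> i j k = chern_christoffel L i j k p y0" for i j k
  have "spray_coeff L i p y = 1/2 * (\<Sum>j\<in>UNIV. \<Sum>k\<in>UNIV. \<Gamma> i j k * y $ j * y $ k) + 0 * y $ i"
    if y: "y \<noteq> 0" for y i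
  proof -
    obtain S where S: "\<And>z. M2 (E p y) z S = M1 (E p y) (br (E p y) z)"
      using ex_spray_vector[OF E_nonzero[OF p y] bilinear_br] by blast
    have "\<Gamma> i j k = chern_christoffel L i j k p y" for j k unfolding \<Gamma>_def using assms y0 y by blast
    then show ?thesis using chern_contraction[OF y S, of i] spray_coeff_eq[OF p y S, of i] by simp
  qed
  from quadratic_spray_vector[OF this]
  obtain Q where "bilinear Q" "\<And>\<eta> z. \<eta> \<noteq> 0 \<Longrightarrow> M2 \<eta> z (Q \<eta> \<eta> - (2 * 0) *\<^sub>R \<eta>) = M1 \<eta> (br \<eta> z)" by blast
  then show thesis using that by simp
qed

text \<open>This is the uniqueness of the Chern connection: a torsion-free \<open>B\<close> that
  acts by infinitesimal isometries must induce it. The right side is free of \<open>y\<close>, which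
  is the Berwald condition.\<close>

lemma chern_christoffel_eq:
  assumes B: "bilinear B" and tor: "\<And>a b. B a b - B b a = br a b"
    and iso: "\<And>z y. y \<noteq> 0 \<Longrightarrow> M1 y (B z y) = 0" and y: "y \<noteq> 0"
  shows "chern_christoffel L i j k p y
    = E' p (DE p (axis j 1) (axis k 1) + B (E p (axis j 1)) (E p (axis k 1))) $ i"
proof -
  let ?\<eta> = "E p y"
  note \<eta> = E_nonzero[OF p y]
  have linB: "linear (B a)" "linear (\<lambda>a. B a b)" for a b using B by (auto simp: bilinear_def)
  define C where "C w z = E' p (DE p w z + B (E p w) (E p z))" for w z
  have EC: "E p (C w z) = DE p w z + B (E p w) (E p z)" for w z by (simp add: C_def E_E' p)
  have Csym: "C w z = C z w" for w z
    unfolding C_def DE_swap[OF p, of w z] using tor[of "E p w" "E p z"] by (simp add: algebra_simps)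
  have linC: "linear (C w)" for w
    unfolding C_def
    by (intro linear_compose[OF linear_compose_add[OF linear_DE_right[OF p]
            linear_compose[OF linear_E[OF p] linB(1)]] linear_E'[OF p], unfolded o_def])
  have linC': "linear (\<lambda>w. C w z)" for z using linC[of z] by (simp add: Csym[of _ z])
  have spray: "spray_coeff L i p y = 1/2 * C y y $ i" if y: "y \<noteq> 0" for y i
  proof -
    note \<eta> = E_nonzero[OF p y]
    have "M2 (E p y) z (- B (E p y) (E p y)) = M1 (E p y) (br (E p y) z)" for z
    proof -
      have "M2 (E p y) (B (E p y) (E p y)) z + M1 (E p y) (B (E p y) z) = 0"
        by (rule isometry_derivatives(1)[OF linB(1) iso \<eta>])
      moreover have "M1 (E p y) (br (E p y) z) = M1 (E p y) (B (E p y) z) - M1 (E p y) (B z (E p y))"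
        by (simp add: tor[symmetric] linear_diff[OF linear_M1[OF \<eta>]])
      ultimately show ?thesis
        by (simp add: iso[OF \<eta>] M2_sym[OF \<eta>, of z] linear_neg[OF linear_M2'[OF \<eta>]])
    qed
    from spray_coeff_eq[OF p y this] show ?thesis by (simp add: C_def)
  qed
  \<comment> \<open>The spray is half the quadratic form of the symmetric map \<open>C\<close>, so
    its derivative in \<open>y\<close> is \<open>C\<close> itself.\<close>
  have N: "nonlinear_connection L m k p y = C (axis k 1) y $ m" for m k
  proof -
    have "((\<lambda>y. C y y) has_derivative (\<lambda>z. C z y + C y z)) (at y)"
      by (rule has_derivative_linear_family[OF open_UNIV UNIV_I linC])
        (auto intro: linear_imp_has_derivative linC')
    from has_derivative_mult_right[OF bounded_linear.has_derivative[OF bounded_linear_vec_nth this]]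
    have "((\<lambda>y. 1/2 * C y y $ m) has_derivative (\<lambda>z. 1/2 * (C z y + C y z) $ m)) (at y)" .
    then have "((\<lambda>y. spray_coeff L m p y) has_derivative (\<lambda>z. 1/2 * (C z y + C y z) $ m)) (at y)"
      by (rule has_derivative_transform_within_open[OF _ open_nonzero]) (simp_all add: y spray)
    from partial_deriv_eq[OF this] show ?thesis
      by (simp add: nonlinear_connection_def Csym[of y])
  qed
  define h where "h k j l = horizontal_deriv L (\<lambda>p' y'. fundamental_tensor L p' y' $ j $ l) k p y" for k j l
  have h: "h k j l = 1/2 * (M2 ?\<eta> (E p (axis l 1)) (E p (C (axis k 1) (axis j 1)))
      + M2 ?\<eta> (E p (C (axis k 1) (axis l 1))) (E p (axis j 1)))" for k j l
  proof -
    let ?k = "E p (axis k 1)" and ?l = "E p (axis l 1)" and ?j = "E p (axis j 1)"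
    have "(\<Sum>m\<in>UNIV. nonlinear_connection L m k p y *\<^sub>R E p (axis m 1)) = E p (C (axis k 1) y)"
      unfolding N by (rule linear_axis_expansion[OF linear_E[OF p]])
    then have W: "DE p (axis k 1) y - (\<Sum>m\<in>UNIV. nonlinear_connection L m k p y *\<^sub>R E p (axis m 1)) = - B ?k ?\<eta>"
      by (simp add: EC)
    \<comment> \<open>The second derivative of the isometry condition trades the \<open>M3\<close>
      term for Hessians, which leaves the pattern of Riemannian Christoffel symbols.\<close>
    have "M3 ?\<eta> ?l (B ?k ?\<eta>) ?j + M2 ?\<eta> ?l (B ?k ?j) + M2 ?\<eta> (B ?k ?l) ?j = 0"
      by (rule isometry_derivatives(2)[OF linB(1) iso \<eta>])
    then have "M3 ?\<eta> ?l ?j (- B ?k ?\<eta>) = M2 ?\<eta> ?l (B ?k ?j) + M2 ?\<eta> (B ?k ?l) ?j"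
      by (simp add: linear_neg[OF linear_M3[OF \<eta>]] M3_sym[OF \<eta>, of ?l ?j])
    then show ?thesis
      unfolding h_def horizontal_deriv_fundamental_tensor[OF y] W
      by (simp add: EC linear_add[OF linear_M2[OF \<eta>]] linear_add[OF linear_M2'[OF \<eta>]])
  qed
  have "h k j l + h j l k - h l j k = 1/2 * M2 ?\<eta> (E p (axis l 1)) (E p (2 *\<^sub>R C (axis j 1) (axis k 1)))" for l
  proof -
    \<comment> \<open>\<open>T\<close> is symmetric in its last two indices because \<open>B\<close>
      has no torsion; the usual cancellation then leaves a single term.\<close>
    define T where "T l k j = M2 ?\<eta> (E p (axis l 1)) (E p (C (axis k 1) (axis j 1)))" for l k j
    have hT: "h k j l = 1/2 * (T l k j + T j k l)" for k j l
      unfolding h T_def by (simp add: M2_sym[OF \<eta>, of "E p (axis j 1)"])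
    have "T l k j = T l j k" for l k j unfolding T_def by (simp add: Csym[of "axis k 1"])
    from this[of l k j] this[of k l j] this[of j l k]
    have "h k j l + h j l k - h l j k = T l j k" unfolding hT by argo
    then show ?thesis
      unfolding T_def linear_scale[OF linear_E[OF p]] linear_scale[OF linear_M2[OF \<eta>]] by simp
  qed
  from matrix_inv_fundamental_tensor[OF p y this, of i] show ?thesis
    by (simp add: chern_christoffel_def h_def C_def)
qed

text \<open>The way back from the Lie algebra to coordinates: multiples of \<open>E p y\<close>
  become multiples of \<open>y\<close>, with the factor \<open>-1/2\<close> that
  \<open>spray_coeff_eq\<close> puts before \<open>S\<close>.\<close>

lemma douglas_spray_coeff:
  assumes Q: "bilinear Q" and spray: "\<And>\<eta> z. \<eta> \<noteq> 0 \<Longrightarrow> M2 \<eta> z (Q \<eta> \<eta> + P \<eta> *\<^sub>R \<eta>) = M1 \<eta> (br \<eta> z)"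
    and y: "y \<noteq> 0"
  shows "spray_coeff L i p y =
    1/2 * (\<Sum>j\<in>UNIV. \<Sum>k\<in>UNIV. (E' p (DE p (axis j 1) (axis k 1) - Q (E p (axis j 1)) (E p (axis k 1))) $ i)
        * y $ j * y $ k) + (- 1/2 * P (E p y)) * y $ i"
proof -
  have linQ: "linear (Q a)" "linear (\<lambda>a. Q a b)" for a b using Q by (auto simp: bilinear_def)
  define C where "C w z = E' p (DE p w z - Q (E p w) (E p z)) $ i" for w z
  have C1: "linear (C w)" for w
    unfolding C_def
    by (rule linear_compose[OF linear_compose[OF linear_compose_sub[OF linear_DE_right[OF p]
            linear_compose[OF linear_E[OF p] linQ(1)]] linear_E'[OF p]]
          bounded_linear.linear[OF bounded_linear_vec_nth], unfolded o_def])
  have C2: "linear (\<lambda>w. C w z)" for z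
    unfolding C_def
    by (rule linear_compose[OF linear_compose[OF linear_compose_sub[OF linear_DE_left[OF p]
            linear_compose[OF linear_E[OF p] linQ(2)]] linear_E'[OF p]]
          bounded_linear.linear[OF bounded_linear_vec_nth], unfolded o_def])
  have "(\<Sum>j\<in>UNIV. \<Sum>k\<in>UNIV. C (axis j 1) (axis k 1) * y $ j * y $ k)
      = (\<Sum>j\<in>UNIV. (\<Sum>k\<in>UNIV. C (axis j 1) (axis k 1) * y $ k) * y $ j)"
    by (simp add: sum_distrib_left mult_ac)
  also have "\<dots> = C y y"
    by (simp add: linear_axis_expansion_real[OF C1] linear_axis_expansion_real[OF C2])
  finally have sum: "(\<Sum>j\<in>UNIV. \<Sum>k\<in>UNIV. C (axis j 1) (axis k 1) * y $ j * y $ k) = C y y" .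
  have "spray_coeff L i p y = ((1/2) *\<^sub>R E' p (DE p y y - (Q (E p y) (E p y) + P (E p y) *\<^sub>R E p y))) $ i"
    by (rule spray_coeff_eq[OF p y spray[OF E_nonzero[OF p y]]])
  also have "E' p (DE p y y - (Q (E p y) (E p y) + P (E p y) *\<^sub>R E p y))
     = E' p (DE p y y - Q (E p y) (E p y)) - P (E p y) *\<^sub>R y"
    by (simp add: diff_diff_eq[symmetric] linear_diff[OF linear_E'[OF p]] linear_scale[OF linear_E'[OF p]] E'_E[OF p])
  finally show ?thesis using sum by (simp add: C_def algebra_simps)
qed

end

end

text \<open>The spray vector is determined by its equation and homogeneous of degree two. So is its
  \<open>Q\<close> part, and the remaining multiple of \<eta> leaves degree one for
  \<open>P\<close>.\<close>

lemma (in minkowski) spray_factor_homogeneous: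
  assumes Q: "bilinear Q" and br: "bilinear br"
    and spray: "\<And>\<eta> z. \<eta> \<noteq> 0 \<Longrightarrow> M2 \<eta> z (Q \<eta> \<eta> + P \<eta> *\<^sub>R \<eta>) = M1 \<eta> (br \<eta> z)"
    and \<eta>: "\<eta> \<noteq> 0" and l: "l > 0"
  shows "P (l *\<^sub>R \<eta>) = l * P \<eta>"
proof -
  let ?S = "\<lambda>\<eta>. Q \<eta> \<eta> + P \<eta> *\<^sub>R \<eta>"
  have lin: "linear (br a)" "linear (\<lambda>a. br a b)" "linear (Q a)" "linear (\<lambda>a. Q a b)" for a b
    using Q br by (auto simp: bilinear_def)
  have "?S (l *\<^sub>R \<eta>) = l\<^sup>2 *\<^sub>R ?S \<eta>"
  proof (rule M2_cancel[OF \<eta>])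
    fix z
    have "M2 \<eta> z (?S (l *\<^sub>R \<eta>)) = M2 (l *\<^sub>R \<eta>) z (?S (l *\<^sub>R \<eta>))" using M2_homogeneous[OF \<eta> l] by simp
    also have "\<dots> = M1 (l *\<^sub>R \<eta>) (br (l *\<^sub>R \<eta>) z)" using spray[of "l *\<^sub>R \<eta>"] \<eta> l by simp
    also have "\<dots> = l\<^sup>2 * M1 \<eta> (br \<eta> z)"
      by (simp add: M1_homogeneous[OF \<eta> l] linear_scale[OF lin(2)] linear_scale[OF linear_M1[OF \<eta>]] power2_eq_square)
    also have "\<dots> = M2 \<eta> z (l\<^sup>2 *\<^sub>R ?S \<eta>)" using spray[OF \<eta>] by (simp add: linear_scale[OF linear_M2[OF \<eta>]])
    finally show "M2 \<eta> z (?S (l *\<^sub>R \<eta>)) = M2 \<eta> z (l\<^sup>2 *\<^sub>R ?S \<eta>)" .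
  qed
  then have "(P (l *\<^sub>R \<eta>) * l) *\<^sub>R \<eta> = (l\<^sup>2 * P \<eta>) *\<^sub>R \<eta>"
    by (simp add: linear_scale[OF lin(3)] linear_scale[OF lin(4)] scaleR_add_right power2_eq_square)
  then show ?thesis using \<eta> l by (simp add: power2_eq_square)
qed

lemma alternating_imp_skew:
  assumes "bilinear br" "\<And>a. br a a = 0"
  shows "br a c = - br c a"
proof -
  have lin: "linear (br a)" "linear (\<lambda>a. br a c)" for a c using assms(1) by (auto simp: bilinear_def)
  have "br (a + c) (a + c) = br a a + br c a + (br a c + br c c)"
    by (simp add: linear_add[OF lin(1)] linear_add[OF lin(2)])
  then show ?thesis by (simp add: assms(2) eq_neg_iff_add_eq_0 add.commute)
qed

section \<open>Minkowski norms of \<open>(\<alpha>,\<beta>)\<close> type\<close>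

locale inner_form =
  fixes b :: "real ^ 'n::finite \<Rightarrow> real ^ 'n \<Rightarrow> real"
  assumes bilinear_b: "bilinear b" and b_sym: "b v w = b w v" and b_pos: "v \<noteq> 0 \<Longrightarrow> b v v > 0"
begin

lemma linear_b: "linear (b v)" and linear_b': "linear (\<lambda>v. b v w)"
  using bilinear_b by (auto simp: bilinear_def)

lemmas b_simps = linear_add[OF linear_b] linear_add[OF linear_b'] linear_diff[OF linear_b] linear_diff[OF linear_b']
  linear_scale[OF linear_b] linear_scale[OF linear_b'] linear_0[OF linear_b] linear_0[OF linear_b']
  linear_neg[OF linear_b] linear_neg[OF linear_b']

lemma b_nonneg: "b v v \<ge> 0"
  using b_pos[of v] by (cases "v = 0") (auto simp: b_simps)

lemma b_cancel: "(\<And>z. b z v = b z w) \<Longrightarrow> v = w"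
  using b_pos[of "v - w"] by (force simp: b_simps)

lemma cauchy_schwarz: "(b v w)\<^sup>2 \<le> b v v * b w w"
proof (cases "v = 0")
  case False
  note p = b_pos[OF False]
  have "0 \<le> b (b v v *\<^sub>R w - b v w *\<^sub>R v) (b v v *\<^sub>R w - b v w *\<^sub>R v)" by (rule b_nonneg)
  also have "\<dots> = b v v * (b v v * b w w - (b v w)\<^sup>2)"
    by (simp add: b_simps b_sym[of w v] power2_eq_square algebra_simps)
  finally show ?thesis using p by (simp add: zero_le_mult_iff)
qed (simp add: b_simps)

text \<open>Each pair of arguments has its representing vector; uniqueness of that vector makes the
  dependence on the pair bilinear.\<close>

lemma ex_bilinear_representation:
  assumes f: "\<And>a c. linear (f a c)" "\<And>a d. linear (\<lambda>c. f a c d)" "\<And>c d. linear (\<lambda>a. f a c d)"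
  obtains B where "bilinear B" "\<And>a c d. b d (B a c) = f a c d"
proof -
  have "\<forall>a c. \<exists>s. \<forall>d. b d s = f a c d"
    using riesz_representation[OF bilinear_b b_pos f(1)] by metis
  then obtain B where B: "\<And>a c d. b d (B a c) = f a c d" by metis
  have "linear (B a)" "linear (\<lambda>a. B a c)" for a c
    by (auto intro!: linearI b_cancel
        simp: B b_simps linear_add[OF f(2)] linear_add[OF f(3)] linear_scale[OF f(2)] linear_scale[OF f(3)])
  then have "bilinear B" by (simp add: bilinear_def)
  then show thesis using B by (rule that)
qed

lemma b_linear_family:
  "linear h \<Longrightarrow> linear (\<lambda>x. b (h x) v)" "linear h \<Longrightarrow> linear (\<lambda>x. b v (h x))"
  using linear_compose[OF _ linear_b', of h] linear_compose[OF _ linear_b, of h] by (auto simp: o_def)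

text \<open>\<open>B\<close> is the Levi-Civita connection on left invariant fields, given by the Koszul formula.\<close>

lemma ex_torsion_free_isometric:
  assumes br: "bilinear br" and alt: "\<And>a. br a a = 0"
    and X: "\<And>v w. b X (br v w) = 0" "\<And>v. br X v = 0"
  obtains B where "bilinear B" "\<And>a c. B a c - B c a = br a c"
    "\<And>z y. b y (B z y) = 0" "\<And>z y. b X (B z y) = 0"
proof -
  have lin: "linear (br a)" "linear (\<lambda>a. br a c)" for a c using br by (auto simp: bilinear_def)
  note skew = alternating_imp_skew[OF br alt]
  let ?f = "\<lambda>a c d. 1/2 * (b d (br a c) - b a (br c d) + b c (br d a))"
  have "linear (\<lambda>d. (1/2) *\<^sub>R (b d (br a c) - b a (br c d) + b c (br d a)))"
    "linear (\<lambda>c. (1/2) *\<^sub>R (b d (br a c) - b a (br c d) + b c (br d a)))"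
    "linear (\<lambda>a. (1/2) *\<^sub>R (b d (br a c) - b a (br c d) + b c (br d a)))" for a c d
    by (intro linear_compose_scale_right linear_compose_add linear_compose_sub b_linear_family lin linear_b linear_b')+
  then have f: "linear (?f a c)" "linear (\<lambda>c. ?f a c d)" "linear (\<lambda>a. ?f a c d)" for a c d
    unfolding real_scaleR_def by blast+
  obtain B where B: "bilinear B" "\<And>a c d. b d (B a c) = ?f a c d"
    using ex_bilinear_representation[of ?f, OF f] by blast
  show thesis
  proof (rule that[OF B(1)])
    show "B a c - B c a = br a c" for a c
    proof (rule b_cancel)
      fix d
      show "b d (B a c - B c a) = b d (br a c)"
        using skew[of c a] skew[of d c] skew[of d a] by (simp add: b_simps B(2) field_simps)
    qed
    show "b y (B z y) = 0" for z y using skew[of y z] by (simp add: B(2) alt b_simps)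
    \<comment> \<open>All three Koszul terms vanish for \<open>d = X\<close>, since \<open>X\<close>
      is central and orthogonal to the brackets: \<open>X\<close> is parallel.\<close>
    show "b X (B z y) = 0" for z y using skew[of y X] by (simp add: B(2) X b_simps)
  qed
qed

end

text \<open>The derivative of \<phi> is required on a closed interval because
  \<open>\<beta>/\<alpha>\<close> attains the end points at multiples of \<open>X\<close>.
  Continuity of \<open>\<phi>'\<close> at 0 serves for vectors nearly orthogonal to
  \<open>X\<close>.\<close>

locale alpha_beta_norm = minkowski M + inner_form b
  for M :: "real ^ 'n::finite \<Rightarrow> real" and b +
  fixes X :: "real ^ 'n" and \<phi> \<phi>' :: "real \<Rightarrow> real"
  assumes M_eq: "M y = (sqrt (b y y) * \<phi> (b X y / sqrt (b y y)))\<^sup>2"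
    and has_derivative_\<phi>: "\<bar>s\<bar> \<le> sqrt (b X X) \<Longrightarrow> (\<phi> has_real_derivative \<phi>' s) (at s)"
    and isCont_\<phi>': "isCont \<phi>' 0"
begin

lemma \<beta>_over_\<alpha>_bound:
  assumes y: "y \<noteq> 0"
  shows "\<bar>b X y / sqrt (b y y)\<bar> \<le> sqrt (b X X)"
proof -
  have "\<bar>b X y\<bar> \<le> sqrt (b X X * b y y)"
    using cauchy_schwarz[of X y] by (metis real_sqrt_abs real_sqrt_le_iff)
  then show ?thesis using b_pos[OF y] by (simp add: real_sqrt_mult divide_simps)
qed

lemma has_derivative_b_quadratic: "((\<lambda>y. b y y) has_derivative (\<lambda>v. 2 * b y v)) (at y)"
proof -
  have "((\<lambda>y. b y y) has_derivative (\<lambda>w. b w y + b y w)) (at y)"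
    by (rule has_derivative_linear_family[OF open_UNIV UNIV_I linear_b])
      (auto intro: linear_imp_has_derivative linear_b')
  then show ?thesis by (simp add: b_sym[of _ y])
qed

lemma has_derivative_\<alpha>:
  assumes y: "y \<noteq> 0"
  shows "((\<lambda>y. sqrt (b y y)) has_derivative (\<lambda>v. b y v / sqrt (b y y))) (at y)"
proof -
  have "(sqrt has_derivative (*) (inverse (sqrt (b y y)) / 2)) (at (b y y))"
    using DERIV_real_sqrt[OF b_pos[OF y]] by (simp add: has_field_derivative_def)
  note d = has_derivative_compose[OF has_derivative_b_quadratic this]
  have "sqrt (b y y) \<noteq> 0" using b_pos[OF y] by simp
  then have "inverse (sqrt (b y y)) / 2 * (2 * b y v) = b y v / sqrt (b y y)" for v
    by (simp add: field_simps)
  with d show ?thesis by simp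
qed

lemma has_derivative_\<beta>: "(b X has_derivative b X) (at y)"
  by (rule linear_imp_has_derivative[OF linear_b])

text \<open>The vector \<open>v\<close> enters only through \<open>b y v\<close> and
  \<open>b X v\<close>. Hence a linear map that is skew for \<open>b\<close> and has image
  orthogonal to \<open>X\<close> is an infinitesimal isometry for every \<phi>.\<close>

lemma M1_eq:
  assumes y: "y \<noteq> 0"
  defines "\<alpha> \<equiv> sqrt (b y y)"
  defines "s \<equiv> b X y / \<alpha>"
  shows "M1 y v = 2 * \<phi> s * ((\<phi> s - s * \<phi>' s) * b y v + \<alpha> * \<phi>' s * b X v)"
proof -
  have \<alpha>: "\<alpha> > 0" using b_pos[OF y] by (simp add: \<alpha>_def)
  note d\<alpha> = has_derivative_\<alpha>[OF y, folded \<alpha>_def]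
  have ds: "((\<lambda>y. b X y / sqrt (b y y)) has_derivative (\<lambda>v. b X v / \<alpha> - s * (b y v / \<alpha>) / \<alpha>)) (at y)"
  proof (rule has_derivative_eq_rhs)
    show "((\<lambda>y. b X y / sqrt (b y y)) has_derivative
      (\<lambda>v. (b X v * \<alpha> - b X y * (b y v / \<alpha>)) / (\<alpha> * \<alpha>))) (at y)"
      using has_derivative_divide'[OF has_derivative_\<beta> has_derivative_\<alpha>[OF y]] \<alpha>
      by (simp add: \<alpha>_def[symmetric])
  qed (use \<alpha> in \<open>auto simp: s_def field_simps\<close>)
  have "((\<lambda>y. \<phi> (b X y / sqrt (b y y))) has_derivative (\<lambda>v. \<phi>' s * (b X v / \<alpha> - s * (b y v / \<alpha>) / \<alpha>))) (at y)"
    using diff_chain_at[OF ds] has_derivative_\<phi>[OF \<beta>_over_\<alpha>_bound[OF y]]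
    unfolding has_field_derivative_def by (simp add: o_def s_def \<alpha>_def)
  from has_derivative_power[OF has_derivative_mult[OF has_derivative_\<alpha>[OF y] this], of 2]
  have "(M has_derivative (\<lambda>v. 2 * (\<alpha> * (\<phi>' s * (b X v / \<alpha> - s * (b y v / \<alpha>) / \<alpha>)) + b y v / \<alpha> * \<phi> s) * (\<alpha> * \<phi> s))) (at y)"
    unfolding M_eq[abs_def] by (simp add: \<alpha>_def[symmetric] s_def[symmetric] algebra_simps)
  from has_derivative_unique[OF has_derivative_M[OF y] this]
  have "M1 y v = 2 * (\<alpha> * (\<phi>' s * (b X v / \<alpha> - s * (b y v / \<alpha>) / \<alpha>)) + b y v / \<alpha> * \<phi> s) * (\<alpha> * \<phi> s)" by metis
  moreover have "\<alpha> * (\<phi>' s * (b X v / \<alpha> - s * (b y v / \<alpha>) / \<alpha>)) = \<phi>' s * b X v - \<phi>' s * s * b y v / \<alpha>"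
    using \<alpha> by (simp add: field_simps)
  ultimately have "M1 y v = 2 * \<phi> s * ((\<phi>' s * b X v - \<phi>' s * s * b y v / \<alpha> + b y v / \<alpha> * \<phi> s) * \<alpha>)"
    by (simp only: mult_ac)
  also have "(\<phi>' s * b X v - \<phi>' s * s * b y v / \<alpha> + b y v / \<alpha> * \<phi> s) * \<alpha>
      = (\<phi> s - s * \<phi>' s) * b y v + \<alpha> * \<phi>' s * b X v"
    using \<alpha> by (simp add: field_simps)
  finally show ?thesis .
qed

lemma M1_orthogonal:
  "y \<noteq> 0 \<Longrightarrow> b y v = 0 \<Longrightarrow> b X v = 0 \<Longrightarrow> M1 y v = 0"
  by (simp add: M1_eq)

lemma \<phi>_nonzero: "y \<noteq> 0 \<Longrightarrow> \<phi> (b X y / sqrt (b y y)) \<noteq> 0"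
  using M_pos[of y] by (auto simp: M_eq)

lemma isometry_equation:
  assumes iso: "\<And>y. y \<noteq> 0 \<Longrightarrow> M1 y (K y) = 0" and y: "b y y = 1"
  shows "(\<phi> (b X y) - b X y * \<phi>' (b X y)) * b y (K y) + \<phi>' (b X y) * b X (K y) = 0"
proof -
  have y0: "y \<noteq> 0" using y by (auto simp: b_simps)
  show ?thesis using iso[OF y0] \<phi>_nonzero[OF y0] by (simp add: M1_eq[OF y0] y)
qed

text \<open>An infinitesimal linear isometry that moves \<open>X\<close> in a direction \<open>w\<close> orthogonal to it forces the
  differential equation \<open>\<phi>' (1 - c s\<^sup>2) = - c s \<phi>\<close>, whose solutions \<open>\<phi>\<^sup>2 = k (1 - c s\<^sup>2)\<close> give
  Euclidean norms.\<close>

lemma isometry_imp_quadratic: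
  assumes K: "linear K" and iso: "\<And>y. y \<noteq> 0 \<Longrightarrow> M1 y (K y) = 0"
    and X: "X \<noteq> 0" and w: "b X w = 0" "b w w = 1" and Kw: "b X (K w) \<noteq> 0" and KX: "b X (K X) = 0"
  shows "\<exists>q. bilinear q \<and> (\<forall>v w. q v w = q w v) \<and> (\<forall>y. M y = q y y)"
proof -
  define \<beta> where "\<beta> = sqrt (b X X)"
  have \<beta>: "\<beta> > 0" "b X X = \<beta>\<^sup>2" using b_pos[OF X] b_nonneg[of X] by (auto simp: \<beta>_def)
  \<comment> \<open>Makes \<open>b X (K w) + b w (K X)\<close> equal to
    \<open>c * \<beta>\<^sup>2 * b X (K w)\<close>, so that \<open>b X (K w)\<close> can be
    cancelled from the isometry equation.\<close>
  define c where "c = (b X (K w) + b w (K X)) / (\<beta>\<^sup>2 * b X (K w))"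
  have ode: "\<phi>' s * (1 - c * s\<^sup>2) = - c * s * \<phi> s" and nz: "\<phi> s \<noteq> 0" if s: "\<bar>s\<bar> < \<beta>" for s
  proof -
    define r where "r = sqrt (1 - s\<^sup>2 / \<beta>\<^sup>2)"
    have "s\<^sup>2 < \<beta>\<^sup>2" using s \<beta> by (metis abs_ge_zero power2_abs power_strict_mono zero_less_numeral)
    then have r: "r > 0" "r\<^sup>2 = 1 - s\<^sup>2 / \<beta>\<^sup>2" using \<beta> by (auto simp: r_def)
    \<comment> \<open>For \<open>t = 1\<close> and \<open>t = -1\<close> these are the two unit
      vectors in the plane of \<open>X\<close> and \<open>w\<close> whose product with
      \<open>X\<close> is \<open>s\<close>. Comparing their isometry equations isolates the part
      \<open>A\<close> that is odd in \<open>t\<close>.\<close>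
    define y where "y t = (s / \<beta>\<^sup>2) *\<^sub>R X + (t * r) *\<^sub>R w" for t
    have bXy: "b X (y t) = s" for t using \<beta> w by (simp add: y_def b_simps)
    have byy: "b (y t) (y t) = 1" if "t\<^sup>2 = 1" for t
    proof -
      have "b (y t) (y t) = (s / \<beta>\<^sup>2)\<^sup>2 * \<beta>\<^sup>2 + t\<^sup>2 * r\<^sup>2"
        using \<beta>(2) w b_sym[of w X] by (simp add: y_def b_simps power2_eq_square)
      then show ?thesis using that r(2) \<beta>(1) by (simp add: power2_eq_square)
    qed
    have byK: "b (y t) (K (y t)) = (s / \<beta>\<^sup>2) * t * r * (b X (K w) + b w (K X)) + t\<^sup>2 * r\<^sup>2 * b w (K w)"
      and bXK: "b X (K (y t)) = t * r * b X (K w)" for t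
      by (simp_all add: y_def b_simps linear_add[OF K] linear_scale[OF K] KX power2_eq_square algebra_simps add_divide_distrib)
    let ?\<psi> = "\<phi> s - s * \<phi>' s"
    define A where "A = r * (?\<psi> * (s / \<beta>\<^sup>2) * (b X (K w) + b w (K X)) + \<phi>' s * b X (K w))"
    have "t * A + ?\<psi> * (r\<^sup>2 * b w (K w)) = 0" if t: "t\<^sup>2 = 1" for t
    proof -
      have "?\<psi> * b (y t) (K (y t)) + \<phi>' s * b X (K (y t)) = 0"
        using isometry_equation[OF iso byy[OF t]] by (simp add: bXy)
      then have "?\<psi> * ((s / \<beta>\<^sup>2) * t * r * (b X (K w) + b w (K X)) + r\<^sup>2 * b w (K w)) + \<phi>' s * (t * r * b X (K w)) = 0"
        by (simp only: byK bXK t mult_1)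
      then show ?thesis unfolding A_def by (simp only: distrib_left mult_ac add_ac)
    qed
    from this[of 1] this[of "-1"] have "A = 0" by simp
    then have "?\<psi> * (s / \<beta>\<^sup>2) * (b X (K w) + b w (K X)) + \<phi>' s * b X (K w) = 0"
      using r by (simp add: A_def)
    moreover have "b X (K w) + b w (K X) = c * \<beta>\<^sup>2 * b X (K w)" using \<beta>(1) Kw by (simp add: c_def)
    ultimately have "?\<psi> * (s / \<beta>\<^sup>2) * (c * \<beta>\<^sup>2 * b X (K w)) + \<phi>' s * b X (K w) = 0" by simp
    moreover have "?\<psi> * (s / \<beta>\<^sup>2) * (c * \<beta>\<^sup>2 * b X (K w)) = ?\<psi> * s * c * b X (K w)"
      using \<beta>(1) by simp
    ultimately have "b X (K w) * (?\<psi> * s * c + \<phi>' s) = 0" by (simp only: distrib_left mult_ac)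
    then have "?\<psi> * s * c + \<phi>' s = 0" using Kw by simp
    then show "\<phi>' s * (1 - c * s\<^sup>2) = - c * s * \<phi> s" by (simp add: power2_eq_square algebra_simps)
    have "y 1 \<noteq> 0" using byy[of 1] by (auto simp: b_simps)
    from \<phi>_nonzero[OF this] show "\<phi> s \<noteq> 0" using bXy byy[of 1] by simp
  qed
  have cs: "1 - c * s\<^sup>2 \<noteq> 0" if "\<bar>s\<bar> < \<beta>" for s
    using ode[OF that] nz[OF that] by auto
  have d\<phi>: "(\<phi> has_real_derivative \<phi>' s) (at s)" if "\<bar>s\<bar> \<le> \<beta>" for s
    using has_derivative_\<phi> that by (simp add: \<beta>_def)
  have const: "(\<phi> s)\<^sup>2 / (1 - c * s\<^sup>2) = (\<phi> 0)\<^sup>2" if s: "\<bar>s\<bar> < \<beta>" for s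
  proof -
    have "((\<lambda>s. (\<phi> s)\<^sup>2 / (1 - c * s\<^sup>2)) has_derivative (\<lambda>h. 0)) (at t)" if t: "t \<in> {-\<beta><..<\<beta>}" for t
    proof -
      have t': "\<bar>t\<bar> < \<beta>" using t by auto
      have "((\<lambda>s. (\<phi> s)\<^sup>2 / (1 - c * s\<^sup>2)) has_real_derivative
         (2 * \<phi> t * \<phi>' t * (1 - c * t\<^sup>2) - (\<phi> t)\<^sup>2 * (- c * (2 * t))) / ((1 - c * t\<^sup>2) * (1 - c * t\<^sup>2))) (at t)"
        using d\<phi>[of t] t' cs[OF t'] by (auto intro!: derivative_eq_intros simp: mult_ac)
      moreover have "2 * \<phi> t * \<phi>' t * (1 - c * t\<^sup>2) - (\<phi> t)\<^sup>2 * (- c * (2 * t)) = 0"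
      proof -
        have "2 * \<phi> t * \<phi>' t * (1 - c * t\<^sup>2) - (\<phi> t)\<^sup>2 * (- c * (2 * t))
          = 2 * \<phi> t * (\<phi>' t * (1 - c * t\<^sup>2) + c * t * \<phi> t)"
          by (simp add: power2_eq_square algebra_simps)
        then show ?thesis using ode[OF t'] by simp
      qed
      ultimately have "((\<lambda>s. (\<phi> s)\<^sup>2 / (1 - c * s\<^sup>2)) has_real_derivative 0) (at t)" by simp
      moreover have "(*) (0 :: real) = (\<lambda>h. 0)" by (simp add: fun_eq_iff)
      ultimately show ?thesis by (simp add: has_field_derivative_def)
    qed
    moreover have "s \<in> {-\<beta><..<\<beta>}" "0 \<in> {-\<beta><..<\<beta>}" using s \<beta>(1) by auto
    ultimately have "(\<phi> s)\<^sup>2 / (1 - c * s\<^sup>2) = (\<phi> 0)\<^sup>2 / (1 - c * 0\<^sup>2)"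
      by (rule has_derivative_zero_unique_connected[OF open_greaterThanLessThan connected_Ioo])
    then show ?thesis by simp
  qed
  define k where "k = (\<phi> 0)\<^sup>2"
  \<comment> \<open>The end points \<open>\<bar>s\<bar> = \<beta>\<close> belong to multiples of
    \<open>X\<close> and are reached by continuity.\<close>
  have "(\<phi> s)\<^sup>2 - k * (1 - c * s\<^sup>2) = 0" if s: "\<bar>s\<bar> \<le> \<beta>" for s
  proof (rule continuous_constant_on_closure[where S="{-\<beta><..<\<beta>}" and f="\<lambda>s. (\<phi> s)\<^sup>2 - k * (1 - c * s\<^sup>2)"])
    have cl: "closure {-\<beta><..<\<beta>} = {-\<beta>..\<beta>}" using \<beta>(1) by simp
    have "isCont \<phi> t" if "t \<in> {-\<beta>..\<beta>}" for t
      using DERIV_isCont[OF d\<phi>[of t]] that by auto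
    then have "continuous_on {-\<beta>..\<beta>} \<phi>" by (simp add: continuous_at_imp_continuous_on)
    then show "continuous_on (closure {-\<beta><..<\<beta>}) (\<lambda>s. (\<phi> s)\<^sup>2 - k * (1 - c * s\<^sup>2))"
      unfolding cl by (intro continuous_intros)
    show "s \<in> closure {-\<beta><..<\<beta>}" using s unfolding cl by auto
    fix t assume "t \<in> {-\<beta><..<\<beta>}"
    then have "\<bar>t\<bar> < \<beta>" by auto
    from const[OF this] cs[OF this] show "(\<phi> t)\<^sup>2 - k * (1 - c * t\<^sup>2) = 0"
      by (simp add: k_def divide_eq_eq)
  qed
  then have sq: "(\<phi> s)\<^sup>2 = k * (1 - c * s\<^sup>2)" if "\<bar>s\<bar> \<le> \<beta>" for s using that by simp
  define q where "q v w = k * (b v w - c * (b X v * b X w))" for v w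
  have "bilinear q"
    unfolding bilinear_def q_def by (auto intro!: linearI simp: b_simps algebra_simps)
  moreover have "q v w = q w v" for v w by (simp add: q_def b_sym[of v w])
  moreover have "M y = q y y" for y
  proof (cases "y = 0")
    case False
    have "M y = b y y * (k * (1 - c * (b X y / sqrt (b y y))\<^sup>2))"
      using sq[OF \<beta>_over_\<alpha>_bound[OF False, folded \<beta>_def]] b_nonneg[of y] by (simp add: M_eq power_mult_distrib)
    also have "(b X y / sqrt (b y y))\<^sup>2 = (b X y)\<^sup>2 / b y y" by (simp add: power_divide b_nonneg)
    also have "b y y * (k * (1 - c * ((b X y)\<^sup>2 / b y y))) = q y y"
    proof -
      have "t * (k * (1 - c * (a / t))) = k * (t - c * a)" if "t > 0" for t a :: real
        using that by (simp add: field_simps)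
      from this[OF b_pos[OF False]] show ?thesis by (simp add: q_def power2_eq_square)
    qed
    finally show ?thesis .
  qed (simp add: M_eq q_def b_simps)
  ultimately show ?thesis by blast
qed

text \<open>A nonzero \<open>b X (K w)\<close> with \<open>w\<close> orthogonal to \<open>X\<close>
  would make the norm Euclidean. With this component gone, the isometry equation reads
  \<open>(\<phi> - s \<phi>') b y (K y) = 0\<close>. The first factor is seen to be nonzero near
  \<open>s = 0\<close>, so skewness is proved near the hyperplane orthogonal to \<open>X\<close> and
  extended by linearity.\<close>

lemma isometry_fixes:
  assumes K: "linear K" and iso: "\<And>y. y \<noteq> 0 \<Longrightarrow> M1 y (K y) = 0" and X: "X \<noteq> 0"
    and nq: "\<not> (\<exists>q. bilinear q \<and> (\<forall>v w. q v w = q w v) \<and> (\<forall>y. M y = q y y))"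
  shows "b X (K y) = 0" and "b y (K y) = 0"
proof -
  have XX: "b X X > 0" by (rule b_pos[OF X])
  \<comment> \<open>At \<open>y = X\<close> one has \<open>s = \<alpha>\<close>, and the terms with
    \<open>\<phi>'\<close> cancel.\<close>
  have KX: "b X (K X) = 0"
    using iso[OF X] \<phi>_nonzero[OF X] XX by (simp add: M1_eq[OF X] real_div_sqrt algebra_simps)
  have Kperp: "b X (K w) = 0" if w: "b X w = 0" for w
  proof (rule ccontr)
    assume n: "b X (K w) \<noteq> 0"
    then have "w \<noteq> 0" by (auto simp: linear_0[OF K] b_simps)
    then have ww: "b w w > 0" by (rule b_pos)
    let ?w = "(1 / sqrt (b w w)) *\<^sub>R w"
    have "b X ?w = 0" "b ?w ?w = 1" "b X (K ?w) \<noteq> 0"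
      using w n ww by (simp_all add: b_simps linear_scale[OF K])
    from isometry_imp_quadratic[OF K iso X this KX] nq show False by blast
  qed
  have decomp: "b X (v - (b X v / b X X) *\<^sub>R X) = 0" for v using XX by (simp add: b_simps)
  show \<lambda>: "b X (K y) = 0" for y
    using Kperp[OF decomp[of y]] by (simp add: linear_diff[OF K] linear_scale[OF K] b_simps KX)
  have perp: "b w (K w) = 0" if w: "b X w = 0" for w
  proof (cases "w = 0")
    case False
    show ?thesis using iso[OF False] \<phi>_nonzero[OF False] by (simp add: M1_eq[OF False] \<lambda> w)
  qed (simp add: linear_0[OF K] b_simps)
  have cross: "b w (K X) = 0" if w: "b X w = 0" for w
  proof (cases "w = 0")
    case False
    note ww = b_pos[OF False]
    \<comment> \<open>At \<open>w\<close> itself \<open>K X\<close> does not occur, so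
      \<open>w\<close> is tilted to \<open>\<epsilon> *\<^sub>R X + w\<close>, and
      \<open>s \<epsilon>\<close> is the value of \<open>\<beta>/\<alpha>\<close> there. Continuity
      provides some \<open>\<epsilon> \<noteq> 0\<close> for which the factor
      \<open>\<phi> - s \<phi>'\<close> is nonzero.\<close>
    define s where "s \<epsilon> = \<epsilon> * b X X / sqrt (\<epsilon>\<^sup>2 * b X X + b w w)" for \<epsilon>
    have "isCont s 0" unfolding s_def using ww by (intro continuous_intros) auto
    moreover have s0: "s 0 = 0" by (simp add: s_def)
    ultimately have "isCont (\<lambda>\<epsilon>. \<phi>' (s \<epsilon>)) 0" "isCont (\<lambda>\<epsilon>. \<phi> (s \<epsilon>)) 0"
      using isCont_\<phi>' DERIV_isCont[OF has_derivative_\<phi>[of 0]] XX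
      by (auto intro: isCont_o2)
    then have "isCont (\<lambda>\<epsilon>. \<phi> (s \<epsilon>) - s \<epsilon> * \<phi>' (s \<epsilon>)) 0" using \<open>isCont s 0\<close> by (intro continuous_intros)
    moreover have "\<phi> (s 0) - s 0 * \<phi>' (s 0) \<noteq> 0" using \<phi>_nonzero[OF False] w by (simp add: s0)
    ultimately have "eventually (\<lambda>\<epsilon>. \<phi> (s \<epsilon>) - s \<epsilon> * \<phi>' (s \<epsilon>) \<noteq> 0) (at 0)"
      unfolding isCont_def by (rule tendsto_imp_eventually_ne)
    then have "eventually (\<lambda>\<epsilon>. \<phi> (s \<epsilon>) - s \<epsilon> * \<phi>' (s \<epsilon>) \<noteq> 0 \<and> \<epsilon> \<noteq> 0) (at 0)"
      by (simp add: eventually_conj_iff eventually_neq_at_within)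
    then obtain \<epsilon> where \<epsilon>: "\<phi> (s \<epsilon>) - s \<epsilon> * \<phi>' (s \<epsilon>) \<noteq> 0" "\<epsilon> \<noteq> 0"
      using eventually_happens'[OF at_neq_bot] by blast
    let ?y = "\<epsilon> *\<^sub>R X + w"
    have wX: "b w X = 0" using w b_sym by metis
    have byy: "b ?y ?y = \<epsilon>\<^sup>2 * b X X + b w w" by (simp add: b_simps w wX power2_eq_square)
    have "b ?y ?y > 0" unfolding byy using ww XX by (simp add: add_nonneg_pos)
    then have y0: "?y \<noteq> 0" using linear_0[OF linear_b] by (metis less_irrefl)
    have s: "b X ?y / sqrt (b ?y ?y) = s \<epsilon>" unfolding byy by (simp add: s_def b_simps w)
    have "b ?y (K ?y) = 0"
      using iso[OF y0] \<phi>_nonzero[OF y0] \<epsilon>(1) unfolding M1_eq[OF y0] s by (simp add: \<lambda>)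
    moreover have "b ?y (K ?y) = \<epsilon> * b w (K X)"
      by (simp add: b_simps linear_add[OF K] linear_scale[OF K] \<lambda> perp[OF w])
    ultimately show ?thesis using \<epsilon> by simp
  qed (simp add: b_simps)
  show "b y (K y) = 0"
  proof -
    let ?a = "b X y / b X X" let ?w = "y - ?a *\<^sub>R X"
    have w: "b X ?w = 0" by (rule decomp)
    have "b y (K y) = b (?w + ?a *\<^sub>R X) (K (?w + ?a *\<^sub>R X))" by simp
    also have "\<dots> = b ?w (K ?w) + ?a * b ?w (K X)"
      by (simp only: b_simps linear_add[OF K] linear_scale[OF K] \<lambda>) simp
    finally show ?thesis by (simp add: perp[OF w] cross[OF w])
  qed
qed

lemma quadratic_spray_imp:
  assumes Q: "bilinear Q" and br: "bilinear br" and alt: "\<And>a. br a a = 0"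
    and spray: "\<And>y z. y \<noteq> 0 \<Longrightarrow> M2 y z (Q y y) = M1 y (br y z)"
    and nq: "X \<noteq> 0 \<Longrightarrow> \<not> (\<exists>q. bilinear q \<and> (\<forall>v w. q v w = q w v) \<and> (\<forall>y. M y = q y y))"
  shows "b X (br y z) = 0" and "b z (br X z) = 0"
proof -
  have lin: "linear (br a)" "linear (\<lambda>a. br a c)" "linear (Q a)" "linear (\<lambda>a. Q a c)" for a c
    using Q br by (auto simp: bilinear_def)
  note skew = alternating_imp_skew[OF br alt]
  have "b X (br y z) = 0 \<and> b z (br X z) = 0" for y z
  proof (cases "X = 0")
    case False
    let ?K = "\<lambda>z y. Q z y + Q y z + br y z"
    have K: "linear (?K z)" for z by (intro linear_compose_add lin)
    have iso: "M1 y (?K z y) = 0" if "y \<noteq> 0" for y z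
      by (rule quadratic_spray_isometry[OF Q br alt spray that])
    note fix1 = isometry_fixes(1)[OF K iso False nq[OF False]]
    note fix2 = isometry_fixes(2)[OF K iso False nq[OF False]]
    \<comment> \<open>In \<open>?K z y - ?K y z\<close> the symmetric terms cancel and twice the
      bracket remains.\<close>
    have 1: "b X (br y z) = 0"
      using fix1[of z y] fix1[of y z] skew[of z y] by (simp add: b_simps)
    \<comment> \<open>Polarized skewness moves \<open>?K z\<close> from \<open>X\<close> to
      \<open>v\<close>, where its value is orthogonal to \<open>X\<close>.\<close>
    have KX: "?K z X = 0" for z
    proof (rule b_cancel)
      fix v
      have "b (v + X) (?K z (v + X)) = 0" by (rule fix2)
      moreover have "b v (?K z v) = 0" by (rule fix2)
      moreover have "b X (?K z X) = 0" by (rule fix2)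
      ultimately have "b v (?K z X) + b X (?K z v) = 0"
        by (simp add: linear_add[OF K] b_simps linear_add[OF lin(1)] linear_add[OF lin(2)]
            linear_add[OF lin(3)] linear_add[OF lin(4)])
      then show "b v (?K z X) = b v 0" by (simp add: fix1 b_simps(7))
    qed
    \<comment> \<open>Since \<open>?K z X\<close> vanishes, \<open>ad X\<close> is a multiple of
      \<open>?K X\<close> and inherits its skewness.\<close>
    have "?K X z = ?K z X - 2 *\<^sub>R br X z" using skew[of z X] by (simp add: scaleR_2)
    then have "?K X z = - 2 *\<^sub>R br X z" by (simp only: KX) simp
    with fix2[of z X] have "b z (- 2 *\<^sub>R br X z) = 0" by metis
    then have 2: "b z (br X z) = 0" by (simp add: b_simps)
    show ?thesis using 1 2 by blast
  qed (simp add: b_simps linear_0[OF lin(2)])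
  then show "b X (br y z) = 0" "b z (br X z) = 0" by blast+
qed

end

section \<open>Randers norms\<close>

locale randers_norm = minkowski M + inner_form b
  for M :: "real ^ 'n::finite \<Rightarrow> real" and b +
  fixes X :: "real ^ 'n"
  assumes M_randers: "M y = (sqrt (b y y) + b X y)\<^sup>2"
    and N_nonneg: "sqrt (b y y) + b X y \<ge> 0"
begin

sublocale alpha_beta_norm M b X "\<lambda>s. 1 + s" "\<lambda>s. 1"
proof
  fix y
  show "M y = (sqrt (b y y) * (1 + b X y / sqrt (b y y)))\<^sup>2"
    using b_pos[of y] by (cases "y = 0") (auto simp: M_randers distrib_left b_simps)
qed (auto intro!: derivative_eq_intros)

abbreviation N where "N y \<equiv> sqrt (b y y) + b X y"
abbreviation N1 where "N1 y v \<equiv> b y v / sqrt (b y y) + b X v"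

lemma N_pos: "y \<noteq> 0 \<Longrightarrow> N y > 0"
  using M_pos[of y] N_nonneg[of y] by (cases "N y = 0") (auto simp: M_randers)

lemma M1_randers: "y \<noteq> 0 \<Longrightarrow> M1 y v = 2 * (N y * N1 y v)"
  using b_pos[of y] by (simp add: M1_eq field_simps)

lemma M2_randers:
  assumes y: "y \<noteq> 0"
  shows "M2 y v w = 2 * (N1 y w * N1 y v + N y * (b w v / sqrt (b y y) - b y v * b y w / (sqrt (b y y)) ^ 3))"
proof -
  define \<alpha> where "\<alpha> = sqrt (b y y)"
  have \<alpha>: "\<alpha> > 0" using b_pos[OF y] by (simp add: \<alpha>_def)
  note d\<alpha> = has_derivative_\<alpha>[OF y, folded \<alpha>_def]
  have "((\<lambda>y. b y v) has_derivative (\<lambda>w. b w v)) (at y)"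
    by (rule linear_imp_has_derivative[OF linear_b'])
  from has_derivative_divide[OF this d\<alpha>, folded \<alpha>_def]
  have "((\<lambda>y. b y v / sqrt (b y y)) has_derivative (\<lambda>w. b w v / \<alpha> - b y v * b y w / \<alpha> ^ 3)) (at y)"
    by (rule has_derivative_eq_rhs) (use \<alpha> in \<open>auto simp: divide_inverse power3_eq_cube algebra_simps \<alpha>_def[symmetric]\<close>)
  from has_derivative_mult_right[OF has_derivative_mult[OF has_derivative_add[OF d\<alpha> has_derivative_\<beta>] has_derivative_add[OF this has_derivative_const]], of 2 "b X v"]
  have "((\<lambda>y. 2 * (N y * N1 y v)) has_derivative
    (\<lambda>w. 2 * (N1 y w * N1 y v + N y * (b w v / \<alpha> - b y v * b y w / \<alpha> ^ 3)))) (at y)"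
    by (rule has_derivative_eq_rhs) (auto simp: algebra_simps \<alpha>_def[symmetric])
  then have "((\<lambda>y. M1 y v) has_derivative
    (\<lambda>w. 2 * (N1 y w * N1 y v + N y * (b w v / \<alpha> - b y v * b y w / \<alpha> ^ 3)))) (at y)"
    by (rule has_derivative_transform_within_open[OF _ open_nonzero]) (use y M1_randers in auto)
  from has_derivative_unique[OF has_derivative_M1[OF y] this] show ?thesis unfolding \<alpha>_def by metis
qed

lemma douglas_imp_closed:
  assumes Q: "bilinear Q" and br: "bilinear br" and alt: "\<And>a. br a a = 0"
    and spray: "\<And>y z. y \<noteq> 0 \<Longrightarrow> M2 y z (Q y y + P y *\<^sub>R y) = M1 y (br y z)"
  shows "b X (br y z) = 0"
proof (cases "y = 0")
  case False
  have lin: "linear (br a)" "linear (\<lambda>a. br a c)" "linear (Q a)" "linear (\<lambda>a. Q a c)" for a c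
    using Q br by (auto simp: bilinear_def)
  have eq: "b (Q y y) z / sqrt (b y y) - b y z * b y (Q y y) / (sqrt (b y y)) ^ 3 = N1 y (br y z)"
    if y: "y \<noteq> 0" for y
  proof -
    let ?\<alpha> = "sqrt (b y y)" let ?S = "Q y y + P y *\<^sub>R y"
    have \<alpha>: "?\<alpha> > 0" "b y y = ?\<alpha>\<^sup>2" using b_pos[OF y] by auto
    have E: "N1 y ?S * N1 y z + N y * (b ?S z / ?\<alpha> - b y z * b y ?S / ?\<alpha> ^ 3) = N y * N1 y (br y z)" for z
      using spray[OF y, of z] by (simp add: M2_randers[OF y] M1_randers[OF y])
    \<comment> \<open>The second-order part of the Hessian annihilates \<open>y\<close>. So
      \<open>z = y\<close> leaves \<open>N1 y ?S * N1 y y = 0\<close>, and for the same reason the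
      multiple of \<open>y\<close> in \<open>?S\<close> drops out below.\<close>
    have "b ?S y / ?\<alpha> - b y y * b y ?S / ?\<alpha> ^ 3 = 0"
      using \<alpha>(1) by (subst \<alpha>(2)) (simp add: b_sym[of y ?S] power3_eq_cube power2_eq_square)
    then have "N1 y ?S * N1 y y = 0" using E[of y] by (simp add: alt b_simps)
    moreover have "N1 y y = N y" by (simp add: real_div_sqrt b_nonneg)
    ultimately have "N1 y ?S = 0" using N_pos[OF y] by simp
    then have "N y * (b ?S z / ?\<alpha> - b y z * b y ?S / ?\<alpha> ^ 3) = N y * N1 y (br y z)" using E[of z] by simp
    then have 1: "b ?S z / ?\<alpha> - b y z * b y ?S / ?\<alpha> ^ 3 = N1 y (br y z)" using N_pos[OF y] by simp
    have "b y z * (P y * b y y) / ?\<alpha> ^ 3 = P y * b y z / ?\<alpha>"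
      using \<alpha>(1) by (subst \<alpha>(2)) (simp add: power3_eq_cube power2_eq_square)
    then have "b ?S z / ?\<alpha> - b y z * b y ?S / ?\<alpha> ^ 3 = b (Q y y) z / ?\<alpha> - b y z * b y (Q y y) / ?\<alpha> ^ 3"
      by (simp add: b_simps distrib_left add_divide_distrib)
    with 1 show ?thesis by simp
  qed
  \<comment> \<open>in \<open>eq\<close>, only the term \<open>b X (br y z)\<close> is odd in \<open>y\<close>\<close>
  have "Q (- y) (- y) = Q y y" by (simp add: linear_neg[OF lin(3)] linear_neg[OF lin(4)])
  then show ?thesis
    using eq[OF False] eq[of "- y"] False by (simp add: b_simps linear_neg[OF lin(2)])
next
  case True
  have "linear (\<lambda>a. br a z)" using br by (simp add: bilinear_def)
  from linear_0[OF this] show ?thesis by (simp add: True b_simps)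
qed

text \<open>\<open>Q\<close> yields the spray vector of the Riemannian norm of \<open>b\<close>. As
  \<open>X\<close> is orthogonal to the brackets, the Randers equation adds only the requirement
  that \<open>N1 y\<close> vanish on the spray vector, and the multiple \<open>P y\<close> of
  \<open>y\<close> is chosen to meet it.\<close>

lemma closed_imp_douglas:
  assumes br: "bilinear br" and alt: "\<And>a. br a a = 0" and X: "\<And>v w. b X (br v w) = 0"
  obtains Q P where "bilinear Q" "\<And>y z. y \<noteq> 0 \<Longrightarrow> M2 y z (Q y y + P y *\<^sub>R y) = M1 y (br y z)"
proof -
  have lin: "linear (br a)" "linear (\<lambda>a. br a c)" for a c using br by (auto simp: bilinear_def)
  obtain Q where Q: "bilinear Q" "\<And>a c d. b d (Q a c) = b a (br c d)"
    using ex_bilinear_representation[of "\<lambda>a c d. b a (br c d)"] b_linear_family lin linear_b' by blast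
  define P where "P y = - N1 y (Q y y) / N y" for y
  have "M2 y z (Q y y + P y *\<^sub>R y) = M1 y (br y z)" if y: "y \<noteq> 0" for y z
  proof -
    let ?\<alpha> = "sqrt (b y y)" let ?S = "Q y y + P y *\<^sub>R y"
    have \<alpha>: "?\<alpha> > 0" "b y y = ?\<alpha>\<^sup>2" using b_pos[OF y] by auto
    have bQ: "b y (Q y y) = 0" by (simp add: Q alt b_simps)
    have "N1 y y = N y" by (simp add: real_div_sqrt b_nonneg)
    moreover have "N1 y ?S = N1 y (Q y y) + P y * N1 y y"
      by (simp add: b_simps add_divide_distrib distrib_left)
    ultimately have "N1 y ?S = N1 y (Q y y) + P y * N y" by simp
    then have N1S: "N1 y ?S = 0" using N_pos[OF y] by (simp add: P_def)
    have "b y z * (P y * b y y) / ?\<alpha> ^ 3 = P y * b y z / ?\<alpha>"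
      using \<alpha>(1) by (subst \<alpha>(2)) (simp add: power3_eq_cube power2_eq_square)
    then have "b ?S z / ?\<alpha> - b y z * b y ?S / ?\<alpha> ^ 3 = b (Q y y) z / ?\<alpha>"
      by (simp add: b_simps distrib_left add_divide_distrib bQ)
    also have "b (Q y y) z = b y (br y z)" by (simp add: b_sym[of _ z] Q)
    finally show ?thesis
      by (simp add: M2_randers[OF y] M1_randers[OF y] N1S X)
  qed
  then show thesis using that Q(1) by blast
qed

end

section \<open>Left invariant metrics\<close>

text \<open>Links the matrix condition in \<open>finsler_metric\<close> to the Hessian of the
  squared metric. It stands outside the locales because it is what establishes their positivity
  assumption.\<close>

lemma fundamental_tensor_quadratic_form:
  assumes smooth: "smooth_on (- {0}) (\<lambda>y. (L p y)\<^sup>2)" and y: "y \<noteq> 0"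
  shows "v \<bullet> (fundamental_tensor L p y *v v)
    = 1/2 * \<D> (\<lambda>z. \<D> (\<lambda>y. (L p y)\<^sup>2) z v) y v"
proof -
  let ?M = "\<lambda>y. (L p y)\<^sup>2"
  let ?H = "\<lambda>a w. \<D> (\<lambda>z. \<D> ?M z a) y w"
  note sm = smooth_on_derivative[OF smooth]
  have opn: "open (- {0 :: real ^ 'a})" by (rule open_Compl[OF closed_singleton])
  have y': "y \<in> - {0}" using y by simp
  have H: "((\<lambda>z. \<D> ?M z a) has_derivative ?H a) (at y)" for a
    by (rule frechet_derivative_has[OF smooth_on_differentiable[OF sm y']])
  have "partial_deriv ?M j z = \<D> ?M z (axis j 1)" if "z \<in> - {0}" for j z
    by (rule partial_deriv_eq[OF frechet_derivative_has[OF smooth_on_differentiable[OF smooth that]]])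
  then have "((\<lambda>z. partial_deriv ?M j z) has_derivative ?H (axis j 1)) (at y)" for j
    by (intro has_derivative_transform_within_open[OF H opn y']) simp
  from partial_deriv_eq[OF this]
  have "fundamental_tensor L p y $ i $ j = 1/2 * ?H (axis j 1) (axis i 1)" for i j
    by (simp add: fundamental_tensor_def)
  moreover have sym: "?H a w = ?H w a" for a w by (rule second_derivative_symmetric[OF opn smooth y'])
  ultimately have g: "fundamental_tensor L p y $ i $ j = 1/2 * ?H (axis i 1) (axis j 1)" for i j
    by metis
  have linH: "linear (?H a)" for a using H by (rule has_derivative_linear)
  have "v \<bullet> (fundamental_tensor L p y *v v) = 1/2 * (\<Sum>i\<in>UNIV. (\<Sum>j\<in>UNIV. ?H (axis i 1) (axis j 1) * v $ j) * v $ i)"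
  proof -
    have "(\<Sum>i\<in>UNIV. v $ i * (\<Sum>j\<in>UNIV. 1/2 * h i j * v $ j))
        = 1/2 * (\<Sum>i\<in>UNIV. (\<Sum>j\<in>UNIV. h i j * v $ j) * v $ i)" for h :: "'a \<Rightarrow> 'a \<Rightarrow> real"
      by (simp add: sum_distrib_left sum_distrib_right mult_ac)
    then show ?thesis by (simp only: inner_vec_def matrix_vector_mult_def g inner_real_def vec_lambda_beta)
  qed
  moreover have "(\<Sum>j\<in>UNIV. ?H (axis i 1) (axis j 1) * v $ j) = ?H v (axis i 1)" for i
    by (rule trans[OF linear_axis_expansion_real[OF linH] sym])
  ultimately show ?thesis by (simp only: linear_axis_expansion_real[OF linH])
qed

context lie
begin

lemma coframe_unit: "coframe e0 q0 v = v"
  using coframe_frame[OF chart_at(1) q0_in_image, of v] by (simp add: frame_unit)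

lemma bracket_self: "bracket a a = 0"
  by (simp add: bracket_eq)

text \<open>At the unit the coframe of the chart \<open>e0\<close> is the identity, so the local
  conditions on \<open>F\<close> there are conditions on \<open>F unit\<close>.\<close>

lemma minkowski_left_invariant:
  assumes fins: "finsler_metric A F" and inv: "left_invariant_finsler G A F"
  shows "minkowski (\<lambda>y. (F unit y)\<^sup>2)"
proof
  have ic: "in_chart A F e0 q0 y = F unit y" for y
    using left_invariant_in_chart[OF chart_at(1) q0_in_image] inv
    by (simp add: left_invariant_finsler_def coframe_unit)
  have opn: "open (- {0 :: real ^ 'n})" by (rule open_Compl[OF closed_singleton])
  have "smooth_on (chart_image e0 \<times> (UNIV - {0})) (\<lambda>(p, y). in_chart A F e0 p y)"
    using fins chart_at(1) by (simp add: finsler_metric_def)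
  then have "smooth_on (- {0}) (\<lambda>y. (\<lambda>(p, y). in_chart A F e0 p y) (q0, y))"
    by (intro smooth_on_compose[OF opn _ smooth_on_Pair[OF opn smooth_on_const smooth_on_ident]])
      (auto intro!: open_Times open_chart_image is_chart chart_at open_Diff)
  then have N: "smooth_on (- {0}) (F unit)" by (simp add: ic)
  from smooth_on_scaleR[OF opn N N]
  show sm: "smooth_on (- {0}) (\<lambda>y. (F unit y)\<^sup>2)" by (simp add: power2_eq_square)
  show "(F unit (l *\<^sub>R y))\<^sup>2 = l\<^sup>2 * (F unit y)\<^sup>2" if "l > 0" for l y
    using fins that by (simp add: finsler_metric_def power_mult_distrib)
  fix y v :: "real ^ 'n" assume y: "y \<noteq> 0" and v: "v \<noteq> 0"
  have "v \<bullet> (fundamental_tensor (in_chart A F e0) q0 y *v v) > 0"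
    using fins chart_at(1) y v by (simp add: finsler_metric_def)
  then show "\<D> (\<lambda>z. \<D> (\<lambda>y. (F unit y)\<^sup>2) z v) y v > 0"
    using fundamental_tensor_quadratic_form[of "in_chart A F e0" q0 y v] sm y by (simp add: ic)
qed

lemma finsler_coframe_chart:
  assumes fins: "finsler_metric A F" and inv: "left_invariant_finsler G A F" and c: "c \<in> charts A"
  shows "finsler_coframe (\<lambda>y. (F unit y)\<^sup>2) (chart_image c) (coframe c) (frame c) bracket (in_chart A F c)"
proof -
  interpret minkowski "\<lambda>y. (F unit y)\<^sup>2" by (rule minkowski_left_invariant[OF fins inv])
  show ?thesis
  proof
    show "open (chart_image c)" by (rule open_chart_image[OF is_chart[OF c]])
    show "(in_chart A F c p y)\<^sup>2 = (F unit (coframe c p y))\<^sup>2" if "p \<in> chart_image c" for p y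
      using left_invariant_in_chart[OF c that] inv by (simp add: left_invariant_finsler_def)
  qed (simp_all add: linear_add[OF linear_coframe] linear_scale[OF linear_coframe] frame_coframe coframe_frame coframe_differentiable maurer_cartan c
      bilinear_bracket)
qed

text \<open>Smoothness is given for \<open>F\<close> only, and off the zero section; polarizing its
  square in the coordinate vectors recovers smooth metric coefficients.\<close>

lemma quadratic_imp_riemannian:
  assumes fins: "finsler_metric A F" and inv: "left_invariant_finsler G A F"
    and q: "bilinear q" "\<And>v w. q v w = q w v" "\<And>y. (F unit y)\<^sup>2 = q y y"
  shows "is_riemannian A F"
proof -
  interpret minkowski "\<lambda>y. (F unit y)\<^sup>2" by (rule minkowski_left_invariant[OF fins inv])
  have linq: "linear (q v)" "linear (\<lambda>v. q v w)" for v w using q(1) by (auto simp: bilinear_def)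
  let ?\<theta> = "\<lambda>x. left_translation_differential G A (iv x) x"
  have \<theta>_eq: "?\<theta> x = coframe (chart_at A x) (snd (chart_at A x) x)" for x
    by (simp add: left_translation_differential_eq coframe_def chart_inv_chart is_chart chart_at)
  have p: "snd (chart_at A x) x \<in> chart_image (chart_at A x)" for x
    by (simp add: chart_in_image is_chart chart_at)
  have lin\<theta>: "linear (?\<theta> x)" for x unfolding \<theta>_eq by (rule linear_coframe[OF chart_at(1) p])
  define h where "h x v w = q (?\<theta> x v) (?\<theta> x w)" for x v w
  have F: "F x y = sqrt (h x y y)" for x y
  proof -
    have "F x y = F unit (?\<theta> x y)" using inv by (simp add: left_invariant_finsler_def)
    moreover have "F x y \<ge> 0" using fins by (simp add: finsler_metric_def)
    ultimately show ?thesis by (simp add: h_def q(3)[symmetric])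
  qed
  have "bilinear (h x)" for x
    unfolding bilinear_def h_def
    using linear_compose[OF lin\<theta> linq(1)] linear_compose[OF lin\<theta> linq(2)] by (simp add: o_def)
  moreover have "h x v w = h x w v" for x v w by (simp add: h_def q(2))
  moreover have "h x v v > 0" if "v \<noteq> 0" for x v
  proof -
    have "?\<theta> x v \<noteq> 0"
      using frame_coframe[OF chart_at(1) p, of x v] that linear_0[OF linear_frame[OF chart_at(1) p]]
      unfolding \<theta>_eq by metis
    from M_pos[OF this] show ?thesis by (simp add: h_def q(3))
  qed
  moreover have "smooth_on (chart_image c)
      (\<lambda>p. h (chart_inv c p) (tangent_vector A c p (axis i 1)) (tangent_vector A c p (axis j 1)))"
    if c: "c \<in> charts A" for c i j
  proof -
    let ?L = "in_chart A F c" and ?i = "axis i 1 :: real ^ 'n" and ?j = "axis j 1 :: real ^ 'n"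
    have opn: "open (chart_image c)" by (rule open_chart_image[OF is_chart[OF c]])
    have sL: "smooth_on (chart_image c) (\<lambda>p. ?L p y * ?L p y)" if y: "y \<noteq> 0" for y
    proof -
      have "smooth_on (chart_image c \<times> (UNIV - {0})) (\<lambda>(p, y). in_chart A F c p y)"
        using fins c by (simp add: finsler_metric_def)
      then have "smooth_on (chart_image c) (\<lambda>p. (\<lambda>(p, y). in_chart A F c p y) (p, y))"
        using y by (intro smooth_on_compose[OF opn _ smooth_on_Pair[OF opn smooth_on_ident smooth_on_const]])
          (auto intro!: open_Times opn open_Diff)
      then have "smooth_on (chart_image c) (\<lambda>p. ?L p y)" by simp
      from smooth_on_scaleR[OF opn this this] show ?thesis by simp
    qed
    \<comment> \<open>Polarization evaluates \<open>F\<close> at this sum, where smoothness is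
      available only for a nonzero vector.\<close>
    have "?i + ?j \<noteq> 0"
    proof
      assume "?i + ?j = 0"
      then have "(?i + ?j) $ i = 0" by simp
      then show False by (simp add: axis_def split: if_splits)
    qed
    then have "smooth_on (chart_image c) (\<lambda>p. (1/2) *\<^sub>R (?L p (?i + ?j) * ?L p (?i + ?j)
        + ((-1) *\<^sub>R (?L p ?i * ?L p ?i) + (-1) *\<^sub>R (?L p ?j * ?L p ?j))))"
      by (intro smooth_on_scaleR smooth_on_add smooth_on_const opn sL) (auto simp: axis_eq_0_iff)
    moreover have "h (chart_inv c p) (tangent_vector A c p ?i) (tangent_vector A c p ?j)
      = (1/2) *\<^sub>R (?L p (?i + ?j) * ?L p (?i + ?j)
        + ((-1) *\<^sub>R (?L p ?i * ?L p ?i) + (-1) *\<^sub>R (?L p ?j * ?L p ?j)))" if p: "p \<in> chart_image c" for p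
    proof -
      have L: "?L p y * ?L p y = q (coframe c p y) (coframe c p y)" for y
        using left_invariant_in_chart[OF c p] inv q(3)
        by (simp add: left_invariant_finsler_def power2_eq_square)
      show ?thesis
        unfolding L h_def left_translation_tangent_vector[OF c p]
        by (simp add: linear_add[OF linear_coframe[OF c p]] linear_add[OF linq(1)] linear_add[OF linq(2)]
            q(2)[of "coframe c p ?j" "coframe c p ?i"])
    qed
    ultimately show ?thesis by (subst smooth_on_cong[OF opn]) auto
  qed
  ultimately have "riemannian_metric A h" by (simp add: riemannian_metric_def)
  then show ?thesis using F unfolding is_riemannian_def by blast
qed

end

section \<open>Douglas and Berwald conditions on the group\<close>

theorem theorem5p1:
  fixes G :: "('g::{t2_space,second_countable_topology}) monoid"
    and A :: "('g, 'n::finite) chart set"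
    and g :: "'g \<Rightarrow> real ^ 'n \<Rightarrow> real ^ 'n \<Rightarrow> real"
    and X :: "'g \<Rightarrow> real ^ 'n"
    and F :: "'g \<Rightarrow> real ^ 'n \<Rightarrow> real"
    and u :: "real ^ 'n"
  assumes "family_G2 G A"
    and "riemannian_metric A g" and "left_invariant_riemannian G A g"
    and "left_invariant_field G A X"
    and "alpha_beta_metric A g X F" and "left_invariant_finsler G A F"
    and "u \<in> commutator_lie_algebra G A" and "g \<one>\<^bsub>G\<^esub> u u = 1"
  shows "((\<forall>x y. F x y = sqrt (g x y y) + g x (X x) y) \<longrightarrow>
            (douglas_type A F \<longleftrightarrow> X \<one>\<^bsub>G\<^esub> \<in> orthogonal_hyperplane G g u))
       \<and> ((X \<one>\<^bsub>G\<^esub> \<noteq> 0 \<longrightarrow> \<not> is_riemannian A F) \<longrightarrow>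
            (berwald_type A F \<longleftrightarrow> X \<one>\<^bsub>G\<^esub> \<in> orthogonal_hyperplane G g u \<inter> lie_center G A))"
proof -
  interpret lie G A using assms(1) by (simp add: lie_def family_G2_def)
  let ?b = "g unit" and ?X = "X unit" and ?M = "\<lambda>y. (F unit y)\<^sup>2"
  note inv = assms(6)
  have fins: "finsler_metric A F" using assms(5) by (simp add: alpha_beta_metric_def)
  interpret minkowski ?M by (rule minkowski_left_invariant[OF fins inv])
  interpret inner_form ?b
    using assms(2) by (unfold_locales) (auto simp: riemannian_metric_def)
  note alt = bracket_self and bil = bilinear_bracket
  have coframe_loc: "finsler_coframe ?M (chart_image c) (coframe c) (frame c) bracket (in_chart A F c)"
    if "c \<in> charts A" for c
    by (rule finsler_coframe_chart[OF fins inv that])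
  have u0: "u \<noteq> 0" using assms(8) by (auto simp: b_simps)
  \<comment> \<open>By dimension one the span of the commutator algebra is the line through
    \<open>u\<close>.\<close>
  have span_u: "\<exists>r. bracket v w = r *\<^sub>R u" for v w
  proof -
    have "span {u} = span (commutator_lie_algebra G A)"
    proof (rule subspace_dim_equal[OF subspace_span subspace_span])
      show "span {u} \<subseteq> span (commutator_lie_algebra G A)" using assms(7) by (simp add: span_mono)
      show "dim (span (commutator_lie_algebra G A)) \<le> dim (span {u})"
        using assms(1) u0 by (simp add: family_G2_def dim_span)
    qed
    then show ?thesis using bracket_in_span[of v w] by (auto simp: span_singleton)
  qed
  \<comment> \<open>A nonzero bracket is a nonzero multiple of \<open>u\<close>; through it
    orthogonality to all brackets yields orthogonality to \<open>u\<close>.\<close>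
  obtain v0 w0 where "bracket v0 w0 \<noteq> 0"
    using assms(1) by (metis bracket_nonzero family_G2_def)
  then obtain r0 where r0: "bracket v0 w0 = r0 *\<^sub>R u" "r0 \<noteq> 0" using span_u by (metis scaleR_zero_left)
  have hyp: "?X \<in> orthogonal_hyperplane G g u \<longleftrightarrow> (\<forall>v w. ?b ?X (bracket v w) = 0)"
  proof
    assume "?X \<in> orthogonal_hyperplane G g u"
    then have "?b ?X u = 0" by (simp add: orthogonal_hyperplane_def)
    moreover have "\<exists>r. bracket v w = r *\<^sub>R u" for v w by (rule span_u)
    ultimately show "\<forall>v w. ?b ?X (bracket v w) = 0"
      using linear_scale[OF linear_b] by (metis mult_zero_right real_scaleR_def)
  next
    assume "\<forall>v w. ?b ?X (bracket v w) = 0"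
    then have "?b ?X (r0 *\<^sub>R u) = 0" using r0 by metis
    then show "?X \<in> orthogonal_hyperplane G g u" using r0 by (simp add: orthogonal_hyperplane_def b_simps)
  qed
  have "douglas_type A F \<longleftrightarrow> ?X \<in> orthogonal_hyperplane G g u"
    if randers: "\<forall>x y. F x y = sqrt (g x y y) + g x (X x) y"
  proof -
    interpret R: randers_norm ?M ?b ?X
    proof
      show "(F unit y)\<^sup>2 = (sqrt (?b y y) + ?b ?X y)\<^sup>2" for y using randers by simp
      show "sqrt (?b y y) + ?b ?X y \<ge> 0" for y
        using randers fins by (simp add: finsler_metric_def)
    qed
    show ?thesis
    proof
      assume D: "douglas_type A F"
      interpret C: finsler_coframe ?M "chart_image e0" "coframe e0" "frame e0" bracket "in_chart A F e0"
        by (rule coframe_loc[OF chart_at(1)])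
      from D chart_at(1)[of unit] obtain \<Gamma> P where
        "\<forall>p\<in>chart_image e0. \<forall>y. y \<noteq> 0 \<longrightarrow> (\<forall>i. spray_coeff (in_chart A F e0) i p y =
               1/2 * (\<Sum>j\<in>UNIV. \<Sum>k\<in>UNIV. \<Gamma> i j k p * y $ j * y $ k) + P p y * y $ i)"
        unfolding douglas_type_def by blast
      then have sp: "\<And>y i. y \<noteq> 0 \<Longrightarrow> spray_coeff (in_chart A F e0) i q0 y =
               1/2 * (\<Sum>j\<in>UNIV. \<Sum>k\<in>UNIV. \<Gamma> i j k q0 * y $ j * y $ k) + P q0 y * y $ i"
        using q0_in_image by blast
      obtain Q where Q: "bilinear Q"
        "\<And>\<eta> z. \<eta> \<noteq> 0 \<Longrightarrow> M2 \<eta> z (Q \<eta> \<eta> - (2 * P q0 (frame e0 q0 \<eta>)) *\<^sub>R \<eta>) = M1 \<eta> (bracket \<eta> z)"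
        using C.quadratic_spray_vector[OF q0_in_image, of "\<lambda>i j k. \<Gamma> i j k q0" "P q0", OF sp] by blast
      have "?b ?X (bracket v w) = 0" for v w
        by (rule R.douglas_imp_closed[OF Q(1) bil alt, where P="\<lambda>\<eta>. - (2 * P q0 (frame e0 q0 \<eta>))"])
          (use Q(2) in simp)
      then show "?X \<in> orthogonal_hyperplane G g u" by (simp add: hyp)
    next
      assume "?X \<in> orthogonal_hyperplane G g u"
      then have closed: "\<And>v w. ?b ?X (bracket v w) = 0" by (simp add: hyp)
      obtain Q P where Q: "bilinear Q"
        and QP: "\<And>y z. y \<noteq> 0 \<Longrightarrow> M2 y z (Q y y + P y *\<^sub>R y) = M1 y (bracket y z)"
        using R.closed_imp_douglas[OF bil alt closed] by blast
      show "douglas_type A F"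
        unfolding douglas_type_def
      proof (intro ballI)
        fix c assume c: "c \<in> charts A"
        interpret C: finsler_coframe ?M "chart_image c" "coframe c" "frame c" bracket "in_chart A F c"
          by (rule coframe_loc[OF c])
        let ?\<Gamma> = "\<lambda>i j k p. frame c p (C.DE p (axis j 1) (axis k 1) - Q (coframe c p (axis j 1)) (coframe c p (axis k 1))) $ i"
        let ?P = "\<lambda>p y. - 1/2 * P (coframe c p y)"
        have "?P p (l *\<^sub>R y) = l * ?P p y" if "p \<in> chart_image c" "y \<noteq> 0" "l > 0" for p y l
          using spray_factor_homogeneous[OF Q bil QP C.E_nonzero[OF that(1,2)] that(3)]
          by (simp add: linear_scale[OF C.linear_E[OF that(1)]])
        moreover have "spray_coeff (in_chart A F c) i p y =
               1/2 * (\<Sum>j\<in>UNIV. \<Sum>k\<in>UNIV. ?\<Gamma> i j k p * y $ j * y $ k) + ?P p y * y $ i"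
          if "p \<in> chart_image c" "y \<noteq> 0" for p y i
          by (rule C.douglas_spray_coeff[OF that(1) Q QP that(2)])
        ultimately show "\<exists>\<Gamma> P.
          (\<forall>p\<in>chart_image c. \<forall>y. y \<noteq> 0 \<longrightarrow> (\<forall>l>0. P p (l *\<^sub>R y) = l * P p y)) \<and>
          (\<forall>p\<in>chart_image c. \<forall>y. y \<noteq> 0 \<longrightarrow> (\<forall>i.
             spray_coeff (in_chart A F c) i p y =
               1/2 * (\<Sum>j\<in>UNIV. \<Sum>k\<in>UNIV. \<Gamma> i j k p * y $ j * y $ k) + P p y * y $ i))"
          by (intro exI[of _ ?\<Gamma>] exI[of _ ?P]) blast
      qed
    qed
  qed
  moreover have "berwald_type A F \<longleftrightarrow> ?X \<in> orthogonal_hyperplane G g u \<inter> lie_center G A"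
    if nr: "?X \<noteq> 0 \<longrightarrow> \<not> is_riemannian A F"
  proof -
    obtain \<phi> b0 where \<phi>: "smooth_on {s. ereal \<bar>s\<bar> < b0} \<phi>" "\<And>x. ereal (sqrt (g x (X x) (X x))) < b0"
      "\<And>x y. F x y = sqrt (g x y y) * \<phi> (g x (X x) y / sqrt (g x y y))"
      using assms(5) unfolding alpha_beta_metric_def by blast
    define \<phi>' where "\<phi>' s = \<D> \<phi> s 1" for s
    have opn: "open {s. ereal \<bar>s\<bar> < b0}"
      by (intro open_Collect_less continuous_intros)
    \<comment> \<open>The bound on the length of \<open>X\<close> is strict, so the whole closed
      interval of values of \<open>\<beta>/\<alpha>\<close> lies in the open domain of
      \<phi>.\<close>
    have small: "s \<in> {s. ereal \<bar>s\<bar> < b0}" if "\<bar>s\<bar> \<le> sqrt (?b ?X ?X)" for s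
      using that \<phi>(2)[of unit] by (metis (mono_tags, lifting) ereal_less_eq(3) le_less_trans mem_Collect_eq)
    interpret AB: alpha_beta_norm ?M ?b ?X \<phi> \<phi>'
    proof
      show "(F unit y)\<^sup>2 = (sqrt (?b y y) * \<phi> (?b ?X y / sqrt (?b y y)))\<^sup>2" for y by (simp add: \<phi>(3))
      fix s assume "\<bar>s\<bar> \<le> sqrt (?b ?X ?X)"
      then have d: "\<phi> differentiable (at s)" using smooth_on_differentiable[OF \<phi>(1) small] by simp
      have "\<D> \<phi> s = (*) (\<phi>' s)"
      proof
        fix t
        show "\<D> \<phi> s t = \<phi>' s * t"
          using linear_scale[OF linear_frechet_derivative[OF d], of t 1] by (simp add: \<phi>'_def mult.commute)
      qed
      then show "(\<phi> has_real_derivative \<phi>' s) (at s)"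
        using frechet_derivative_has[OF d] by (simp add: has_field_derivative_def)
    next
      have "continuous_on {s. ereal \<bar>s\<bar> < b0} \<phi>'"
        unfolding \<phi>'_def by (rule smooth_on_continuous[OF smooth_on_derivative[OF \<phi>(1)]])
      then show "isCont \<phi>' 0" using opn small[of 0] b_nonneg by (simp add: continuous_on_eq_continuous_at)
    qed
    show ?thesis
    proof
      assume B: "berwald_type A F"
      interpret C: finsler_coframe ?M "chart_image e0" "coframe e0" "frame e0" bracket "in_chart A F e0"
        by (rule coframe_loc[OF chart_at(1)])
      obtain Q where Q: "bilinear Q" "\<And>\<eta> z. \<eta> \<noteq> 0 \<Longrightarrow> M2 \<eta> z (Q \<eta> \<eta>) = M1 \<eta> (bracket \<eta> z)"
        using C.berwald_imp_quadratic_spray[OF q0_in_image] B chart_at(1)[of unit] q0_in_image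
        unfolding berwald_type_def by metis
      \<comment> \<open>The exclusion of Riemannian \<open>F\<close> enters here, as a condition on
        the norm at the unit.\<close>
      have nq: "\<not> (\<exists>q. bilinear q \<and> (\<forall>v w. q v w = q w v) \<and> (\<forall>y. ?M y = q y y))" if "?X \<noteq> 0"
        using quadratic_imp_riemannian[OF fins inv] nr that by blast
      note * = AB.quadratic_spray_imp[OF Q(1) bil alt Q(2) nq]
      have "bracket ?X w = 0" for w
      proof -
        obtain f where f: "\<And>w. bracket ?X w = f w *\<^sub>R u" using span_u by metis
        have lin: "linear (bracket ?X)" using bil by (simp add: bilinear_def)
        \<comment> \<open>\<open>ad X\<close> is skew with values in the line of \<open>u\<close>,
          so \<open>f w\<close> vanishes unless \<open>w\<close> is orthogonal to \<open>u\<close>.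
          In that case \<open>w + u\<close> has the same bracket with \<open>X\<close> and is not
          orthogonal to \<open>u\<close>.\<close>
        have fu: "f w * ?b w u = 0" for w using *(2)[of w] by (simp add: f b_simps)
        have "f u = 0" using fu[of u] assms(8) by simp
        then have "f (w + u) *\<^sub>R u = f w *\<^sub>R u" using linear_add[OF lin, of w u] by (simp add: f)
        then have "f (w + u) = f w" using u0 by simp
        then have "f w = 0" using fu[of w] fu[of "w + u"] assms(8) by (auto simp: b_simps)
        then show ?thesis by (simp add: f)
      qed
      then show "?X \<in> orthogonal_hyperplane G g u \<inter> lie_center G A"
        using *(1) by (simp add: hyp lie_center_def)
    next
      assume X: "?X \<in> orthogonal_hyperplane G g u \<inter> lie_center G A"
      then have "\<And>v w. ?b ?X (bracket v w) = 0" "\<And>v. bracket ?X v = 0"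
        by (simp_all add: hyp lie_center_def)
      from ex_torsion_free_isometric[OF bil alt this]
      obtain B where B: "bilinear B" "\<And>a c. B a c - B c a = bracket a c"
        "\<And>z y. ?b y (B z y) = 0" "\<And>z y. ?b ?X (B z y) = 0" by blast
      \<comment> \<open>The Levi-Civita maps are skew for \<open>g\<close> and have image orthogonal
        to \<open>X\<close>, which makes them isometries of the norm; one \<open>B\<close> serves
        all charts.\<close>
      have iso: "M1 y (B z y) = 0" if "y \<noteq> 0" for y z
        by (rule AB.M1_orthogonal[OF that B(3,4)])
      show "berwald_type A F"
        unfolding berwald_type_def
      proof (intro ballI allI impI)
        fix c p and y y' :: "real ^ 'n" and i j k
        assume c: "c \<in> charts A" and p: "p \<in> chart_image c" and y: "y \<noteq> 0" and y': "y' \<noteq> 0"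
        interpret C: finsler_coframe ?M "chart_image c" "coframe c" "frame c" bracket "in_chart A F c"
          by (rule coframe_loc[OF c])
        show "chern_christoffel (in_chart A F c) i j k p y = chern_christoffel (in_chart A F c) i j k p y'"
          by (rule trans[OF C.chern_christoffel_eq[OF p B(1,2) iso y]
                C.chern_christoffel_eq[OF p B(1,2) iso y', symmetric]])
      qed
    qed
  qed
  ultimately show ?thesis by blast
qed

end
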